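(* For a Banach space $X$, the following are equivalent: (1) $X^*$ has the Radon–Nikodým property (i.e. $X$ is an Asplund space); (2) $X$ has property $(A_\infty')$: every $L_\infty(X)$-bounded sequence of functions that converges scalarly a.e. (to some $f\in L_0(X)$) also converges weakly a.e.; (3) $X$ has property $(A_\infty)$: every $L_\infty(X)$-bounded sequence of functions that converges scalarly a.e. has a subsequence that converges weakly a.e.; (4) $X$ has property $(B_\infty)$: every $L_\infty(X)$-bounded sequence of functions that converges scalarly in measure (to some $f\in L_0(X)$) has a subsequence that converges weakly a.e.
   Context: $(\Omega,\Sigma,\mu)$ is the Lebesgue measure space on $[0,1]$. Banach spaces are real. $L_0(X)$ is the space of (classes of a.e. equal) strongly measurable functions $f:\Omega\to X$, and $L_p(X)$ ($1\le p\le\infty$) are the Bochner–Lebesgue spaces. For $f_n,f\in L_0(X)$: - $\{f_n\}$ converges scalarly a.e. to $f$ if for each $x^*\in X^*$, $x^*f_n\to x^*f$ almost everywhere (the exceptional null set may depend on $x^*$); - $\{f_n\}$ converges scalarly in measure to $f$ if for each $x^*\in X^*$, $x^*f_n\to x^*f$ in measure; - $\{f_n\}$ converges weakly a.e. to $f$ if there is a set $A$ of full measure (independent of $x^*$) such that $x^*f_n(\omega)\to x^*f(\omega)$ for all $\omega\in A$ and all $x^*\in X^*$. A sequence $\{f_n\}$ in $L_0(X)$ is $L_\infty(X)$-bounded if $\sup_n\|f_n\|_{L_\infty(X)}<\infty$. *)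

theory Defs
  imports "HOL-Analysis.Analysis" "HOL-Probability.Essential_Supremum"
begin

abbreviation unit_interval_measure :: "real measure" where
  "unit_interval_measure \<equiv> lebesgue_on {0..1}"

(* Elements of L_0(X), L_1(X), ... are represented by functions rather than by a.e.-classes; every
   property below is invariant under changing the functions on null sets. *)

(* The library's borel_measurable and has_bochner_integral are only usable for second countable
   target spaces, so strong measurability and the Bochner integral are defined here for arbitrary
   normed spaces. *)

definition strongly_measurable :: "'c measure \<Rightarrow> ('c \<Rightarrow> 'b::real_normed_vector) \<Rightarrow> bool" where
  "strongly_measurable M f \<longleftrightarrow>
     (\<exists>s. (\<forall>n::nat. simple_function M (s n)) \<and> (AE \<omega> in M. (\<lambda>n. s n \<omega>) \<longlonglongrightarrow> f \<omega>))"

(* f is Bochner integrable with integral x; the same as the library's has_bochner_integral, with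
   strong measurability in place of Borel measurability. *)
definition has_strong_bochner_integral ::
    "'c measure \<Rightarrow> ('c \<Rightarrow> 'b::real_normed_vector) \<Rightarrow> 'b \<Rightarrow> bool" where
  "has_strong_bochner_integral M f x \<longleftrightarrow>
     strongly_measurable M f \<and>
     (\<exists>s. (\<forall>n::nat. Bochner_Integration.simple_bochner_integrable M (s n)) \<and>
          (\<lambda>n. \<integral>\<^sup>+\<omega>. ennreal (norm (f \<omega> - s n \<omega>)) \<partial>M) \<longlonglongrightarrow> 0 \<and>
          (\<lambda>n. Bochner_Integration.simple_bochner_integral M (s n)) \<longlonglongrightarrow> x)"

definition vector_measure :: "'c measure \<Rightarrow> ('c set \<Rightarrow> 'b::real_normed_vector) \<Rightarrow> bool" where
  "vector_measure M G \<longleftrightarrow>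
     (\<forall>A::nat \<Rightarrow> 'c set. range A \<subseteq> sets M \<longrightarrow> disjoint_family A \<longrightarrow>
        (\<lambda>i. G (A i)) sums G (\<Union>i. A i))"

definition total_variation :: "'c measure \<Rightarrow> ('c set \<Rightarrow> 'b::real_normed_vector) \<Rightarrow> ennreal" where
  "total_variation M G =
     (SUP P\<in>{P. finite P \<and> P \<subseteq> sets M \<and> disjoint P \<and> \<Union>P = space M}. \<Sum>A\<in>P. ennreal (norm (G A)))"

definition continuous_wrt_measure ::
    "'c measure \<Rightarrow> ('c set \<Rightarrow> 'b::real_normed_vector) \<Rightarrow> bool" where
  "continuous_wrt_measure M G \<longleftrightarrow>
     (\<forall>\<epsilon>>0. \<exists>\<delta>>0. \<forall>E\<in>sets M. measure M E < \<delta> \<longrightarrow> norm (G E) < \<epsilon>)"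

definition radon_nikodym_property_wrt :: "'c measure \<Rightarrow> 'b::banach itself \<Rightarrow> bool" where
  "radon_nikodym_property_wrt M Y \<longleftrightarrow>
     (\<forall>G :: 'c set \<Rightarrow> 'b.
        vector_measure M G \<longrightarrow> total_variation M G < \<infinity> \<longrightarrow> continuous_wrt_measure M G \<longrightarrow>
        (\<exists>g. (\<exists>x. has_strong_bochner_integral M g x) \<and>
             (\<forall>E\<in>sets M. has_strong_bochner_integral M (\<lambda>\<omega>. indicator E \<omega> *\<^sub>R g \<omega>) (G E))))"

(* The first argument names the type of the points of the finite measure spaces ranged over, since
   HOL cannot quantify over that type inside a formula. The notion is meant to be used with a type
   variable 'c (universally quantified in a theorem) having at least as many elements as the
   reals; for a small type such as unit it would be trivial. *)
definition radon_nikodym_property :: "'c itself \<Rightarrow> 'b::banach itself \<Rightarrow> bool" where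
  "radon_nikodym_property C Y \<longleftrightarrow>
     (\<forall>M :: 'c measure. finite_measure M \<longrightarrow> radon_nikodym_property_wrt M Y)"

definition converges_scalarly_ae ::
    "(nat \<Rightarrow> real \<Rightarrow> 'a::real_normed_vector) \<Rightarrow> (real \<Rightarrow> 'a) \<Rightarrow> bool" where
  "converges_scalarly_ae f g \<longleftrightarrow>
     (\<forall>\<phi> :: 'a \<Rightarrow>\<^sub>L real.
        AE \<omega> in unit_interval_measure. (\<lambda>n. blinfun_apply \<phi> (f n \<omega>)) \<longlonglongrightarrow> blinfun_apply \<phi> (g \<omega>))"

definition converges_scalarly_in_measure ::
    "(nat \<Rightarrow> real \<Rightarrow> 'a::real_normed_vector) \<Rightarrow> (real \<Rightarrow> 'a) \<Rightarrow> bool" where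
  "converges_scalarly_in_measure f g \<longleftrightarrow>
     (\<forall>\<phi> :: 'a \<Rightarrow>\<^sub>L real. \<forall>\<epsilon>>0.
        (\<lambda>n. measure unit_interval_measure
               {\<omega> \<in> space unit_interval_measure.
                  \<bar>blinfun_apply \<phi> (f n \<omega>) - blinfun_apply \<phi> (g \<omega>)\<bar> \<ge> \<epsilon>}) \<longlonglongrightarrow> 0)"

definition converges_weakly_ae ::
    "(nat \<Rightarrow> real \<Rightarrow> 'a::real_normed_vector) \<Rightarrow> (real \<Rightarrow> 'a) \<Rightarrow> bool" where
  "converges_weakly_ae f g \<longleftrightarrow>
     (AE \<omega> in unit_interval_measure.
        \<forall>\<phi> :: 'a \<Rightarrow>\<^sub>L real. (\<lambda>n. blinfun_apply \<phi> (f n \<omega>)) \<longlonglongrightarrow> blinfun_apply \<phi> (g \<omega>))"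

definition Linf_bounded :: "(nat \<Rightarrow> real \<Rightarrow> 'a::real_normed_vector) \<Rightarrow> bool" where
  "Linf_bounded f \<longleftrightarrow>
     (\<forall>n. strongly_measurable unit_interval_measure (f n)) \<and>
     (SUP n. esssup unit_interval_measure (\<lambda>\<omega>. ennreal (norm (f n \<omega>)))) < \<infinity>"

definition property_A_inf' :: "'a::banach itself \<Rightarrow> bool" where
  "property_A_inf' X \<longleftrightarrow>
     (\<forall>(f :: nat \<Rightarrow> real \<Rightarrow> 'a) g.
        Linf_bounded f \<longrightarrow> strongly_measurable unit_interval_measure g \<longrightarrow>
        converges_scalarly_ae f g \<longrightarrow> converges_weakly_ae f g)"

definition property_A_inf :: "'a::banach itself \<Rightarrow> bool" where
  "property_A_inf X \<longleftrightarrow>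
     (\<forall>(f :: nat \<Rightarrow> real \<Rightarrow> 'a) g.
        Linf_bounded f \<longrightarrow> strongly_measurable unit_interval_measure g \<longrightarrow>
        converges_scalarly_ae f g \<longrightarrow>
        (\<exists>r. strict_mono r \<and> converges_weakly_ae (f \<circ> r) g))"

definition property_B_inf :: "'a::banach itself \<Rightarrow> bool" where
  "property_B_inf X \<longleftrightarrow>
     (\<forall>(f :: nat \<Rightarrow> real \<Rightarrow> 'a) g.
        Linf_bounded f \<longrightarrow> strongly_measurable unit_interval_measure g \<longrightarrow>
        converges_scalarly_in_measure f g \<longrightarrow>
        (\<exists>r. strict_mono r \<and> converges_weakly_ae (f \<circ> r) g))"

end

theory Submission
  imports Defs "HOL-Probability.Probability_Measure"
begin

text \<open>All properties are compared with the separability of the duals of separable subspaces, in the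
  form: every bounded countable set \<open>D\<close> of vectors admits countably many functionals that are dense
  in the whole dual with respect to uniform convergence on \<open>D\<close>. If this holds, then scalar
  convergence of a bounded sequence has to be tested on countably many functionals only.

  If it fails for \<open>D\<close> and \<open>\<epsilon>\<close>, the sets of functionals that cannot be covered by countably many
  \<open>\<epsilon>\<close>-balls can be split again and again by vectors of \<open>D\<close>. This gives functionals \<open>\<psi> s\<close> and
  vectors \<open>x s\<close>, indexed by finite sequences of bits, such that \<open>x s\<close> separates by a fixed gap the
  functionals above \<open>1s\<close> from those above \<open>0s\<close>. Taking weak-star limits of
  \<open>\<psi>\<close> along the bits of a point of the unit interval yields a vector measure without density. It
  also refutes \<open>(A_\<infinity>)\<close>: the averages over long blocks of levels \<open>k\<close> of \<open>\<plusminus> x (first k bits)\<close>, the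
  sign being given by the next bit, are scalarly averages of bounded martingale differences, hence
  null almost everywhere, but the functional attached to a point does not converge to 0 on them.

  Conversely, let \<open>G\<close> be a dual-valued vector measure, of Lipschitz type after truncation. If it has
  no density, some martingale of averages of \<open>G\<close> over refining finite partitions has increments that
  are bounded away from 0 in \<open>L\<^sub>1\<close>. These increments are normed by countably many vectors, so that
  separability of the dual makes the martingale uniformly close, on these vectors, to the martingale
  of a simple function, which converges.\<close>

section \<open>Filter limits and strongly measurable functions\<close>

text \<open>A single level of the tree gives \<open>\<plusminus> x s\<close>, whose scalar values
  are orthogonal but need not tend to 0. Averages over dyadic blocks have summable second moments
  and so tend to 0 almost everywhere, while the gap survives: once the midpoint
  \<open>a s + \<eta> / 2\<close> is subtracted it contributes at least \<open>\<eta> / 2\<close> at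
  every level, and the midpoints are themselves martingale coefficients that average to 0. Limits
  along branches and of vector measures must exist for uncountably many tests at once, where
  subsequences may fail; they are taken along filters finer than \<open>sequentially\<close>. Such a
  limit need not depend measurably on the point, so it is used at one fixed point only, or through
  its values on a countable set, where it agrees with limits of measurable functions. In the
  converse neither the sigma-algebra nor the space need be separable. Failures of approximation are
  therefore collected one at a time: each is witnessed by one finite partition, and the resulting
  sequence of partitions and finitely valued increments involves only countably many
  vectors.\<close>

abbreviation "sb_integrable \<equiv> Bochner_Integration.simple_bochner_integrable"
abbreviation "sb_integral \<equiv> Bochner_Integration.simple_bochner_integral"

lemma bounded_sequence_filter_limit:
  fixes u :: "nat \<Rightarrow> 'i \<Rightarrow> real"
  assumes "\<And>n i. \<bar>u n i\<bar> \<le> B i"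
  obtains F L where "F \<noteq> bot" "F \<le> sequentially" "\<And>i. ((\<lambda>n. u n i) \<longlongrightarrow> L i) F"
proof -
  define K where "K = PiE UNIV (\<lambda>i. {- B i..B i})"
  have "compactin (product_topology (\<lambda>i. euclidean) UNIV) K"
    unfolding K_def compactin_PiE by auto
  hence K: "compact K"
    by (simp add: euclidean_product_topology)
  have "eventually (\<lambda>f. f \<in> K) (filtermap u sequentially)"
    unfolding eventually_filtermap K_def using assms by (intro always_eventually allI PiE_I) (auto simp: abs_le_iff minus_le_iff)
  moreover have "filtermap u sequentially \<noteq> bot"
    by (simp add: filtermap_bot_iff)
  ultimately obtain L where L: "inf (nhds L) (filtermap u sequentially) \<noteq> bot"
    using K unfolding compact_filter by blast
  \<comment> \<open>The pulled back neighbourhoods of \<open>L\<close> force convergence to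
    \<open>L\<close>; meeting them with \<open>sequentially\<close> keeps every property that holds
    for all large indices, and the cluster property keeps the result proper.\<close>
  define F where "F = inf sequentially (filtercomap u (nhds L))"
  have "filtermap u F \<le> nhds L"
    unfolding F_def by (metis filtermap_filtercomap filtermap_mono inf_le2 order_trans)
  have "F \<noteq> bot"
  proof
    assume "F = bot"
    hence "eventually (\<lambda>_. False) F" by simp
    then obtain P Q where PQ: "eventually P sequentially" "eventually Q (filtercomap u (nhds L))"
       "\<And>x. P x \<Longrightarrow> Q x \<Longrightarrow> False"
      unfolding F_def eventually_inf by metis
    then obtain R where R: "eventually R (nhds L)" "\<And>x. R (u x) \<Longrightarrow> Q x"
      unfolding eventually_filtercomap by blast
    have "eventually (\<lambda>y. \<not> R y) (filtermap u sequentially)"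
      unfolding eventually_filtermap using PQ(1) by eventually_elim (use PQ(3) R(2) in blast)
    hence "eventually (\<lambda>_. False) (inf (nhds L) (filtermap u sequentially))"
      unfolding eventually_inf using R(1) by blast
    thus False using L by simp
  qed
  moreover have "((\<lambda>n. u n i) \<longlongrightarrow> L i) F" for i
  proof -
    have "(u \<longlongrightarrow> L) F" using \<open>filtermap u F \<le> nhds L\<close> by (simp add: filterlim_def)
    thus ?thesis
      using continuous_on_tendsto_compose[OF continuous_on_product_coordinates[of i]] by simp
  qed
  ultimately show ?thesis using that[of F L] by (auto simp: F_def)
qed

lemma AE_summable_of_summable_integrals:
  fixes f :: "nat \<Rightarrow> 'c \<Rightarrow> real"
  assumes meas [measurable]: "\<And>n. f n \<in> borel_measurable M"
    and le: "\<And>n. (\<integral>\<^sup>+w. ennreal (f n w) \<partial>M) \<le> ennreal (c n)"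
    and nonneg: "\<And>n w. 0 \<le> f n w" "\<And>n. 0 \<le> c n" and c: "summable c"
  shows "AE w in M. summable (\<lambda>n. f n w)"
proof -
  have "(\<integral>\<^sup>+w. (\<Sum>n. ennreal (f n w)) \<partial>M) = (\<Sum>n. \<integral>\<^sup>+w. ennreal (f n w) \<partial>M)"
    by (rule nn_integral_suminf) measurable
  also have "\<dots> \<le> (\<Sum>n. ennreal (c n))" by (intro suminf_le le) auto
  also have "\<dots> < \<infinity>"
    using suminf_ennreal2[OF nonneg(2) c] by simp
  finally have "AE w in M. (\<Sum>n. ennreal (f n w)) \<noteq> \<infinity>"
    by (intro nn_integral_PInf_AE) auto
  thus ?thesis
    by eventually_elim (auto intro: summable_suminf_not_top nonneg)
qed

text \<open>The values may lie in a nonseparable space; the argument uses only that a pair of simple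
  functions takes finitely many values, so that every function of the pair is again simple.\<close>

lemma borel_measurable_norm_diff_simple:
  fixes s t :: "'c \<Rightarrow> 'b::real_normed_vector"
  assumes "simple_function M s" "simple_function M t"
  shows "(\<lambda>w. norm (s w - t w)) \<in> borel_measurable M"
  by (rule borel_measurable_simple_function,
      rule simple_function_compose2[OF assms, where h = "\<lambda>x y. norm (x - y)"])

text \<open>By completeness the convergence set is given by the Cauchy criterion, which consists of
  countably many measurable conditions; outside it the approximants are set to 0. As
  \<open>M\<close> need not be complete, the version \<open>f'\<close> is what makes norms of
  differences measurable.\<close>

lemma strongly_measurable_everywhere:
  fixes f :: "'c \<Rightarrow> 'b::banach"
  assumes "strongly_measurable M f"
  obtains s f' where "\<And>n::nat. simple_function M (s n)"
    "\<And>w. w \<in> space M \<Longrightarrow> (\<lambda>n. s n w) \<longlonglongrightarrow> f' w" "AE w in M. f' w = f w"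
proof -
  obtain s where s: "\<And>n::nat. simple_function M (s n)" and lim: "AE w in M. (\<lambda>n. s n w) \<longlonglongrightarrow> f w"
    using assms unfolding strongly_measurable_def by blast
  have diff [measurable]: "(\<lambda>w. norm (s n w - s m w)) \<in> borel_measurable M" for n m
    by (intro borel_measurable_norm_diff_simple s)
  define A where "A = {w\<in>space M. \<forall>k. \<exists>n0. \<forall>n\<ge>n0. \<forall>m\<ge>n0. norm (s n w - s m w) < 1 / real (Suc k)}"
  have [measurable]: "A \<in> sets M" unfolding A_def by measurable
  have A: "w \<in> A \<longleftrightarrow> w \<in> space M \<and> convergent (\<lambda>n. s n w)" for w
  proof -
    have "Cauchy (\<lambda>n. s n w) \<longleftrightarrow> (\<forall>k. \<exists>n0. \<forall>n\<ge>n0. \<forall>m\<ge>n0. norm (s n w - s m w) < 1 / real (Suc k))"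
      unfolding metric_Cauchy_iff2 dist_norm inverse_eq_divide by (rule refl)
    thus ?thesis by (auto simp: A_def Cauchy_convergent_iff)
  qed
  define t where "t n w = (if w \<in> A then s n w else 0)" for n w
  show ?thesis
  proof
    show "simple_function M (t n)" for n
      unfolding t_def by (intro simple_function_If_set s) (auto simp: Int_absorb2 sets.sets_into_space)
    show "(\<lambda>n. t n w) \<longlonglongrightarrow> lim (\<lambda>n. t n w)" if "w \<in> space M" for w
      using that A[of w] by (cases "w \<in> A") (auto simp: t_def convergent_LIMSEQ_iff)
    show "AE w in M. lim (\<lambda>n. t n w) = f w"
      using lim AE_space
    proof eventually_elim
      case (elim w)
      hence "w \<in> A" by (auto simp: A convergent_def)
      thus ?case using elim by (simp add: t_def limI)
    qed
  qed
qed

lemma simple_bochner_integrable_finite: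
  "finite_measure M \<Longrightarrow> sb_integrable M s \<longleftrightarrow> simple_function M s"
  by (auto simp: simple_bochner_integrable.simps finite_measure.emeasure_finite)

lemma norm_simple_bochner_integral_le:
  fixes s :: "'c \<Rightarrow> 'b::real_normed_vector"
  assumes "sb_integrable M s"
  shows "ennreal (norm (sb_integral M s)) \<le> (\<integral>\<^sup>+w. ennreal (norm (s w)) \<partial>M)"
proof -
  have "sb_integrable M (\<lambda>w. norm (s w))"
    using assms by (auto intro: simple_bochner_integrable_compose2[where p = "\<lambda>x y. norm x"])
  thus ?thesis
    using simple_bochner_integral_norm_bound[OF assms]
    by (subst simple_bochner_integral_eq_nn_integral[symmetric]) (auto intro!: ennreal_leI)
qed

text \<open>Used to test a supposed density on a set where it is almost constant. The estimate is
  immediate for simple functions and passes to the limit along the approximants of the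
  integral.\<close>

lemma strong_bochner_integral_close:
  fixes g :: "'c \<Rightarrow> 'b::banach"
  assumes fin: "finite_measure M" and E [measurable]: "E \<in> sets M"
    and int: "has_strong_bochner_integral M (\<lambda>w. indicator E w *\<^sub>R g w) z"
    and close: "AE w in M. w \<in> E \<longrightarrow> norm (g w - y) \<le> \<delta>" and "0 \<le> \<delta>"
  shows "norm (z - measure M E *\<^sub>R y) \<le> \<delta> * measure M E"
proof -
  interpret finite_measure M by fact
  define h where "h = (\<lambda>w. indicator E w *\<^sub>R g w)"
  obtain s where s: "\<And>n. sb_integrable M (s n)"
      and s0: "(\<lambda>n. \<integral>\<^sup>+w. ennreal (norm (h w - s n w)) \<partial>M) \<longlonglongrightarrow> 0"
      and sz: "(\<lambda>n. sb_integral M (s n)) \<longlonglongrightarrow> z"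
    using int unfolding has_strong_bochner_integral_def h_def by blast
  have "strongly_measurable M h" using int unfolding has_strong_bochner_integral_def h_def by blast
  \<comment> \<open>Splitting the nonnegative integral below needs measurable summands, which
    \<open>h'\<close> provides and \<open>h\<close> need not; the integrals agree since
    \<open>h' = h\<close> almost everywhere.\<close>
  then obtain t h' where t: "\<And>n::nat. simple_function M (t n)"
      "\<And>w. w \<in> space M \<Longrightarrow> (\<lambda>n. t n w) \<longlonglongrightarrow> h' w" and h': "AE w in M. h' w = h w"
    by (rule strongly_measurable_everywhere) blast
  have ssf: "simple_function M (s n)" for n using s[of n] by (simp add: simple_bochner_integrable.simps)
  have [measurable]: "(\<lambda>w. norm (h' w - s n w)) \<in> borel_measurable M" for n
  proof (rule borel_measurable_LIMSEQ_real)
    show "(\<lambda>j. norm (t j w - s n w)) \<longlonglongrightarrow> norm (h' w - s n w)" if "w \<in> space M" for w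
      by (intro tendsto_intros t that)
    show "(\<lambda>w. norm (t j w - s n w)) \<in> borel_measurable M" for j
      by (intro borel_measurable_norm_diff_simple t ssf)
  qed
  define I where "I = (\<lambda>w. indicat_real E w *\<^sub>R y)"
  have "simple_function M I"
    unfolding I_def by (intro simple_function_compose1[where g = "\<lambda>r. r *\<^sub>R y"]) simp
  hence I: "sb_integrable M I" using fin by (simp add: simple_bochner_integrable_finite)
  have "sb_integral M I = sb_integral M (indicat_real E) *\<^sub>R y"
    unfolding I_def
    by (intro simple_bochner_integral_linear[of "\<lambda>r. r *\<^sub>R y"])
       (auto simp: simple_bochner_integrable_finite[OF fin] scaleR_add_left intro!: linearI)
  also have "sb_integral M (indicat_real E) = measure M E"
    by (subst simple_bochner_integrable_eq_integral)
       (auto simp: simple_bochner_integrable_finite[OF fin])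
  finally have I_int: "sb_integral M I = measure M E *\<^sub>R y" .
  have bound: "ennreal (norm (sb_integral M (s n) - measure M E *\<^sub>R y))
      \<le> (\<integral>\<^sup>+w. ennreal (norm (h w - s n w)) \<partial>M) + ennreal (\<delta> * measure M E)" for n
  proof -
    have "ennreal (norm (sb_integral M (s n) - measure M E *\<^sub>R y))
        \<le> (\<integral>\<^sup>+w. ennreal (norm (s n w - I w)) \<partial>M)"
      unfolding I_int[symmetric] simple_bochner_integral_diff[OF s I, symmetric]
      by (rule norm_simple_bochner_integral_le,
          rule simple_bochner_integrable_compose2[where p = "\<lambda>x y. x - y", OF _ s I]) simp
    also have "\<dots> \<le> (\<integral>\<^sup>+w. ennreal (norm (h' w - s n w)) + ennreal (\<delta> * indicator E w) \<partial>M)"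
    proof (intro nn_integral_mono_AE)
      show "AE w in M. ennreal (norm (s n w - I w))
          \<le> ennreal (norm (h' w - s n w)) + ennreal (\<delta> * indicator E w)"
        using close h'
      proof eventually_elim
        case (elim w)
        have "norm (h' w - I w) \<le> \<delta> * indicator E w"
          using elim by (auto simp: h_def I_def indicator_def)
        moreover have "norm (s n w - I w) \<le> norm (h' w - s n w) + norm (h' w - I w)"
          using norm_triangle_ineq4[of "h' w - I w" "h' w - s n w"] by simp
        ultimately have "norm (s n w - I w) \<le> norm (h' w - s n w) + \<delta> * indicator E w"
          by linarith
        thus ?case using \<open>0 \<le> \<delta>\<close>
          by (subst ennreal_plus[symmetric]) (auto simp del: ennreal_plus intro!: ennreal_leI)
      qed
    qed
    also have "\<dots> = (\<integral>\<^sup>+w. ennreal (norm (h' w - s n w)) \<partial>M) + (\<integral>\<^sup>+w. ennreal (\<delta> * indicator E w) \<partial>M)"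
      by (intro nn_integral_add) auto
    also have "(\<integral>\<^sup>+w. ennreal (\<delta> * indicator E w) \<partial>M) = ennreal (\<delta> * measure M E)"
      using \<open>0 \<le> \<delta>\<close>
      by (simp add: ennreal_mult nn_integral_cmult emeasure_eq_measure ennreal_indicator)
    also have "(\<integral>\<^sup>+w. ennreal (norm (h' w - s n w)) \<partial>M) = (\<integral>\<^sup>+w. ennreal (norm (h w - s n w)) \<partial>M)"
      using h' by (intro nn_integral_cong_AE) (auto elim!: eventually_mono)
    finally show ?thesis .
  qed
  have "ennreal (norm (z - measure M E *\<^sub>R y)) \<le> 0 + ennreal (\<delta> * measure M E)"
  proof (rule LIMSEQ_le)
    show "(\<lambda>n. ennreal (norm (sb_integral M (s n) - measure M E *\<^sub>R y)))
        \<longlonglongrightarrow> ennreal (norm (z - measure M E *\<^sub>R y))"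
      by (intro tendsto_intros sz)
    show "(\<lambda>n. (\<integral>\<^sup>+w. ennreal (norm (h w - s n w)) \<partial>M) + ennreal (\<delta> * measure M E))
        \<longlonglongrightarrow> 0 + ennreal (\<delta> * measure M E)"
      by (intro tendsto_add s0 tendsto_const)
  qed (use bound in blast)
  thus ?thesis using \<open>0 \<le> \<delta>\<close> by simp
qed

section \<open>Finitely additive charges dominated by a multiple of the measure\<close>

definition lipschitz_charge :: "'c measure \<Rightarrow> real \<Rightarrow> ('c set \<Rightarrow> 'b::real_normed_vector) \<Rightarrow> bool" where
  "lipschitz_charge M C G \<longleftrightarrow>
     (\<forall>A\<in>sets M. norm (G A) \<le> C * measure M A) \<and>
     (\<forall>A\<in>sets M. \<forall>B\<in>sets M. A \<inter> B = {} \<longrightarrow> G (A \<union> B) = G A + G B)"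

lemma lipschitz_charge_bound: "lipschitz_charge M C G \<Longrightarrow> A \<in> sets M \<Longrightarrow> norm (G A) \<le> C * measure M A"
  and lipschitz_charge_Un: "lipschitz_charge M C G \<Longrightarrow> A \<in> sets M \<Longrightarrow> B \<in> sets M \<Longrightarrow> A \<inter> B = {} \<Longrightarrow>
    G (A \<union> B) = G A + G B"
  by (auto simp: lipschitz_charge_def)

lemma lipschitz_charge_empty: "lipschitz_charge M C G \<Longrightarrow> G {} = 0"
  using lipschitz_charge_bound[of M C G "{}"] by simp

lemma lipschitz_charge_UN:
  assumes G: "lipschitz_charge M C G" and "finite I"
    and "\<And>i. i \<in> I \<Longrightarrow> A i \<in> sets M" "disjoint_family_on A I"
  shows "G (\<Union>i\<in>I. A i) = (\<Sum>i\<in>I. G (A i))"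
  using assms(2-)
proof (induction I)
  case empty
  thus ?case using lipschitz_charge_empty[OF G] by simp
next
  case (insert j I)
  have "G (A j \<union> (\<Union>i\<in>I. A i)) = G (A j) + G (\<Union>i\<in>I. A i)"
    using insert by (intro lipschitz_charge_Un[OF G]) (auto simp: disjoint_family_on_def)
  also have "G (\<Union>i\<in>I. A i) = (\<Sum>i\<in>I. G (A i))"
    using insert by (intro insert.IH) (auto simp: disjoint_family_on_def)
  finally show ?case using insert by simp
qed

text \<open>Finite additivity suffices: the remainder of the series is the charge of the remaining
  union, whose norm is at most \<open>C\<close> times a measure tending to 0.\<close>

lemma lipschitz_charge_vector_measure:
  assumes "finite_measure M" and G: "lipschitz_charge M C G"
  shows "vector_measure M G"
  unfolding vector_measure_def
proof (intro allI impI)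
  interpret finite_measure M by fact
  fix A :: "nat \<Rightarrow> 'a set" assume A: "range A \<subseteq> sets M" "disjoint_family A"
  hence Ai: "A i \<in> sets M" for i by auto
  have "(\<lambda>n. measure M (\<Union>i. A i) - (\<Sum>i<n. measure M (A i))) \<longlonglongrightarrow> measure M (\<Union>i. A i) - measure M (\<Union>i. A i)"
    using finite_measure_UNION[OF A] by (intro tendsto_diff tendsto_const) (simp add: sums_def)
  hence lim: "(\<lambda>n. C * (measure M (\<Union>i. A i) - (\<Sum>i<n. measure M (A i)))) \<longlonglongrightarrow> 0"
    by (auto intro: tendsto_mult_right_zero)
  have bound: "norm ((\<Sum>i<n. G (A i)) - G (\<Union>i. A i))
      \<le> C * (measure M (\<Union>i. A i) - (\<Sum>i<n. measure M (A i)))" for n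
  proof -
    have dj: "disjoint_family_on A {..<n}" using A(2) by (auto simp: disjoint_family_on_def)
    have sub: "(\<Union>i<n. A i) \<subseteq> (\<Union>i. A i)" by auto
    have U: "(\<Union>i. A i) \<in> sets M" "(\<Union>i<n. A i) \<in> sets M" using Ai by auto
    have "G ((\<Union>i<n. A i) \<union> ((\<Union>i. A i) - (\<Union>i<n. A i))) = G (\<Union>i<n. A i) + G ((\<Union>i. A i) - (\<Union>i<n. A i))"
      using U by (intro lipschitz_charge_Un[OF G]) auto
    moreover have "(\<Union>i<n. A i) \<union> ((\<Union>i. A i) - (\<Union>i<n. A i)) = (\<Union>i. A i)" by auto
    moreover have "G (\<Union>i<n. A i) = (\<Sum>i<n. G (A i))"
      by (rule lipschitz_charge_UN[OF G _ Ai dj]) auto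
    moreover have "measure M (\<Union>i<n. A i) = (\<Sum>i<n. measure M (A i))"
      by (rule finite_measure_finite_Union) (use Ai dj in auto)
    moreover have "measure M ((\<Union>i. A i) - (\<Union>i<n. A i)) = measure M (\<Union>i. A i) - measure M (\<Union>i<n. A i)"
      by (rule finite_measure_Diff) (use U sub in auto)
    moreover have "norm (G ((\<Union>i. A i) - (\<Union>i<n. A i))) \<le> C * measure M ((\<Union>i. A i) - (\<Union>i<n. A i))"
      using U by (intro lipschitz_charge_bound[OF G]) auto
    ultimately show ?thesis by (simp add: norm_minus_commute)
  qed
  have "(\<lambda>n. (\<Sum>i<n. G (A i)) - G (\<Union>i. A i)) \<longlonglongrightarrow> 0"
    by (rule Lim_null_comparison[OF _ lim]) (simp add: bound)
  thus "(\<lambda>i. G (A i)) sums G (\<Union>i. A i)"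
    unfolding sums_def by (simp add: LIM_zero_iff)
qed

lemma lipschitz_charge_total_variation:
  assumes "finite_measure M" and G: "lipschitz_charge M C G" and "0 \<le> C"
  shows "total_variation M G < \<infinity>"
proof -
  interpret finite_measure M by fact
  have "(\<Sum>A\<in>P. ennreal (norm (G A))) \<le> ennreal (C * measure M (space M))"
    if P: "finite P" "P \<subseteq> sets M" "disjoint P" "\<Union>P = space M" for P
  proof -
    have "(\<Sum>A\<in>P. norm (G A)) \<le> (\<Sum>A\<in>P. C * measure M A)"
      using P by (intro sum_mono lipschitz_charge_bound[OF G]) auto
    also have "\<dots> = C * measure M (\<Union>A\<in>P. A)"
      unfolding sum_distrib_left[symmetric] using P
      by (subst finite_measure_finite_Union) (auto simp: disjoint_family_on_def disjoint_def)
    finally show ?thesis using P by (simp add: sum_ennreal ennreal_leI)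
  qed
  hence "total_variation M G \<le> ennreal (C * measure M (space M))"
    unfolding total_variation_def by (intro SUP_least) auto
  thus ?thesis by (rule le_less_trans) simp
qed

lemma lipschitz_charge_continuous:
  assumes G: "lipschitz_charge M C G" and "0 \<le> C"
  shows "continuous_wrt_measure M G"
  unfolding continuous_wrt_measure_def
proof (intro allI impI)
  fix e :: real assume "e > 0"
  have "norm (G E) < e" if "E \<in> sets M" "measure M E < e / (C + 1)" for E
  proof -
    have "norm (G E) \<le> C * measure M E" by (rule lipschitz_charge_bound[OF G that(1)])
    also have "\<dots> \<le> (C + 1) * measure M E" by (intro mult_right_mono) auto
    also have "\<dots> < e" using that(2) \<open>0 \<le> C\<close> by (simp add: field_simps)
    finally show ?thesis .
  qed
  moreover have "e / (C + 1) > 0" using \<open>e > 0\<close> \<open>0 \<le> C\<close> by simp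
  ultimately show "\<exists>\<delta>>0. \<forall>E\<in>sets M. measure M E < \<delta> \<longrightarrow> norm (G E) < e" by blast
qed

section \<open>Trees of functionals in nonseparable duals\<close>

text \<open>For all \<open>\<epsilon>\<close> together this is separability of the restrictions of
  \<open>W\<close> to \<open>D\<close> in the supremum distance. The centres may lie outside
  \<open>W\<close>, which makes passing to subsets trivial.\<close>

definition uniformly_coverable :: "'a::real_normed_vector set \<Rightarrow> real \<Rightarrow> ('a \<Rightarrow>\<^sub>L real) set \<Rightarrow> bool" where
  "uniformly_coverable D \<epsilon> W \<longleftrightarrow>
     (\<exists>\<Psi>. countable \<Psi> \<and> (\<forall>\<phi>\<in>W. \<exists>\<psi>\<in>\<Psi>. \<forall>x\<in>D. \<bar>blinfun_apply \<phi> x - blinfun_apply \<psi> x\<bar> \<le> \<epsilon>))"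

text \<open>The subspaces need not be formed: by Hahn--Banach, the functionals on the closed span of \<open>D\<close>
  are the restrictions of the functionals on the whole space.\<close>

definition separable_subspaces_have_separable_dual :: "'a::real_normed_vector itself \<Rightarrow> bool" where
  "separable_subspaces_have_separable_dual X \<longleftrightarrow>
     (\<forall>D::'a set. countable D \<longrightarrow> bounded D \<longrightarrow> (\<forall>\<epsilon>>0. uniformly_coverable D \<epsilon> UNIV))"

lemma uniformly_coverable_subset: "uniformly_coverable D \<epsilon> W \<Longrightarrow> V \<subseteq> W \<Longrightarrow> uniformly_coverable D \<epsilon> V"
  unfolding uniformly_coverable_def by blast

text \<open>The coverable sets form a sigma-ideal; not being coverable is therefore a notion of
  largeness that survives countable decompositions.\<close>

lemma uniformly_coverable_UN:
  assumes "countable I" "\<And>i. i \<in> I \<Longrightarrow> uniformly_coverable D \<epsilon> (W i)"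
  shows "uniformly_coverable D \<epsilon> (\<Union>i\<in>I. W i)"
proof -
  have "\<forall>i\<in>I. \<exists>\<Psi>. countable \<Psi> \<and>
      (\<forall>\<phi>\<in>W i. \<exists>\<psi>\<in>\<Psi>. \<forall>x\<in>D. \<bar>blinfun_apply \<phi> x - blinfun_apply \<psi> x\<bar> \<le> \<epsilon>)"
    using assms(2) unfolding uniformly_coverable_def by blast
  then obtain \<Psi> where "\<forall>i\<in>I. countable (\<Psi> i) \<and>
      (\<forall>\<phi>\<in>W i. \<exists>\<psi>\<in>\<Psi> i. \<forall>x\<in>D. \<bar>blinfun_apply \<phi> x - blinfun_apply \<psi> x\<bar> \<le> \<epsilon>)"
    by metis
  thus ?thesis
    unfolding uniformly_coverable_def using assms(1)
    by (intro exI[of _ "\<Union>i\<in>I. \<Psi> i"]) (simp, blast)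
qed

lemma uniformly_coverable_Un:
  "uniformly_coverable D \<epsilon> V \<Longrightarrow> uniformly_coverable D \<epsilon> W \<Longrightarrow> uniformly_coverable D \<epsilon> (V \<union> W)"
  using uniformly_coverable_UN[of "{V, W}" D \<epsilon> "\<lambda>x. x"] by auto

text \<open>For each \<open>x\<close> the real line is cut into intervals of length
  \<open>\<eta>\<close>, and one of the slabs of functionals is large. If no cut splits
  \<open>W\<close>, everything beyond the two neighbouring slabs is small for each of the countably
  many \<open>x\<close>. After its removal any two functionals differ by at most
  \<open>3 * \<eta>\<close> on \<open>D\<close>, so one of them covers the rest; this is the origin
  of the factor 3.\<close>

lemma not_uniformly_coverable_split:
  fixes D :: "'a::real_normed_vector set"
  assumes D: "countable D" and "\<eta> > 0" and W: "\<not> uniformly_coverable D (3 * \<eta>) W"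
  shows "\<exists>x\<in>D. \<exists>a. \<not> uniformly_coverable D (3 * \<eta>) {\<phi>\<in>W. blinfun_apply \<phi> x \<ge> a + \<eta>} \<and>
                    \<not> uniformly_coverable D (3 * \<eta>) {\<phi>\<in>W. blinfun_apply \<phi> x \<le> a}"
proof (rule ccontr)
  let ?cov = "uniformly_coverable D (3 * \<eta>)"
  assume contra: "\<not> ?thesis"
  have "\<exists>j::int. \<not> ?cov {\<phi>\<in>W. of_int j * \<eta> \<le> blinfun_apply \<phi> x \<and> blinfun_apply \<phi> x \<le> of_int (j + 1) * \<eta>}"
    if "x \<in> D" for x
  proof (rule ccontr)
    assume "\<nexists>j::int. \<not> ?cov {\<phi>\<in>W. of_int j * \<eta> \<le> blinfun_apply \<phi> x \<and> blinfun_apply \<phi> x \<le> of_int (j + 1) * \<eta>}"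
    hence "?cov (\<Union>j::int. {\<phi>\<in>W. of_int j * \<eta> \<le> blinfun_apply \<phi> x \<and> blinfun_apply \<phi> x \<le> of_int (j + 1) * \<eta>})"
      by (intro uniformly_coverable_UN) auto
    moreover have "W \<subseteq> (\<Union>j::int. {\<phi>\<in>W. of_int j * \<eta> \<le> blinfun_apply \<phi> x \<and> blinfun_apply \<phi> x \<le> of_int (j + 1) * \<eta>})"
    proof
      fix \<phi> assume "\<phi> \<in> W"
      let ?j = "\<lfloor>blinfun_apply \<phi> x / \<eta>\<rfloor>"
      have "of_int ?j * \<eta> \<le> blinfun_apply \<phi> x" "blinfun_apply \<phi> x \<le> of_int (?j + 1) * \<eta>"
        using floor_divide_lower[OF \<open>\<eta> > 0\<close>] floor_divide_upper[OF \<open>\<eta> > 0\<close>] less_imp_le by auto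
      thus "\<phi> \<in> (\<Union>j::int. {\<phi>\<in>W. of_int j * \<eta> \<le> blinfun_apply \<phi> x \<and> blinfun_apply \<phi> x \<le> of_int (j + 1) * \<eta>})"
        using \<open>\<phi> \<in> W\<close> by blast
    qed
    ultimately show False using W uniformly_coverable_subset by blast
  qed
  hence "\<forall>x\<in>D. \<exists>j::int. \<not> ?cov {\<phi>\<in>W. of_int j * \<eta> \<le> blinfun_apply \<phi> x \<and> blinfun_apply \<phi> x \<le> of_int (j + 1) * \<eta>}"
    by blast
  from bchoice[OF this] obtain j :: "'a \<Rightarrow> int" where
    j: "\<And>x. x \<in> D \<Longrightarrow> \<not> ?cov {\<phi>\<in>W. of_int (j x) * \<eta> \<le> blinfun_apply \<phi> x \<and> blinfun_apply \<phi> x \<le> of_int (j x + 1) * \<eta>}"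
    by blast
  \<comment> \<open>The cuts at \<open>a = (j x + 1) * \<eta>\<close> and
    \<open>a = (j x - 1) * \<eta>\<close> each have the large slab on one side, so the other side
    must be coverable.\<close>
  define V where "V x = {\<phi>\<in>W. blinfun_apply \<phi> x \<ge> of_int (j x + 1) * \<eta> + \<eta>}
    \<union> {\<phi>\<in>W. blinfun_apply \<phi> x \<le> of_int (j x - 1) * \<eta>}" for x
  have "?cov (V x)" if "x \<in> D" for x
    unfolding V_def
  proof (rule uniformly_coverable_Un)
    have "\<not> ?cov {\<phi>\<in>W. blinfun_apply \<phi> x \<le> of_int (j x + 1) * \<eta>}"
      using j[OF that] by (rule contrapos_nn) (auto elim: uniformly_coverable_subset)
    thus "?cov {\<phi>\<in>W. blinfun_apply \<phi> x \<ge> of_int (j x + 1) * \<eta> + \<eta>}"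
      using contra that by blast
    have "\<not> ?cov {\<phi>\<in>W. blinfun_apply \<phi> x \<ge> of_int (j x - 1) * \<eta> + \<eta>}"
      using j[OF that] by (rule contrapos_nn) (auto elim!: uniformly_coverable_subset simp: algebra_simps)
    thus "?cov {\<phi>\<in>W. blinfun_apply \<phi> x \<le> of_int (j x - 1) * \<eta>}"
      using contra that by blast
  qed
  hence "?cov (\<Union>x\<in>D. V x)" by (intro uniformly_coverable_UN D)
  moreover have "?cov (W - (\<Union>x\<in>D. V x))"
  proof (cases "W - (\<Union>x\<in>D. V x) = {}")
    case False
    then obtain \<psi> where \<psi>: "\<psi> \<in> W - (\<Union>x\<in>D. V x)" by blast
    have "\<bar>blinfun_apply \<phi> x - blinfun_apply \<psi> x\<bar> \<le> 3 * \<eta>"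
      if "\<phi> \<in> W - (\<Union>x\<in>D. V x)" "x \<in> D" for \<phi> x
      using that \<psi> unfolding V_def by (auto simp: algebra_simps not_le abs_le_iff) (smt (verit))+
    thus ?thesis unfolding uniformly_coverable_def by (intro exI[of _ "{\<psi>}"]) auto
  qed (auto simp: uniformly_coverable_def)
  ultimately have "?cov ((\<Union>x\<in>D. V x) \<union> (W - (\<Union>x\<in>D. V x)))" by (rule uniformly_coverable_Un)
  thus False using W by (rule_tac notE[OF W], elim uniformly_coverable_subset) blast
qed

text \<open>Lists grow at the front, so \<open>u @ True # s\<close> runs through the descendants of
  the child \<open>True # s\<close>. The condition on \<open>\<psi>\<close> is imposed on all
  descendants, not just on children, so that it passes to limits along branches; the bound
  \<open>K\<close> makes such limits exist.\<close>

locale functional_tree =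
  fixes \<psi> :: "bool list \<Rightarrow> ('a::banach \<Rightarrow>\<^sub>L real)" and x :: "bool list \<Rightarrow> 'a" and a :: "bool list \<Rightarrow> real"
    and K R \<eta> :: real
  assumes \<eta>_pos: "\<eta> > 0" and K_nonneg: "K \<ge> 0"
    and norm_\<psi>: "\<And>s. norm (\<psi> s) \<le> K" and norm_x: "\<And>s. norm (x s) \<le> R"
    and \<psi>_True: "\<And>u s. blinfun_apply (\<psi> (u @ True # s)) (x s) \<ge> a s + \<eta>"
    and \<psi>_False: "\<And>u s. blinfun_apply (\<psi> (u @ False # s)) (x s) \<le> a s"

text \<open>The dual is a countable union of balls, so one ball is already not coverable, which
  supplies \<open>K\<close>. Repeated splitting attaches a large set to every node, and
  \<open>\<psi> s\<close> is an arbitrary element of the set at \<open>s\<close>.\<close>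

lemma functional_tree_exists:
  assumes "\<not> separable_subspaces_have_separable_dual TYPE('a::banach)"
  shows "\<exists>(\<psi> :: bool list \<Rightarrow> ('a \<Rightarrow>\<^sub>L real)) x a K R \<eta>. functional_tree \<psi> x a K R \<eta>"
proof -
  obtain D :: "'a set" and \<epsilon> where D: "countable D" "bounded D" and "\<epsilon> > 0"
    and not_cov: "\<not> uniformly_coverable D \<epsilon> UNIV"
    using assms unfolding separable_subspaces_have_separable_dual_def by blast
  obtain R where R: "\<And>y. y \<in> D \<Longrightarrow> norm y \<le> R" using D(2) unfolding bounded_iff by blast
  define \<eta> where "\<eta> = \<epsilon> / 3"
  have \<eta>: "\<eta> > 0" "3 * \<eta> = \<epsilon>" using \<open>\<epsilon> > 0\<close> by (auto simp: \<eta>_def)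
  let ?big = "\<lambda>W. \<not> uniformly_coverable D (3 * \<eta>) W"
  have "\<exists>K::nat. ?big {\<phi>. norm \<phi> \<le> real K}"
  proof (rule ccontr)
    assume "\<nexists>K::nat. ?big {\<phi>. norm \<phi> \<le> real K}"
    hence "uniformly_coverable D \<epsilon> (\<Union>K::nat. {\<phi>. norm \<phi> \<le> real K})"
      using \<eta> by (intro uniformly_coverable_UN) auto
    moreover have "(\<Union>K::nat. {\<phi> :: 'a \<Rightarrow>\<^sub>L real. norm \<phi> \<le> real K}) = UNIV"
      using real_arch_simple by auto
    ultimately show False using not_cov by simp
  qed
  then obtain K :: nat where K: "?big {\<phi>. norm \<phi> \<le> real K}" by blast
  have "\<forall>W. \<exists>x a. ?big W \<longrightarrow> x \<in> D \<and> ?big {\<phi>\<in>W. blinfun_apply \<phi> x \<ge> a + \<eta>} \<and> ?big {\<phi>\<in>W. blinfun_apply \<phi> x \<le> a}"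
    using not_uniformly_coverable_split[OF D(1) \<eta>(1)] by blast
  from choice[OF this] obtain X where "\<forall>W. \<exists>a. ?big W \<longrightarrow> X W \<in> D \<and>
      ?big {\<phi>\<in>W. blinfun_apply \<phi> (X W) \<ge> a + \<eta>} \<and> ?big {\<phi>\<in>W. blinfun_apply \<phi> (X W) \<le> a}"
    by blast
  from choice[OF this] obtain A where XA: "\<And>W. ?big W \<Longrightarrow> X W \<in> D \<and> ?big {\<phi>\<in>W. blinfun_apply \<phi> (X W) \<ge> A W + \<eta>}
      \<and> ?big {\<phi>\<in>W. blinfun_apply \<phi> (X W) \<le> A W}"
    by blast
  \<comment> \<open>The head of a list is the latest choice of side, so the recursion on the tail
    builds the parent set \<open>V\<close> before splitting it; prefixing bits can only shrink the
    set.\<close>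
  define W where "W = rec_list {\<phi>. norm \<phi> \<le> real K} (\<lambda>b _ V. if b
      then {\<phi>\<in>V. blinfun_apply \<phi> (X V) \<ge> A V + \<eta>} else {\<phi>\<in>V. blinfun_apply \<phi> (X V) \<le> A V})"
  have W_simps: "W [] = {\<phi>. norm \<phi> \<le> real K}"
      "W (True # s) = {\<phi>\<in>W s. blinfun_apply \<phi> (X (W s)) \<ge> A (W s) + \<eta>}"
      "W (False # s) = {\<phi>\<in>W s. blinfun_apply \<phi> (X (W s)) \<le> A (W s)}" for s
    by (simp_all add: W_def)
  have big: "?big (W s)" for s
  proof (induction s)
    case (Cons b s)
    thus ?case using XA[OF Cons] by (cases b) (auto simp: W_simps)
  qed (use K in \<open>simp add: W_simps\<close>)
  have "W (b # s) \<subseteq> W s" for b s by (cases b) (auto simp: W_simps)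
  note Cons_mono = this
  have mono: "W (u @ s) \<subseteq> W s" for u s
    by (induction u) (use Cons_mono in auto)
  have "W s \<noteq> {}" for s using big[of s] by (auto simp: uniformly_coverable_def)
  hence "\<forall>s. \<exists>\<phi>. \<phi> \<in> W s" by blast
  from choice[OF this] obtain \<psi> where \<psi>: "\<And>s. \<psi> s \<in> W s" by blast
  have "functional_tree \<psi> (\<lambda>s. X (W s)) (\<lambda>s. A (W s)) (real K) R \<eta>"
  proof
    show "norm (\<psi> s) \<le> real K" for s
      using \<psi>[of s] mono[of s "[]"] by (auto simp: W_simps)
    show "norm (X (W s)) \<le> R" for s using XA[OF big] R by blast
    show "blinfun_apply (\<psi> (u @ True # s)) (X (W s)) \<ge> A (W s) + \<eta>" for u s
      using \<psi>[of "u @ True # s"] mono[of u "True # s"] by (auto simp: W_simps)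
    show "blinfun_apply (\<psi> (u @ False # s)) (X (W s)) \<le> A (W s)" for u s
      using \<psi>[of "u @ False # s"] mono[of u "False # s"] by (auto simp: W_simps)
  qed (use \<eta> in auto)
  thus ?thesis by blast
qed

section \<open>Fair bits\<close>

text \<open>The newest bit comes first, as in the tree: earlier paths are suffixes of later
  ones.\<close>

primrec bit_path :: "(nat \<Rightarrow> 'c \<Rightarrow> bool) \<Rightarrow> nat \<Rightarrow> 'c \<Rightarrow> bool list" where
  "bit_path b 0 w = []"
| "bit_path b (Suc k) w = b k w # bit_path b k w"

lemma length_bit_path [simp]: "length (bit_path b k w) = k"
  by (induction k) auto

lemma bit_path_later:
  assumes "k < n"
  obtains u where "bit_path b n w = u @ b k w # bit_path b k w"
proof -
  have "\<exists>u. bit_path b n w = u @ b k w # bit_path b k w"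
    using assms
  proof (induction n)
    case (Suc n)
    show ?case
    proof (cases "k = n")
      case False
      then obtain u where "bit_path b n w = u @ b k w # bit_path b k w" using Suc by auto
      thus ?thesis by (intro exI[of _ "b n w # u"]) simp
    qed simp
  qed simp
  thus ?thesis using that by blast
qed

lemma finite_bool_lists: "finite {s :: bool list. length s = k}"
  using finite_lists_length_eq[of "UNIV :: bool set" k] by simp

definition bit_sign :: "bool \<Rightarrow> real" where "bit_sign b = (if b then 1 else - 1)"

lemma abs_bit_sign [simp]: "\<bar>bit_sign b\<bar> = 1"
  by (simp add: bit_sign_def)

lemma measurable_bit_path:
  assumes "\<And>k. b k \<in> measurable N (count_space UNIV)"
  shows "bit_path b k \<in> measurable N (count_space UNIV)"
proof (induction k)
  case (Suc k)
  have "(\<lambda>w. (b k w, bit_path b k w)) \<in> measurable N (count_space (UNIV \<times> UNIV))"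
    using measurable_Pair[OF assms[of k] Suc] by (subst pair_measure_countable[symmetric]) auto
  from measurable_compose[OF this, of "\<lambda>(x, y). x # y" "count_space UNIV"]
  show ?case by (simp add: case_prod_unfold)
qed simp

text \<open>Equal probability of all paths of a given length is exactly what independence and
  fairness of the bits amount to, in the form in which the cells of the tree use it.\<close>

locale fair_bits = prob_space N for N :: "'c measure" +
  fixes b :: "nat \<Rightarrow> 'c \<Rightarrow> bool"
  assumes b_measurable [measurable]: "\<And>k. b k \<in> measurable N (count_space UNIV)"
    and measure_path: "\<And>k s. length s = k \<Longrightarrow> measure N {w\<in>space N. bit_path b k w = s} = (1 / 2) ^ k"
begin

lemmas path_measurable = measurable_bit_path[where b = b, OF b_measurable]

lemma path_simple_function: "simple_function N (\<lambda>w. F (bit_path b k w))"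
proof -
  have "finite ((\<lambda>w. bit_path b k w) ` space N)"
    by (rule finite_subset[OF _ finite_bool_lists[of k]]) auto
  moreover have "bit_path b k -` {s} \<inter> space N \<in> sets N" for s
    using measurable_sets[OF path_measurable, of "{s}"] by simp
  ultimately have "simple_function N (bit_path b k)" unfolding simple_function_def by auto
  thus ?thesis by (rule simple_function_compose1)
qed

lemma path_borel_measurable [measurable]:
  fixes F :: "bool list \<Rightarrow> 'd::topological_space"
  shows "(\<lambda>w. F (bit_path b k w)) \<in> borel_measurable N"
  by (rule borel_measurable_simple_function[OF path_simple_function])

lemma path_sets [measurable]: "{w\<in>space N. bit_path b k w = s} \<in> sets N"
  using measurable_sets[OF path_measurable, of "{s}" k]
  by (simp add: vimage_def Int_def conj_commute)

lemma path_integrable: "integrable N (\<lambda>w. F (bit_path b k w) :: real)"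
proof -
  have "finite ((\<lambda>w. F (bit_path b k w)) ` space N)"
    using path_simple_function[of F k] by (simp add: simple_function_def)
  then obtain B where "\<And>w. w \<in> space N \<Longrightarrow> norm (F (bit_path b k w)) \<le> B"
    using finite_imp_bounded[of "(\<lambda>w. F (bit_path b k w)) ` space N"] by (auto simp: bounded_iff)
  thus ?thesis by (intro integrable_const_bound[of _ B]) auto
qed

text \<open>On each cell of the first \<open>k\<close> bits the factor \<open>h\<close> is constant,
  and the two halves on which bit \<open>k\<close> is True or False have the same measure.\<close>

lemma integral_bit_sign_path: "(\<integral>w. bit_sign (b k w) * h (bit_path b k w) \<partial>N) = 0"
proof -
  let ?I = "\<lambda>c s. indicat_real {w\<in>space N. bit_path b (Suc k) w = c # s}"
  have "(\<integral>w. bit_sign (b k w) * h (bit_path b k w) \<partial>N)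
      = (\<integral>w. (\<Sum>s | length s = k. h s * (?I True s w - ?I False s w)) \<partial>N)"
  proof (intro Bochner_Integration.integral_cong refl)
    fix w assume "w \<in> space N"
    hence "(\<Sum>s | length s = k. h s * (?I True s w - ?I False s w))
        = (\<Sum>s | length s = k. if s = bit_path b k w then bit_sign (b k w) * h s else 0)"
      by (intro sum.cong) (auto simp: indicator_def bit_sign_def)
    also have "\<dots> = bit_sign (b k w) * h (bit_path b k w)"
      by (subst sum.delta[OF finite_bool_lists]) auto
    finally show "bit_sign (b k w) * h (bit_path b k w)
        = (\<Sum>s | length s = k. h s * (?I True s w - ?I False s w))" by simp
  qed
  also have "\<dots> = (\<Sum>s | length s = k. h s * (measure N {w\<in>space N. bit_path b (Suc k) w = True # s}
      - measure N {w\<in>space N. bit_path b (Suc k) w = False # s}))"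
    by (subst Bochner_Integration.integral_sum)
       (auto simp del: bit_path.simps intro!: sum.cong integrable_mult_right Bochner_Integration.integrable_diff
         simp: Bochner_Integration.integral_diff less_top[symmetric] integrable_real_indicator)
  also have "\<dots> = 0"
    by (intro sum.neutral) (auto simp del: bit_path.simps simp: measure_path)
  finally show ?thesis .
qed

context
  fixes c :: "bool list \<Rightarrow> real" and C :: real
  assumes c: "\<And>s. \<bar>c s\<bar> \<le> C"
begin

text \<open>The coefficient sees only the first \<open>k\<close> bits, and the next sign has mean 0
  given them: these are bounded martingale differences.\<close>

definition "martingale_step k w = bit_sign (b k w) * c (bit_path b k w)"

lemma martingale_step_path: "j < k \<Longrightarrow> \<exists>h. \<forall>w. martingale_step j w = h (bit_path b k w)"
proof (induction k)
  case (Suc k)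
  show ?case
  proof (cases "j = k")
    case True
    thus ?thesis
      by (intro exI[of _ "\<lambda>l. bit_sign (hd l) * c (tl l)"]) (simp add: martingale_step_def)
  next
    case False
    then obtain h where "\<forall>w. martingale_step j w = h (bit_path b k w)" using Suc by auto
    thus ?thesis by (intro exI[of _ "h \<circ> tl"]) simp
  qed
qed simp

lemma martingale_step_orthogonal:
  assumes "j < k"
  shows "(\<integral>w. martingale_step j w * martingale_step k w \<partial>N) = 0"
proof -
  obtain h where "\<forall>w. martingale_step j w = h (bit_path b k w)" using martingale_step_path[OF assms] by blast
  hence "(\<lambda>w. martingale_step j w * martingale_step k w)
      = (\<lambda>w. bit_sign (b k w) * (\<lambda>l. h l * c l) (bit_path b k w))"
    by (simp add: martingale_step_def fun_eq_iff)
  thus ?thesis using integral_bit_sign_path[of k "\<lambda>l. h l * c l"] by simp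
qed

lemma martingale_step_measurable [measurable]: "martingale_step k \<in> borel_measurable N"
  unfolding martingale_step_def[abs_def] bit_sign_def by measurable

lemma abs_martingale_step: "\<bar>martingale_step k w\<bar> \<le> C"
  using c by (simp add: martingale_step_def abs_mult)

lemma martingale_step_integrable: "integrable N (\<lambda>w. martingale_step j w * martingale_step k w)"
proof (rule integrable_const_bound[of _ "C * C"])
  have "\<bar>martingale_step j w\<bar> * \<bar>martingale_step k w\<bar> \<le> C * C" for w
    using abs_martingale_step[of j w] abs_martingale_step[of k w] by (intro mult_mono) auto
  thus "AE w in N. norm (martingale_step j w * martingale_step k w) \<le> C * C"
    by (simp add: abs_mult)
qed simp

text \<open>The block has \<open>2 ^ n\<close> pairwise orthogonal steps with second moments at most
  \<open>C\<^sup>2\<close>, and the normalisation divides by \<open>4 ^ n\<close>. Blocks of dyadic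
  length are chosen for this geometric decay.\<close>

lemma block_average_square:
  "(\<integral>w. (1 / 2 ^ n * (\<Sum>k\<in>{2 ^ n..<2 ^ (n + 1)}. martingale_step k w))\<^sup>2 \<partial>N) \<le> C\<^sup>2 * (1 / 2) ^ n"
proof -
  let ?B = "{2 ^ n..<2 ^ (n + 1)} :: nat set"
  have "(\<integral>w. (\<Sum>k\<in>?B. martingale_step k w)\<^sup>2 \<partial>N)
      = (\<Sum>j\<in>?B. \<Sum>k\<in>?B. \<integral>w. martingale_step j w * martingale_step k w \<partial>N)"
    unfolding power2_eq_square sum_product
    by (simp add: Bochner_Integration.integral_sum martingale_step_integrable)
  also have "\<dots> = (\<Sum>j\<in>?B. \<Sum>k\<in>?B. if k = j then \<integral>w. (martingale_step j w)\<^sup>2 \<partial>N else 0)"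
  proof (intro sum.cong refl)
    fix j k
    show "(\<integral>w. martingale_step j w * martingale_step k w \<partial>N)
        = (if k = j then \<integral>w. (martingale_step j w)\<^sup>2 \<partial>N else 0)"
      using martingale_step_orthogonal[of j k] martingale_step_orthogonal[of k j]
      by (cases j k rule: linorder_cases) (auto simp: power2_eq_square mult.commute)
  qed
  also have "\<dots> = (\<Sum>j\<in>?B. \<integral>w. (martingale_step j w)\<^sup>2 \<partial>N)" by (simp add: sum.delta)
  also have "\<dots> \<le> (\<Sum>j\<in>?B. C\<^sup>2)"
  proof (intro sum_mono)
    fix j
    have sq: "(martingale_step j w)\<^sup>2 \<le> C\<^sup>2" for w
      using abs_martingale_step[of j w] by (simp add: abs_le_square_iff[symmetric])
    have "(\<integral>w. (martingale_step j w)\<^sup>2 \<partial>N) \<le> (\<integral>w. C\<^sup>2 \<partial>N)"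
      using martingale_step_integrable[of j j] sq
      by (intro integral_mono) (auto simp: power2_eq_square)
    thus "(\<integral>w. (martingale_step j w)\<^sup>2 \<partial>N) \<le> C\<^sup>2" by (simp add: prob_space)
  qed
  also have "\<dots> = 2 ^ n * C\<^sup>2" by simp
  finally have "(\<integral>w. (\<Sum>k\<in>?B. martingale_step k w)\<^sup>2 \<partial>N) / (2 ^ n)\<^sup>2 \<le> 2 ^ n * C\<^sup>2 / (2 ^ n)\<^sup>2"
    by (intro divide_right_mono) auto
  thus ?thesis
    by (simp add: power_mult_distrib power_divide power2_eq_square power_one_over field_simps)
qed

text \<open>The second moments are summable, so the series of squares converges almost everywhere;
  the whole sequence tends to 0 without passing to a subsequence.\<close>

lemma block_average_tendsto_0:
  "AE w in N. (\<lambda>n. 1 / 2 ^ n * (\<Sum>k\<in>{2 ^ n..<2 ^ (n + 1)}. bit_sign (b k w) * c (bit_path b k w))) \<longlonglongrightarrow> 0"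
proof -
  define Z where "Z n w = 1 / 2 ^ n * (\<Sum>k\<in>{2 ^ n..<2 ^ (n + 1)}. martingale_step k w)" for n w
  have [measurable]: "Z n \<in> borel_measurable N" for n unfolding Z_def[abs_def] by measurable
  have "AE w in N. summable (\<lambda>n. (Z n w)\<^sup>2)"
  proof (rule AE_summable_of_summable_integrals)
    show "(\<integral>\<^sup>+w. ennreal ((Z n w)\<^sup>2) \<partial>N) \<le> ennreal (C\<^sup>2 * (1 / 2) ^ n)" for n
    proof (subst nn_integral_eq_integral)
      have "(Z n w)\<^sup>2 = (\<Sum>j\<in>{2 ^ n..<2 ^ (n + 1)}. \<Sum>k\<in>{2 ^ n..<2 ^ (n + 1)}.
          (1 / 2 ^ n)\<^sup>2 * (martingale_step j w * martingale_step k w))" for w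
      proof -
        have "(\<Sum>k\<in>{2 ^ n..<2 ^ (n + 1)}. martingale_step k w)\<^sup>2 = (\<Sum>j\<in>{2 ^ n..<2 ^ (n + 1)}.
            \<Sum>k\<in>{2 ^ n..<2 ^ (n + 1)}. martingale_step j w * martingale_step k w)"
          by (simp only: power2_eq_square sum_product)
        thus ?thesis unfolding Z_def power_mult_distrib by (simp only: sum_distrib_left)
      qed
      thus "integrable N (\<lambda>w. (Z n w)\<^sup>2)"
        by (simp add: martingale_step_integrable)
      show "ennreal (\<integral>w. (Z n w)\<^sup>2 \<partial>N) \<le> ennreal (C\<^sup>2 * (1 / 2) ^ n)"
        using block_average_square[of n] unfolding Z_def by (rule ennreal_leI)
    qed simp
  qed (auto intro!: summable_mult summable_geometric)
  thus ?thesis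
  proof eventually_elim
    case (elim w)
    from summable_LIMSEQ_zero[OF this] have "(\<lambda>n. Z n w) \<longlonglongrightarrow> 0"
      using tendsto_real_sqrt[of "\<lambda>n. (Z n w)\<^sup>2" 0 sequentially] by (simp add: tendsto_rabs_zero_iff)
    thus ?case by (simp add: Z_def martingale_step_def)
  qed
qed

end

end

section \<open>Weak-star limits along branches and the failure of (A_inf)\<close>

lemma functional_filter_limit:
  fixes u :: "nat \<Rightarrow> ('a::banach \<Rightarrow>\<^sub>L real)"
  assumes "\<And>n. norm (u n) \<le> K"
  obtains F \<phi> where "F \<noteq> bot" "F \<le> sequentially" "norm \<phi> \<le> K"
    "\<And>y. ((\<lambda>n. u n y) \<longlongrightarrow> blinfun_apply \<phi> y) F"
proof -
  have bd: "\<bar>u n y\<bar> \<le> K * norm y" for n y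
  proof -
    have "\<bar>u n y\<bar> \<le> norm (u n) * norm y"
      using norm_blinfun[of "u n" y] by simp
    also have "\<dots> \<le> K * norm y" using assms by (rule mult_right_mono) simp
    finally show ?thesis .
  qed
  \<comment> \<open>A filter is used because dual balls need not be weak-star sequentially compact;
    the pointwise limit along it inherits linearity and the bound \<open>K\<close>.\<close>
  from bounded_sequence_filter_limit[of "\<lambda>n y. u n y" "\<lambda>y. K * norm y", OF bd]
  obtain F L where F: "F \<noteq> bot" "F \<le> sequentially" and L: "\<And>y. ((\<lambda>n. u n y) \<longlongrightarrow> L y) F"
    by blast
  have L_bd: "\<bar>L y\<bar> \<le> norm y * K" for y
    using tendsto_upperbound[OF tendsto_rabs[OF L[of y]] always_eventually F(1), of "K * norm y"] bd
    by (simp add: mult.commute)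
  have "bounded_linear L"
  proof (rule bounded_linear_intro[of L K])
    show "L (x + y) = L x + L y" for x y
      using tendsto_unique[OF F(1) L[of "x + y"]] tendsto_add[OF L[of x] L[of y]] by (simp add: blinfun.add_right)
    show "L (r *\<^sub>R x) = r *\<^sub>R L x" for r x
      using tendsto_unique[OF F(1) L[of "r *\<^sub>R x"]] tendsto_mult_left[OF L[of x], of r] by (simp add: blinfun.scaleR_right)
  qed (use L_bd in simp)
  hence ap: "blinfun_apply (Blinfun L) = L" by (rule bounded_linear_Blinfun_apply)
  have "0 \<le> K" using assms[of 0] norm_ge_zero order_trans by blast
  hence "norm (Blinfun L) \<le> K"
    using L_bd by (intro norm_blinfun_bound) (auto simp: ap mult.commute)
  thus ?thesis using that[OF F] L ap by simp
qed

lemma strongly_measurable_simple: "simple_function M s \<Longrightarrow> strongly_measurable M s"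
  unfolding strongly_measurable_def by (intro exI[of _ "\<lambda>_. s"]) auto

lemma Linf_boundedI:
  assumes "\<And>n. simple_function unit_interval_measure (f n)" "\<And>n w. norm (f n w) \<le> B"
  shows "Linf_bounded f"
proof -
  have "(\<lambda>w. ennreal (norm (f n w))) \<in> borel_measurable unit_interval_measure" for n
    by (intro borel_measurable_simple_function
        simple_function_compose1[OF assms(1), where g = "\<lambda>y. ennreal (norm y)"])
  hence "(SUP n. esssup unit_interval_measure (\<lambda>w. ennreal (norm (f n w)))) \<le> ennreal B"
    using assms(2) by (intro SUP_least esssup_I always_eventually allI ennreal_leI) auto
  thus ?thesis unfolding Linf_bounded_def
    using strongly_measurable_simple[OF assms(1)] by (simp add: le_less_trans[OF _ ennreal_less_top])
qed

text \<open>\<open>a s\<close> is squeezed: it is at least the value of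
  \<open>\<psi> (False # s)\<close> at \<open>x s\<close>, and \<open>a s + \<eta>\<close> is at
  most that of \<open>\<psi> (True # s)\<close>.\<close>

lemma (in functional_tree) abs_a_le: "\<bar>a s\<bar> \<le> K * R"
proof -
  have "\<bar>\<psi> t (x s)\<bar> \<le> K * R" for t
  proof -
    have "\<bar>\<psi> t (x s)\<bar> \<le> norm (\<psi> t) * norm (x s)" using norm_blinfun[of "\<psi> t" "x s"] by simp
    also have "\<dots> \<le> K * R" by (intro mult_mono norm_\<psi> norm_x K_nonneg) simp
    finally show ?thesis .
  qed
  from this[of "True # s"] this[of "False # s"] show ?thesis
    using \<psi>_True[of s "[]"] \<psi>_False[of "[]" s] \<psi>_True[of "[]" s] \<eta>_pos by (auto simp: abs_le_iff)
qed

lemma functional_tree_not_property_A_inf: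
  fixes \<psi> :: "bool list \<Rightarrow> ('a::banach \<Rightarrow>\<^sub>L real)"
  assumes "functional_tree \<psi> x a K R \<eta>" and "fair_bits unit_interval_measure b"
  shows "\<not> property_A_inf TYPE('a)"
proof
  interpret functional_tree \<psi> x a K R \<eta> by fact
  interpret fair_bits unit_interval_measure b by fact
  assume A: "property_A_inf TYPE('a)"
  define f where "f n w = (1 / 2 ^ n) *\<^sub>R (\<Sum>k\<in>{2 ^ n..<2 ^ (n + 1)}. bit_sign (b k w) *\<^sub>R x (bit_path b k w))"
    for n w
  have R: "R \<ge> 0" using norm_x[of "[]"] norm_ge_zero order_trans by blast
  have f_apply: "\<phi> (f n w) = 1 / 2 ^ n *
      (\<Sum>k\<in>{2 ^ n..<2 ^ (n + 1)}. bit_sign (b k w) * \<phi> (x (bit_path b k w)))" for \<phi> :: "'a \<Rightarrow>\<^sub>L real" and n w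
    by (simp add: f_def blinfun.scaleR_right blinfun.sum_right)
  have "norm (f n w) \<le> R" for n w
  proof -
    have "norm (\<Sum>k\<in>{2 ^ n..<2 ^ (n + 1)}. bit_sign (b k w) *\<^sub>R x (bit_path b k w))
        \<le> (\<Sum>k\<in>{2 ^ n..<2 ^ (n + 1) :: nat}. R)"
      by (rule order_trans[OF norm_sum]) (intro sum_mono, simp add: norm_x)
    also have "\<dots> = 2 ^ n * R" by simp
    finally show ?thesis by (simp add: f_def field_simps)
  qed
  moreover have "simple_function unit_interval_measure (f n)" for n
  proof -
    have "simple_function unit_interval_measure (\<lambda>w. bit_sign (b k w) *\<^sub>R x (bit_path b k w))" for k
      using path_simple_function[of "\<lambda>l. bit_sign (hd l) *\<^sub>R x (tl l)" "Suc k"] by simp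
    hence "simple_function unit_interval_measure (\<lambda>w. \<Sum>k\<in>{2 ^ n..<2 ^ (n + 1)}. bit_sign (b k w) *\<^sub>R x (bit_path b k w))"
      by (intro simple_function_sum) auto
    thus ?thesis unfolding f_def[abs_def] by (rule simple_function_compose1[where g = "\<lambda>y. (1 / 2 ^ n) *\<^sub>R y"])
  qed
  ultimately have "Linf_bounded f" by (intro Linf_boundedI)
  moreover have "strongly_measurable unit_interval_measure (\<lambda>_. 0 :: 'a)"
    by (intro strongly_measurable_simple) simp
  moreover have "converges_scalarly_ae f (\<lambda>_. 0)"
    unfolding converges_scalarly_ae_def f_apply blinfun.zero_right
  proof
    fix \<phi> :: "'a \<Rightarrow>\<^sub>L real"
    have "\<bar>\<phi> (x s)\<bar> \<le> norm \<phi> * R" for s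
      using norm_blinfun[of \<phi> "x s"] norm_x[of s] mult_left_mono[of "norm (x s)" R "norm \<phi>"] by simp
    from block_average_tendsto_0[of "\<lambda>s. \<phi> (x s)", OF this]
    show "AE w in unit_interval_measure. (\<lambda>n. 1 / 2 ^ n *
        (\<Sum>k\<in>{2 ^ n..<2 ^ (n + 1)}. bit_sign (b k w) * \<phi> (x (bit_path b k w)))) \<longlonglongrightarrow> 0" .
  qed
  ultimately obtain r where r: "strict_mono r" and "converges_weakly_ae (f \<circ> r) (\<lambda>_. 0)"
    using A unfolding property_A_inf_def by blast
  hence weak: "AE w in unit_interval_measure. \<forall>\<phi> :: 'a \<Rightarrow>\<^sub>L real. (\<lambda>n. \<phi> (f (r n) w)) \<longlonglongrightarrow> 0"
    by (simp add: converges_weakly_ae_def)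
  \<comment> \<open>The midpoints of the gaps serve as the coefficients of a second martingale;
    subtracting them makes the two sides of each gap symmetric.\<close>
  have "\<bar>a s + \<eta> / 2\<bar> \<le> K * R + \<eta> / 2" for s using abs_a_le[of s] \<eta>_pos by linarith
  note center = block_average_tendsto_0[of "\<lambda>s. a s + \<eta> / 2", OF this]
  have "AE w in unit_interval_measure. False"
    using weak center
  proof eventually_elim
    case (elim w)
    \<comment> \<open>The functional depends on the point \<open>w\<close>, with no claim of
      measurability: weak convergence is contradicted at \<open>w\<close> itself.\<close>
    from norm_\<psi> obtain F \<phi> where F: "F \<noteq> bot" "F \<le> sequentially"
      and \<phi>: "\<And>y. ((\<lambda>n. \<psi> (bit_path b n w) y) \<longlongrightarrow> blinfun_apply \<phi> y) F"
      by (rule functional_filter_limit[of "\<lambda>n. \<psi> (bit_path b n w)" K]) blast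
    \<comment> \<open>For a True bit the left side is at least \<open>a s + \<eta>\<close>, for a
      False bit at least \<open>- a s\<close>; both equal \<open>\<eta> / 2\<close> plus the signed
      midpoint. Averaging leaves \<open>\<eta> / 2\<close> up to a null sequence, along every
      subsequence.\<close>
    have step: "bit_sign (b k w) * \<phi> (x (bit_path b k w))
        \<ge> \<eta> / 2 + bit_sign (b k w) * (a (bit_path b k w) + \<eta> / 2)" for k
    proof -
      have ev: "eventually (\<lambda>n. k < n) F" using F(2) eventually_gt_at_top[of k] by (auto simp: le_filter_def)
      show ?thesis
      proof (cases "b k w")
        case True
        have "eventually (\<lambda>n. \<psi> (bit_path b n w) (x (bit_path b k w)) \<ge> a (bit_path b k w) + \<eta>) F"
          using ev by eventually_elim (metis True \<psi>_True bit_path_later)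
        from tendsto_lowerbound[OF \<phi> this F(1)] show ?thesis using True by (simp add: bit_sign_def)
      next
        case False
        have "eventually (\<lambda>n. \<psi> (bit_path b n w) (x (bit_path b k w)) \<le> a (bit_path b k w)) F"
          using ev by eventually_elim (metis False \<psi>_False bit_path_later)
        from tendsto_upperbound[OF \<phi> this F(1)] show ?thesis using False by (simp add: bit_sign_def)
      qed
    qed
    define Z where "Z n = 1 / 2 ^ n * (\<Sum>k\<in>{2 ^ n..<2 ^ (n + 1)}. bit_sign (b k w) * (a (bit_path b k w) + \<eta> / 2))" for n
    have "\<phi> (f n w) \<ge> \<eta> / 2 + Z n" for n
    proof -
      have "(\<Sum>k\<in>{2 ^ n..<2 ^ (n + 1)}. bit_sign (b k w) * \<phi> (x (bit_path b k w)))
          \<ge> (\<Sum>k\<in>{2 ^ n..<2 ^ (n + 1) :: nat}. \<eta> / 2 + bit_sign (b k w) * (a (bit_path b k w) + \<eta> / 2))"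
        by (intro sum_mono step)
      hence "1 / 2 ^ n * (\<Sum>k\<in>{2 ^ n..<2 ^ (n + 1)}. bit_sign (b k w) * \<phi> (x (bit_path b k w)))
          \<ge> 1 / 2 ^ n * (2 ^ n * (\<eta> / 2) + (\<Sum>k\<in>{2 ^ n..<2 ^ (n + 1) :: nat}. bit_sign (b k w) * (a (bit_path b k w) + \<eta> / 2)))"
        by (intro mult_left_mono) (auto simp: sum.distrib)
      thus ?thesis unfolding f_apply Z_def by (simp add: distrib_left)
    qed
    moreover have "(\<lambda>n. \<eta> / 2 + Z (r n)) \<longlonglongrightarrow> \<eta> / 2 + 0"
      using LIMSEQ_subseq_LIMSEQ[OF elim(2) r] by (intro tendsto_intros) (simp add: Z_def o_def)
    ultimately have "\<eta> / 2 + 0 \<le> 0"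
      using elim(1) by (intro LIMSEQ_le[of "\<lambda>n. \<eta> / 2 + Z (r n)" _ "\<lambda>n. \<phi> (f (r n) w)"]) auto
    thus False using \<eta>_pos by simp
  qed
  thus False
    using emeasure_eq_0_AE[where M = unit_interval_measure and P = "\<lambda>_. True"] emeasure_space_1 by simp
qed

section \<open>The Radon--Nikodym property implies separable duals\<close>

primrec binary_value :: "bool list \<Rightarrow> int" where
  "binary_value [] = 0"
| "binary_value (c # s) = 2 * binary_value s + of_bool c"

definition unit_interval_bit :: "nat \<Rightarrow> real \<Rightarrow> bool" where
  "unit_interval_bit k t = odd \<lfloor>2 ^ Suc k * t\<rfloor>"

text \<open>Halving the integer part of \<open>2 ^ Suc k * t\<close> drops its last binary digit,
  which is bit \<open>k\<close>. The last digit is the head of the list, so both recursions run in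
  the same direction.\<close>

lemma unit_interval_bit_path:
  assumes "0 \<le> t" "t < 1" "length s = k"
  shows "bit_path unit_interval_bit k t = s \<longleftrightarrow> \<lfloor>2 ^ k * t\<rfloor> = binary_value s"
  using assms(3)
proof (induction k arbitrary: s)
  case 0
  have "\<lfloor>t\<rfloor> = 0" using assms by (simp add: floor_eq_iff)
  thus ?case using 0 by simp
next
  case (Suc k)
  then obtain c r where s: "s = c # r" "length r = k" by (cases s) auto
  have "\<lfloor>2 ^ Suc k * t / real_of_int 2\<rfloor> = \<lfloor>2 ^ Suc k * t\<rfloor> div 2"
    by (rule floor_divide_real_eq_div) simp
  hence "\<lfloor>2 ^ k * t\<rfloor> = \<lfloor>2 ^ Suc k * t\<rfloor> div 2" by simp
  moreover have "odd m = c \<and> m div 2 = v \<longleftrightarrow> m = 2 * v + of_bool c" for m v :: int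
    by (cases c; simp; presburger)
  ultimately show ?case
    using Suc.IH[OF s(2)] by (simp add: s unit_interval_bit_def)
qed

lemma binary_value_bounds: "0 \<le> binary_value s \<and> binary_value s < 2 ^ length s"
  by (induction s) auto

lemma prob_space_unit_interval: "prob_space unit_interval_measure"
  by (intro prob_spaceI) (simp add: emeasure_restrict_space)

lemma fair_bits_unit_interval: "fair_bits unit_interval_measure unit_interval_bit"
proof -
  interpret prob_space unit_interval_measure by (rule prob_space_unit_interval)
  have bit: "unit_interval_bit k \<in> measurable unit_interval_measure (count_space UNIV)" for k
  proof (intro measurable_restrict_space1 measurable_completion)
    show "unit_interval_bit k \<in> measurable lborel (count_space UNIV)"
      unfolding unit_interval_bit_def[abs_def] by measurable
  qed
  show ?thesis
  proof
    show "unit_interval_bit k \<in> measurable unit_interval_measure (count_space UNIV)" for k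
      by (rule bit)
    fix k and s :: "bool list" assume len: "length s = k"
    let ?A = "{t \<in> space unit_interval_measure. bit_path unit_interval_bit k t = s}"
    let ?v = "real_of_int (binary_value s)"
    have "?A \<in> sets unit_interval_measure"
      using measurable_sets[OF measurable_bit_path[where b = unit_interval_bit, OF bit], of "{s}" k] by (simp add: vimage_def Int_def conj_commute)
    hence A: "?A \<in> sets lebesgue" by (auto simp: sets_restrict_space_iff)
    have "binary_value s + 1 \<le> 2 ^ k" using binary_value_bounds[of s] len by simp
    hence "real_of_int (binary_value s + 1) \<le> real_of_int (2 ^ k)" by (simp only: of_int_le_iff)
    hence "0 \<le> ?v" "?v + 1 \<le> 2 ^ k" using binary_value_bounds[of s] by auto
    \<comment> \<open>At the point 1 all bits are False although the integer part of
      \<open>2 ^ k\<close> is not the value of a list of length \<open>k\<close>; being a null set,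
      this point can be removed.\<close>
    hence "?A - {1} = {?v / 2 ^ k..<(?v + 1) / 2 ^ k}"
    proof (intro equalityI subsetI)
      fix t assume t: "t \<in> ?A - {1}"
      hence "0 \<le> t" "t < 1" "\<lfloor>2 ^ k * t\<rfloor> = binary_value s"
        using unit_interval_bit_path[of t s k] len by auto
      thus "t \<in> {?v / 2 ^ k..<(?v + 1) / 2 ^ k}" by (auto simp: floor_eq_iff field_simps)
    next
      fix t assume t: "t \<in> {?v / 2 ^ k..<(?v + 1) / 2 ^ k}" and *: "0 \<le> ?v" "?v + 1 \<le> 2 ^ k"
      have "0 \<le> ?v / 2 ^ k" "(?v + 1) / 2 ^ k \<le> 1" using * by auto
      hence t01: "0 \<le> t" "t < 1" using t by (meson atLeastLessThan_iff order_trans less_le_trans)+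
      moreover have "\<lfloor>2 ^ k * t\<rfloor> = binary_value s" using t by (auto simp: floor_eq_iff field_simps)
      ultimately show "t \<in> ?A - {1}" using unit_interval_bit_path[of t s k] len by auto
    qed
    hence "measure lebesgue ?A = measure lebesgue {?v / 2 ^ k..<(?v + 1) / 2 ^ k}"
      using measure_Diff_null_set[OF A, of "{1}"] negligible_sing[of "1::real"]
      by (simp add: negligible_iff_null_sets)
    also have "\<dots> = (1 / 2) ^ k"
      by (simp add: measure_completion divide_right_mono power_one_over field_simps)
    finally show "measure unit_interval_measure ?A = (1 / 2) ^ k"
      by (subst measure_restrict_space) auto
  qed
qed

text \<open>The Radon--Nikodym property speaks of measures on one fixed type of points; an injection
  of the reals into that type carries Lebesgue measure and its bits there.\<close>

lemma fair_bits_embed_measure: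
  assumes "fair_bits N b" "inj \<iota>"
  shows "fair_bits (embed_measure N \<iota>) (\<lambda>k w. b k (inv \<iota> w))"
proof -
  interpret fair_bits N b by fact
  have path: "bit_path (\<lambda>k w. b k (inv \<iota> w)) k w = bit_path b k (inv \<iota> w)" for k w
    by (induction k) auto
  have meas: "(\<lambda>w. h (inv \<iota> w)) \<in> measurable (embed_measure N \<iota>) (count_space UNIV)"
    if "h \<in> measurable N (count_space UNIV)" for h :: "'a \<Rightarrow> 'd"
    using that assms(2) by (intro measurable_embed_measure1) (auto simp: inv_f_f)
  interpret E: prob_space "embed_measure N \<iota>"
    using assms(2) emeasure_space_1
    by (intro prob_spaceI) (simp add: emeasure_embed_measure_image space_embed_measure)
  show ?thesis
  proof
    show "(\<lambda>w. b k (inv \<iota> w)) \<in> measurable (embed_measure N \<iota>) (count_space UNIV)" for k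
      by (intro meas b_measurable)
    fix k and s :: "bool list" assume len: "length s = k"
    let ?A = "{w \<in> space (embed_measure N \<iota>). bit_path (\<lambda>k w. b k (inv \<iota> w)) k w = s}"
    have "?A \<in> sets (embed_measure N \<iota>)"
      using measurable_sets[OF meas[OF path_measurable[of k]], of "{s}"]
      by (simp add: path vimage_def Int_def conj_commute)
    hence "emeasure (embed_measure N \<iota>) ?A = emeasure N (\<iota> -` ?A \<inter> space N)"
      using assms(2) by (intro emeasure_embed_measure)
    also have "\<iota> -` ?A \<inter> space N = {w\<in>space N. bit_path b k w = s}"
      using assms(2) by (auto simp: path space_embed_measure inv_f_f)
    finally show "measure (embed_measure N \<iota>) ?A = (1 / 2) ^ k"
      using measure_path[OF len] by (simp add: measure_def)
  qed
qed

text \<open>For the vector measure of the tree, the averages over the two halves of the cell of \<open>s\<close> are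
  separated by \<open>x s\<close>, so no density can be almost constant on a set of positive measure.\<close>

lemma functional_tree_not_radon_nikodym:
  fixes \<psi> :: "bool list \<Rightarrow> ('a::banach \<Rightarrow>\<^sub>L real)"
  assumes "functional_tree \<psi> x a K R \<eta>" and "fair_bits N b"
  shows "\<not> radon_nikodym_property_wrt N TYPE('a \<Rightarrow>\<^sub>L real)"
proof
  interpret functional_tree \<psi> x a K R \<eta> by fact
  interpret fair_bits N b by fact
  assume RNP: "radon_nikodym_property_wrt N TYPE('a \<Rightarrow>\<^sub>L real)"
  \<comment> \<open>Pairing sets with vectors lets a single filter limit serve all of them at once.
    The value 0 on nonmeasurable sets keeps the bound valid for every index.\<close>
  define u where "u n = (\<lambda>(E, y). if E \<in> sets N
      then \<integral>w. indicator E w * \<psi> (bit_path b n w) y \<partial>N else 0)" for n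
  have \<psi>_le: "\<bar>\<psi> s y\<bar> \<le> K * norm y" for s y
  proof -
    have "\<bar>\<psi> s y\<bar> \<le> norm (\<psi> s) * norm y" using norm_blinfun[of "\<psi> s" y] by simp
    also have "\<dots> \<le> K * norm y" by (intro mult_right_mono norm_\<psi>) simp
    finally show ?thesis .
  qed
  have integrable: "integrable N (\<lambda>w. indicator E w * \<psi> (bit_path b n w) y)"
    if "E \<in> sets N" for E n y
    using integrable_mult_indicator[OF that path_integrable[of "\<lambda>s. \<psi> s y"]] by simp
  have u_eq: "u n (E, y) = (\<integral>w. indicator E w * \<psi> (bit_path b n w) y \<partial>N)"
    if "E \<in> sets N" for E n y using that by (simp add: u_def)
  have integral_ind: "(\<integral>w. indicator E w * c \<partial>N) = c * measure N E"
    if "E \<in> sets N" for E and c :: real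
    using that sets.sets_into_space[OF that] by (simp add: Int_absorb2 Int_commute)
  have integrable_ind: "integrable N (\<lambda>w. indicator E w * c)" if "E \<in> sets N" for E and c :: real
    using that by (intro integrable_mult_left) (auto simp: less_top[symmetric])
  have u_le: "\<bar>u n (E, y)\<bar> \<le> K * norm y * measure N E" for n E y
  proof (cases "E \<in> sets N")
    case True
    have "\<bar>u n (E, y)\<bar> \<le> (\<integral>w. \<bar>indicator E w * \<psi> (bit_path b n w) y\<bar> \<partial>N)"
      using True by (simp add: u_def)
    also have "\<dots> \<le> (\<integral>w. indicator E w * (K * norm y) \<partial>N)"
      using True \<psi>_le integrable_abs[OF integrable[OF True]]
      by (intro integral_mono integrable_ind) (auto simp: indicator_def)
    finally show ?thesis unfolding integral_ind[OF True] .
  qed (simp add: u_def K_nonneg)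
  define B where "B = (\<lambda>(E, y :: 'a). K * norm y * measure N E)"
  have u_B: "\<bar>u n i\<bar> \<le> B i" for n i using u_le by (cases i) (simp add: B_def)
  obtain F L where F: "F \<noteq> bot" "F \<le> sequentially" and L: "\<And>i. ((\<lambda>n. u n i) \<longlongrightarrow> L i) F"
    by (rule bounded_sequence_filter_limit[of u B, OF u_B]) (rule that)
  have L_le: "\<bar>L (E, y)\<bar> \<le> K * norm y * measure N E" for E y
    using tendsto_upperbound[OF tendsto_rabs[OF L[of "(E, y)"]] always_eventually F(1)] u_le by blast
  have lin: "bounded_linear (\<lambda>y. L (E, y))" for E
  proof (rule bounded_linear_intro[of _ "K * measure N E"])
    have "u n (E, y + z) = u n (E, y) + u n (E, z)" for n y z
      using integrable by (simp add: u_def blinfun.add_right distrib_left)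
    thus "L (E, y + z) = L (E, y) + L (E, z)" for y z
      using tendsto_unique[OF F(1) L[of "(E, y + z)"]] tendsto_add[OF L[of "(E, y)"] L[of "(E, z)"]] by simp
    have "u n (E, r *\<^sub>R y) = r * u n (E, y)" for n r y
      by (simp add: u_def blinfun.scaleR_right mult.left_commute)
    thus "L (E, r *\<^sub>R y) = r *\<^sub>R L (E, y)" for r y
      using tendsto_unique[OF F(1) L[of "(E, r *\<^sub>R y)"]] tendsto_mult_left[OF L[of "(E, y)"], of r] by simp
    show "norm (L (E, y)) \<le> norm y * (K * measure N E)" for y
      using L_le[of E y] by (simp add: mult_ac)
  qed
  define G where "G E = Blinfun (\<lambda>y. L (E, y))" for E
  have G_apply: "G E y = L (E, y)" for E y
    unfolding G_def using bounded_linear_Blinfun_apply[OF lin] by simp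
  have G: "lipschitz_charge N K G"
    unfolding lipschitz_charge_def
  proof (intro conjI ballI impI)
    show "norm (G E) \<le> K * measure N E" for E
      using L_le[of E] K_nonneg by (intro norm_blinfun_bound) (auto simp: G_apply mult_ac)
    fix A B assume AB: "A \<in> sets N" "B \<in> sets N" "A \<inter> B = {}"
    have "u n (A \<union> B, y) = u n (A, y) + u n (B, y)" for n y
    proof -
      have "indicat_real (A \<union> B) w = indicator A w + indicator B w" for w
        using AB(3) by (auto simp: indicator_def)
      thus ?thesis using AB integrable by (simp add: u_def distrib_right)
    qed
    hence "L (A \<union> B, y) = L (A, y) + L (B, y)" for y
      using tendsto_unique[OF F(1) L[of "(A \<union> B, y)"]] tendsto_add[OF L[of "(A, y)"] L[of "(B, y)"]] by simp
    thus "G (A \<union> B) = G A + G B" by (intro blinfun_eqI) (simp add: G_apply blinfun.add_left)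
  qed
  define cell where "cell k s = {w\<in>space N. bit_path b k w = s}" for k s
  have cell_sets [measurable]: "cell k s \<in> sets N" for k s unfolding cell_def by measurable
  have ev: "eventually (\<lambda>n. k < n) F" for k
    using F(2) eventually_gt_at_top[of k] by (auto simp: le_filter_def)
  \<comment> \<open>Once \<open>n\<close> exceeds \<open>k\<close>, the paths of all points of
    \<open>E\<close> extend \<open>True # s\<close>, so the lower bound holds pointwise under the
    integral and survives the limit.\<close>
  have upper: "G E (x s) \<ge> (a s + \<eta>) * measure N E"
    if E: "E \<in> sets N" "E \<subseteq> cell (Suc k) (True # s)" for E k s
  proof -
    have "u n (E, x s) \<ge> (a s + \<eta>) * measure N E" if kn: "k < n" for n
    proof -
      have "(\<integral>w. indicator E w * (a s + \<eta>) \<partial>N) \<le> u n (E, x s)"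
        unfolding u_eq[OF E(1)]
      proof (intro integral_mono integrable_ind[OF E(1)] integrable[OF E(1)])
        fix w
        show "indicator E w * (a s + \<eta>) \<le> indicator E w * \<psi> (bit_path b n w) (x s)"
        proof (cases "w \<in> E")
          case True
          obtain v where "bit_path b n w = v @ b k w # bit_path b k w" by (rule bit_path_later[OF kn])
          thus ?thesis using True E(2) \<psi>_True[of s v] by (auto simp: cell_def)
        qed simp
      qed
      thus ?thesis unfolding integral_ind[OF E(1)] .
    qed
    hence "eventually (\<lambda>n. u n (E, x s) \<ge> (a s + \<eta>) * measure N E) F"
      using ev[of k] by (auto elim: eventually_mono)
    from tendsto_lowerbound[OF L this F(1)] show ?thesis by (simp add: G_apply)
  qed
  have lower: "G E (x s) \<le> a s * measure N E"
    if E: "E \<in> sets N" "E \<subseteq> cell (Suc k) (False # s)" for E k s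
  proof -
    have "u n (E, x s) \<le> a s * measure N E" if kn: "k < n" for n
    proof -
      have "u n (E, x s) \<le> (\<integral>w. indicator E w * a s \<partial>N)"
        unfolding u_eq[OF E(1)]
      proof (intro integral_mono integrable_ind[OF E(1)] integrable[OF E(1)])
        fix w
        show "indicator E w * \<psi> (bit_path b n w) (x s) \<le> indicator E w * a s"
        proof (cases "w \<in> E")
          case True
          obtain v where "bit_path b n w = v @ b k w # bit_path b k w" by (rule bit_path_later[OF kn])
          thus ?thesis using True E(2) \<psi>_False[of v s] by (auto simp: cell_def)
        qed simp
      qed
      thus ?thesis unfolding integral_ind[OF E(1)] .
    qed
    hence "eventually (\<lambda>n. u n (E, x s) \<le> a s * measure N E) F"
      using ev[of k] by (auto elim: eventually_mono)
    from tendsto_upperbound[OF L this F(1)] show ?thesis by (simp add: G_apply)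
  qed
  have "vector_measure N G" "total_variation N G < \<infinity>" "continuous_wrt_measure N G"
    using lipschitz_charge_vector_measure[OF finite_measure_axioms G]
      lipschitz_charge_total_variation[OF finite_measure_axioms G K_nonneg]
      lipschitz_charge_continuous[OF G K_nonneg] by auto
  then obtain g z where gz: "has_strong_bochner_integral N g z"
    and g: "\<And>E. E \<in> sets N \<Longrightarrow> has_strong_bochner_integral N (\<lambda>w. indicator E w *\<^sub>R g w) (G E)"
    using RNP unfolding radon_nikodym_property_wrt_def by blast
  obtain s where s: "\<And>n::nat. simple_function N (s n)" and s_lim: "AE w in N. (\<lambda>n. s n w) \<longlonglongrightarrow> g w"
    using gz unfolding has_strong_bochner_integral_def strongly_measurable_def by blast
  \<comment> \<open>Testing with \<open>x s\<close> multiplies errors by at most \<open>R\<close>,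
    so closeness \<open>\<delta>\<close> costs at most \<open>\<eta> / 4\<close> per unit of
    measure; adding 1 covers \<open>R = 0\<close>.\<close>
  define \<delta> where "\<delta> = \<eta> / (4 * (R + 1))"
  have R: "R \<ge> 0" using norm_x[of "[]"] norm_ge_zero order_trans by blast
  have \<delta>: "\<delta> > 0" using \<eta>_pos R by (simp add: \<delta>_def)
  \<comment> \<open>Almost every point lies in some \<open>H k\<close>, and \<open>s k\<close>
    divides \<open>H k\<close> into finitely many pieces. One piece has positive measure, and there
    the density stays within \<open>\<delta>\<close> of the single value \<open>y\<close>.\<close>
  define H where "H k = {w\<in>space N. \<forall>j\<ge>k. norm (s j w - s k w) \<le> \<delta>}" for k
  have [measurable]: "(\<lambda>w. norm (s j w - s k w)) \<in> borel_measurable N" for j k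
    by (intro borel_measurable_norm_diff_simple s)
  have H_sets [measurable]: "H k \<in> sets N" for k unfolding H_def by measurable
  have s_sets [measurable]: "{w\<in>space N. s k w = y} \<in> sets N" for k y
    using simple_functionD(2)[OF s[of k], of "{y}"] by (simp add: vimage_def Int_def conj_commute)
  have "\<exists>k y. measure N (H k \<inter> {w\<in>space N. s k w = y}) > 0"
  proof (rule ccontr)
    assume "\<not> ?thesis"
    hence null: "H k \<inter> {w\<in>space N. s k w = y} \<in> null_sets N" for k y
      by (auto simp: null_sets_def emeasure_eq_measure measure_le_0_iff not_less)
    have "H k \<in> null_sets N" for k
    proof -
      have "finite (s k ` space N)" using s[of k] by (simp add: simple_function_def)
      hence "(\<Union>y\<in>s k ` space N. H k \<inter> {w\<in>space N. s k w = y}) \<in> null_sets N"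
        by (intro null_sets_UN' null) (auto intro: countable_finite)
      moreover have "(\<Union>y\<in>s k ` space N. H k \<inter> {w\<in>space N. s k w = y}) = H k"
        by (auto simp: H_def)
      ultimately show ?thesis by simp
    qed
    hence "AE w in N. w \<notin> (\<Union>k. H k)" by (intro AE_not_in null_sets_UN)
    moreover have "AE w in N. w \<in> (\<Union>k. H k)"
      using s_lim AE_space
    proof eventually_elim
      case (elim w)
      have "Cauchy (\<lambda>n. s n w)" using elim(1) by (rule LIMSEQ_imp_Cauchy)
      then obtain k where "\<forall>m\<ge>k. \<forall>n\<ge>k. norm (s m w - s n w) < \<delta>"
        using CauchyD[OF _ \<delta>] by blast
      hence "w \<in> H k" using elim(2) by (auto simp: H_def less_imp_le)
      thus ?case by blast
    qed
    ultimately have "AE w in N. False" by eventually_elim blast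
    thus False
      using emeasure_eq_0_AE[where M = N and P = "\<lambda>_. True"] emeasure_space_1 by simp
  qed
  then obtain k y where pos: "measure N (H k \<inter> {w\<in>space N. s k w = y}) > 0" by blast
  define E where "E = H k \<inter> {w\<in>space N. s k w = y}"
  have E_sets [measurable]: "E \<in> sets N" unfolding E_def by measurable
  have close: "AE w in N. w \<in> E \<longrightarrow> norm (g w - y) \<le> \<delta>"
    using s_lim
  proof eventually_elim
    case (elim w)
    show ?case
    proof
      assume "w \<in> E"
      hence "\<forall>j\<ge>k. norm (s j w - y) \<le> \<delta>" by (auto simp: E_def H_def)
      thus "norm (g w - y) \<le> \<delta>"
        using elim by (intro LIMSEQ_le_const2[where X = "\<lambda>j. norm (s j w - y)"] tendsto_intros) auto
    qed
  qed
  have near: "\<bar>G E' (x s) - y (x s) * measure N E'\<bar> \<le> \<eta> / 4 * measure N E'"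
    if "E' \<in> sets N" "E' \<subseteq> E" for E' s
  proof -
    have "norm (G E' - measure N E' *\<^sub>R y) \<le> \<delta> * measure N E'"
      using that close less_imp_le[OF \<delta>]
      by (intro strong_bochner_integral_close[OF finite_measure_axioms that(1) g[OF that(1)]]) (auto elim: AE_mp)
    hence "\<bar>(G E' - measure N E' *\<^sub>R y) (x s)\<bar> \<le> \<delta> * measure N E' * R"
      using norm_blinfun[of "G E' - measure N E' *\<^sub>R y" "x s"] norm_x[of s] \<delta> R
      by (auto intro: order_trans[OF _ mult_mono])
    also have "\<dots> = \<eta> / 4 * measure N E' * (R / (R + 1))" by (simp add: \<delta>_def)
    also have "\<dots> \<le> \<eta> / 4 * measure N E' * 1"
      using R \<eta>_pos by (intro mult_left_mono) auto
    finally show ?thesis by (simp add: blinfun.diff_left blinfun.scaleR_left mult.commute)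
  qed
  \<comment> \<open>If both halves had positive measure, then \<open>a s + \<eta>\<close> would be
    at most \<open>y (x s) + \<eta> / 4\<close> and \<open>y (x s) - \<eta> / 4\<close> at most
    \<open>a s\<close>, so \<open>\<eta>\<close> would be at most \<open>\<eta> / 2\<close>.\<close>
  have split: "measure N (E \<inter> cell (Suc k) (True # s)) = 0 \<or> measure N (E \<inter> cell (Suc k) (False # s)) = 0" for k s
  proof (rule ccontr)
    let ?T = "E \<inter> cell (Suc k) (True # s)" and ?F = "E \<inter> cell (Suc k) (False # s)"
    assume "\<not> ?thesis"
    hence T: "measure N ?T > 0" and F: "measure N ?F > 0" by (auto simp: measure_nonneg less_le)
    have "\<bar>G ?T (x s) - y (x s) * measure N ?T\<bar> \<le> \<eta> / 4 * measure N ?T"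
      by (intro near) auto
    hence "G ?T (x s) \<le> y (x s) * measure N ?T + \<eta> / 4 * measure N ?T"
      by linarith
    hence "(a s + \<eta>) * measure N ?T \<le> (y (x s) + \<eta> / 4) * measure N ?T"
      using upper[of ?T k s] by (simp add: distrib_right)
    hence "a s + \<eta> \<le> y (x s) + \<eta> / 4" using T by simp
    moreover have "\<bar>G ?F (x s) - y (x s) * measure N ?F\<bar> \<le> \<eta> / 4 * measure N ?F"
      by (intro near) auto
    hence "y (x s) * measure N ?F - \<eta> / 4 * measure N ?F \<le> G ?F (x s)"
      by linarith
    hence "(y (x s) - \<eta> / 4) * measure N ?F \<le> a s * measure N ?F"
      using lower[of ?F k s] by (simp add: left_diff_distrib)
    hence "y (x s) - \<eta> / 4 \<le> a s" using F by simp
    ultimately show False using \<eta>_pos by linarith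
  qed
  \<comment> \<open>Since \<open>E\<close> never splits, up to null sets it lies in a single cell at
    each level, and the measures of these cells tend to 0.\<close>
  have "\<exists>s. length s = n \<and> measure N (E \<inter> cell n s) = measure N E" for n
  proof (induction n)
    case 0
    have "E \<inter> cell 0 [] = E" using sets.sets_into_space[OF E_sets] by (auto simp: cell_def)
    thus ?case by auto
  next
    case (Suc n)
    then obtain s where s: "length s = n" "measure N (E \<inter> cell n s) = measure N E" by blast
    have "E \<inter> cell n s = (E \<inter> cell (Suc n) (True # s)) \<union> (E \<inter> cell (Suc n) (False # s))"
      by (auto simp: cell_def)
    hence "measure N E = measure N (E \<inter> cell (Suc n) (True # s)) + measure N (E \<inter> cell (Suc n) (False # s))"
      using s(2) by (simp, subst finite_measure_Union[symmetric]) (auto simp: cell_def[of "Suc n"])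
    thus ?case using split[of n s] s(1) by (metis add.right_neutral add.left_neutral length_Cons)
  qed
  moreover have "measure N (E \<inter> cell n s) \<le> (1 / 2) ^ n" if "length s = n" for n s
    using measure_path[OF that] finite_measure_mono[of "E \<inter> cell n s" "cell n s"] by (auto simp: cell_def)
  ultimately have "measure N E \<le> (1 / 2) ^ n" for n by metis
  moreover have "(\<lambda>n. (1 / 2 :: real) ^ n) \<longlonglongrightarrow> 0" by (rule LIMSEQ_realpow_zero) auto
  ultimately have "measure N E \<le> 0" by (intro LIMSEQ_le_const) auto
  thus False using pos by (simp add: E_def)
qed

lemma separable_dual_if_radon_nikodym:
  assumes card: "(UNIV :: real set) \<lesssim> (UNIV :: 'c set)"
    and RNP: "radon_nikodym_property TYPE('c) TYPE('a::banach \<Rightarrow>\<^sub>L real)"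
  shows "separable_subspaces_have_separable_dual TYPE('a)"
proof (rule ccontr)
  assume "\<not> ?thesis"
  from functional_tree_exists[OF this] obtain \<psi> :: "bool list \<Rightarrow> ('a \<Rightarrow>\<^sub>L real)" and x a K R \<eta>
    where tree: "functional_tree \<psi> x a K R \<eta>" by blast
  obtain \<iota> :: "real \<Rightarrow> 'c" where "inj \<iota>" using card unfolding lepoll_def by blast
  from fair_bits_embed_measure[OF fair_bits_unit_interval this]
  have bits: "fair_bits (embed_measure unit_interval_measure \<iota>) (\<lambda>k w. unit_interval_bit k (inv \<iota> w))" .
  hence "finite_measure (embed_measure unit_interval_measure \<iota>)"
    by (simp add: fair_bits_def prob_space.finite_measure)
  thus False
    using RNP functional_tree_not_radon_nikodym[OF tree bits] unfolding radon_nikodym_property_def by blast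
qed

lemma separable_dual_if_property_A_inf:
  assumes "property_A_inf TYPE('a::banach)"
  shows "separable_subspaces_have_separable_dual TYPE('a)"
  using functional_tree_exists functional_tree_not_property_A_inf[OF _ fair_bits_unit_interval] assms by blast

section \<open>Separable duals imply weak convergence almost everywhere\<close>

text \<open>This is completeness of Lebesgue measure, applied after extending both functions by 0 to
  the real line.\<close>

lemma borel_measurable_unit_interval_AE:
  fixes f g :: "real \<Rightarrow> real"
  assumes f: "f \<in> borel_measurable unit_interval_measure"
    and eq: "AE w in unit_interval_measure. f w = g w"
  shows "g \<in> borel_measurable unit_interval_measure"
proof -
  have "(\<lambda>x. if x \<in> {0..1} then g x else 0) \<in> borel_measurable lebesgue"
  proof (rule borel_measurable_AE)
    show "(\<lambda>x. if x \<in> {0..1} then f x else 0) \<in> borel_measurable lebesgue"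
      using f by (subst borel_measurable_if) auto
    show "AE x in lebesgue. (if x \<in> {0..1} then f x else 0) = (if x \<in> {0..1} then g x else 0)"
      using eq by (subst (asm) AE_restrict_space_iff) (auto elim: eventually_mono)
  qed
  thus ?thesis by (subst (asm) borel_measurable_if) auto
qed

lemma strongly_measurable_functional:
  fixes f :: "real \<Rightarrow> 'a::banach" and \<phi> :: "'a \<Rightarrow>\<^sub>L real"
  assumes "strongly_measurable unit_interval_measure f"
  shows "(\<lambda>w. blinfun_apply \<phi> (f w)) \<in> borel_measurable unit_interval_measure"
proof -
  obtain s f' where s: "\<And>n::nat. simple_function unit_interval_measure (s n)"
    "\<And>w. w \<in> space unit_interval_measure \<Longrightarrow> (\<lambda>n. s n w) \<longlonglongrightarrow> f' w"
    and eq: "AE w in unit_interval_measure. f' w = f w"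
    by (rule strongly_measurable_everywhere[OF assms]) (rule that)
  have "(\<lambda>w. blinfun_apply \<phi> (f' w)) \<in> borel_measurable unit_interval_measure"
  proof (rule borel_measurable_LIMSEQ_real)
    show "(\<lambda>n. blinfun_apply \<phi> (s n w)) \<longlonglongrightarrow> blinfun_apply \<phi> (f' w)"
      if "w \<in> space unit_interval_measure" for w
      by (intro tendsto_intros s that)
    show "(\<lambda>w. blinfun_apply \<phi> (s n w)) \<in> borel_measurable unit_interval_measure" for n
      by (rule borel_measurable_simple_function, rule simple_function_compose1[OF s(1)])
  qed
  thus ?thesis
    by (rule borel_measurable_unit_interval_AE) (use eq in \<open>auto elim: eventually_mono\<close>)
qed

text \<open>Almost all values of the \<open>f n\<close> and of \<open>g\<close> are limits of
  vectors from the countable set \<open>D\<close> of values of the approximating simple functions. A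
  functional close to \<open>\<psi>\<close> on bounded parts of \<open>D\<close> is then close to it
  at these values, and convergence follows by splitting into three terms. The quantifier over
  \<open>r\<close> stands inside the almost-everywhere statement, so the null set serves
  subsequences chosen later.\<close>

lemma countable_test_functionals:
  fixes f :: "nat \<Rightarrow> real \<Rightarrow> 'a::banach"
  assumes sep: "separable_subspaces_have_separable_dual TYPE('a)"
    and f: "Linf_bounded f" and g: "strongly_measurable unit_interval_measure g"
  obtains \<Psi> :: "('a \<Rightarrow>\<^sub>L real) set" where "countable \<Psi>"
    "AE w in unit_interval_measure. \<forall>r :: nat \<Rightarrow> nat.
       (\<forall>\<psi>\<in>\<Psi>. (\<lambda>n. blinfun_apply \<psi> (f (r n) w)) \<longlonglongrightarrow> blinfun_apply \<psi> (g w)) \<longrightarrow>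
       (\<forall>\<phi> :: 'a \<Rightarrow>\<^sub>L real. (\<lambda>n. blinfun_apply \<phi> (f (r n) w)) \<longlonglongrightarrow> blinfun_apply \<phi> (g w))"
proof -
  let ?M = unit_interval_measure
  have "\<forall>n. \<exists>s. (\<forall>k::nat. simple_function ?M (s k)) \<and> (AE w in ?M. (\<lambda>k. s k w) \<longlonglongrightarrow> f n w)"
    using f unfolding Linf_bounded_def strongly_measurable_def by blast
  from choice[OF this] obtain s where s: "\<And>n k::nat. simple_function ?M (s n k)"
    and s_lim: "\<And>n. AE w in ?M. (\<lambda>k. s n k w) \<longlonglongrightarrow> f n w" by blast
  obtain t where t: "\<And>k::nat. simple_function ?M (t k)" and t_lim: "AE w in ?M. (\<lambda>k. t k w) \<longlonglongrightarrow> g w"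
    using g unfolding strongly_measurable_def by blast
  define D where "D = (\<Union>n k. s n k ` space ?M) \<union> (\<Union>k. t k ` space ?M)"
  have "countable (s n k ` space ?M)" "countable (t k ` space ?M)" for n k
    using s[of n k] t[of k] by (auto simp: simple_function_def countable_finite)
  hence D: "countable D" unfolding D_def by (intro countable_Un countable_UN) auto
  \<comment> \<open>The pair \<open>p\<close> consists of a radius and a precision. Since
    \<open>g\<close> and the approximants are not assumed bounded, \<open>D\<close> has to be cut
    into bounded pieces before separability applies.\<close>
  have "\<forall>p. \<exists>\<Psi>. countable \<Psi> \<and> (\<forall>\<phi>. \<exists>\<psi>\<in>\<Psi>. \<forall>x\<in>{d\<in>D. norm d \<le> real (fst p)}.
      \<bar>blinfun_apply \<phi> x - blinfun_apply \<psi> x\<bar> \<le> 1 / real (Suc (snd p)))"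
  proof
    fix p :: "nat \<times> nat"
    have "countable {d\<in>D. norm d \<le> real (fst p)}" using D by (rule countable_subset[rotated]) auto
    moreover have "bounded {d\<in>D. norm d \<le> real (fst p)}" by (rule boundedI[of _ "real (fst p)"]) auto
    ultimately have "uniformly_coverable {d\<in>D. norm d \<le> real (fst p)} (1 / real (Suc (snd p))) UNIV"
      using sep unfolding separable_subspaces_have_separable_dual_def by simp
    thus "\<exists>\<Psi>. countable \<Psi> \<and> (\<forall>\<phi>. \<exists>\<psi>\<in>\<Psi>. \<forall>x\<in>{d\<in>D. norm d \<le> real (fst p)}.
      \<bar>blinfun_apply \<phi> x - blinfun_apply \<psi> x\<bar> \<le> 1 / real (Suc (snd p)))"
      unfolding uniformly_coverable_def by simp
  qed
  from choice[OF this] obtain \<Psi> where \<Psi>_all: "\<forall>p. countable (\<Psi> p) \<and> (\<forall>\<phi>. \<exists>\<psi>\<in>\<Psi> p.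
      \<forall>x\<in>{d\<in>D. norm d \<le> real (fst p)}. \<bar>blinfun_apply \<phi> x - blinfun_apply \<psi> x\<bar> \<le> 1 / real (Suc (snd p)))" ..
  have \<Psi>: "countable (\<Psi> p)" "\<exists>\<psi>\<in>\<Psi> p. \<forall>x\<in>{d\<in>D. norm d \<le> real (fst p)}.
      \<bar>blinfun_apply \<phi> x - blinfun_apply \<psi> x\<bar> \<le> 1 / real (Suc (snd p))" for p \<phi>
    by (rule conjunct1[OF spec[OF \<Psi>_all]], rule spec[OF conjunct2[OF spec[OF \<Psi>_all]]])
  obtain C :: nat where C: "(SUP n. esssup ?M (\<lambda>w. ennreal (norm (f n w)))) \<le> ennreal (real C)"
  proof -
    obtain c where "c \<ge> 0" "(SUP n. esssup ?M (\<lambda>w. ennreal (norm (f n w)))) = ennreal c"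
      using f unfolding Linf_bounded_def by (auto simp: less_top_ennreal)
    thus ?thesis using that[of "nat \<lceil>c\<rceil>"] by (simp add: of_nat_ceiling ennreal_leI)
  qed
  have bd: "AE w in ?M. \<forall>n. norm (f n w) \<le> real C"
    unfolding AE_all_countable
  proof
    fix n
    have "esssup ?M (\<lambda>w. ennreal (norm (f n w))) \<le> ennreal (real C)"
      by (rule order_trans[OF SUP_upper C]) simp
    with esssup_AE[where M = ?M and f = "\<lambda>w. ennreal (norm (f n w))"] show "AE w in ?M. norm (f n w) \<le> real C"
      by (auto elim!: eventually_mono dest: order_trans simp flip: ennreal_of_nat_eq_real_of_nat)
  qed
  have close: "\<bar>blinfun_apply \<phi> y - blinfun_apply \<psi> y\<bar> \<le> \<epsilon>"
    if v: "\<And>k. v k \<in> D" "v \<longlonglongrightarrow> y" and y: "norm y < R"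
      and \<epsilon>: "\<forall>x\<in>{d\<in>D. norm d \<le> R}. \<bar>blinfun_apply \<phi> x - blinfun_apply \<psi> x\<bar> \<le> \<epsilon>"
    for v y R \<epsilon> and \<phi> \<psi> :: "'a \<Rightarrow>\<^sub>L real"
  proof (rule tendsto_upperbound)
    show "(\<lambda>k. \<bar>blinfun_apply \<phi> (v k) - blinfun_apply \<psi> (v k)\<bar>) \<longlonglongrightarrow> \<bar>blinfun_apply \<phi> y - blinfun_apply \<psi> y\<bar>"
      by (intro tendsto_intros v)
    have "eventually (\<lambda>k. norm (v k) < R) sequentially"
      using order_tendstoD(2)[OF tendsto_norm[OF v(2)] y] .
    thus "eventually (\<lambda>k. \<bar>blinfun_apply \<phi> (v k) - blinfun_apply \<psi> (v k)\<bar> \<le> \<epsilon>) sequentially"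
      by eventually_elim (use \<epsilon> v(1) in auto)
  qed simp
  have "AE w in ?M. \<forall>n. (\<lambda>k. s n k w) \<longlonglongrightarrow> f n w" using s_lim by (simp add: AE_all_countable)
  hence "AE w in ?M. \<forall>r :: nat \<Rightarrow> nat.
       (\<forall>\<psi>\<in>(\<Union>p. \<Psi> p). (\<lambda>n. blinfun_apply \<psi> (f (r n) w)) \<longlonglongrightarrow> blinfun_apply \<psi> (g w)) \<longrightarrow>
       (\<forall>\<phi> :: 'a \<Rightarrow>\<^sub>L real. (\<lambda>n. blinfun_apply \<phi> (f (r n) w)) \<longlonglongrightarrow> blinfun_apply \<phi> (g w))"
    using t_lim bd AE_space
  proof eventually_elim
    case (elim w)
    show ?case
    proof (intro allI impI)
      fix r :: "nat \<Rightarrow> nat" and \<phi> :: "'a \<Rightarrow>\<^sub>L real"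
      assume conv: "\<forall>\<psi>\<in>(\<Union>p. \<Psi> p). (\<lambda>n. blinfun_apply \<psi> (f (r n) w)) \<longlonglongrightarrow> blinfun_apply \<psi> (g w)"
      \<comment> \<open>The strict inequality puts the approximants of the values eventually into
        the ball of radius \<open>R\<close> as well.\<close>
      obtain R :: nat where R: "real C + norm (g w) < real R" using reals_Archimedean2 by blast
      show "(\<lambda>n. blinfun_apply \<phi> (f (r n) w)) \<longlonglongrightarrow> blinfun_apply \<phi> (g w)"
      proof (rule LIMSEQ_I)
        fix e :: real assume "e > 0"
        obtain j :: nat where j: "1 / real (Suc j) < e / 3"
          using \<open>e > 0\<close> reals_Archimedean[of "e / 3"] by (auto simp: inverse_eq_divide)
        obtain \<psi> where \<psi>: "\<psi> \<in> \<Psi> (R, j)" and near: "\<forall>x\<in>{d\<in>D. norm d \<le> real R}.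
            \<bar>blinfun_apply \<phi> x - blinfun_apply \<psi> x\<bar> \<le> 1 / real (Suc j)"
          using \<Psi>(2)[of "(R, j)" \<phi>] by auto
        have near_f: "\<bar>blinfun_apply \<phi> (f n w) - blinfun_apply \<psi> (f n w)\<bar> \<le> 1 / real (Suc j)" for n
        proof (rule close[OF _ _ _ near])
          show "s n k w \<in> D" for k using elim(4) unfolding D_def by blast
          show "(\<lambda>k. s n k w) \<longlonglongrightarrow> f n w" using elim(1) by blast
          show "norm (f n w) < real R" using elim(3) R norm_ge_zero[of "g w"] by (smt (verit))
        qed
        have near_g: "\<bar>blinfun_apply \<phi> (g w) - blinfun_apply \<psi> (g w)\<bar> \<le> 1 / real (Suc j)"
        proof (rule close[OF _ _ _ near])
          show "t k w \<in> D" for k using elim(4) unfolding D_def by blast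
          show "(\<lambda>k. t k w) \<longlonglongrightarrow> g w" using elim(2) .
          show "norm (g w) < real R" using R by linarith
        qed
        have "(\<lambda>n. blinfun_apply \<psi> (f (r n) w)) \<longlonglongrightarrow> blinfun_apply \<psi> (g w)" using conv \<psi> by blast
        from LIMSEQ_D[OF this, of "e / 3"] \<open>e > 0\<close> obtain n0 where
          n0: "\<And>n. n \<ge> n0 \<Longrightarrow> \<bar>blinfun_apply \<psi> (f (r n) w) - blinfun_apply \<psi> (g w)\<bar> < e / 3" by auto
        have "\<bar>blinfun_apply \<phi> (f (r n) w) - blinfun_apply \<phi> (g w)\<bar> < e" if "n \<ge> n0" for n
          using near_f[of "r n"] near_g n0[OF that] j by linarith
        thus "\<exists>n0. \<forall>n\<ge>n0. norm (blinfun_apply \<phi> (f (r n) w) - blinfun_apply \<phi> (g w)) < e" by auto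
      qed
    qed
  qed
  moreover have "countable (\<Union>p. \<Psi> p)" using \<Psi>(1) by (intro countable_UN) auto
  ultimately show ?thesis using that by blast
qed

lemma property_A_inf'_if_separable_dual:
  assumes "separable_subspaces_have_separable_dual TYPE('a::banach)"
  shows "property_A_inf' TYPE('a)"
  unfolding property_A_inf'_def
proof (intro allI impI)
  fix f :: "nat \<Rightarrow> real \<Rightarrow> 'a" and g
  assume fg: "Linf_bounded f" "strongly_measurable unit_interval_measure g"
    and conv: "converges_scalarly_ae f g"
  obtain \<Psi> :: "('a \<Rightarrow>\<^sub>L real) set" where \<Psi>: "countable \<Psi>" and
    test: "AE w in unit_interval_measure. \<forall>r :: nat \<Rightarrow> nat.
       (\<forall>\<psi>\<in>\<Psi>. (\<lambda>n. blinfun_apply \<psi> (f (r n) w)) \<longlonglongrightarrow> blinfun_apply \<psi> (g w)) \<longrightarrow>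
       (\<forall>\<phi> :: 'a \<Rightarrow>\<^sub>L real. (\<lambda>n. blinfun_apply \<phi> (f (r n) w)) \<longlonglongrightarrow> blinfun_apply \<phi> (g w))"
    by (rule countable_test_functionals[OF assms fg])
  have "AE w in unit_interval_measure.
      \<forall>\<psi>\<in>\<Psi>. (\<lambda>n. blinfun_apply \<psi> (f n w)) \<longlonglongrightarrow> blinfun_apply \<psi> (g w)"
    using conv \<Psi> by (simp add: AE_ball_countable converges_scalarly_ae_def)
  with test show "converges_weakly_ae f g"
    unfolding converges_weakly_ae_def
  proof eventually_elim
    case (elim w)
    from elim(1)[rule_format, of "\<lambda>n. n"] elim(2) show ?case by blast
  qed
qed

text \<open>A diagonal choice: at index \<open>r k\<close> the first test functionals, up to number
  \<open>k\<close>, deviate by \<open>1 / real (Suc k)\<close> or more only on sets of measure below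
  \<open>(1 / 2) ^ k\<close>. Borel--Cantelli then gives convergence almost everywhere for each of
  the countably many tests.\<close>

lemma property_B_inf_if_separable_dual:
  assumes "separable_subspaces_have_separable_dual TYPE('a::banach)"
  shows "property_B_inf TYPE('a)"
  unfolding property_B_inf_def
proof (intro allI impI)
  let ?M = unit_interval_measure
  interpret finite_measure ?M by (rule finite_measure_lebesgue_on) simp
  fix f :: "nat \<Rightarrow> real \<Rightarrow> 'a" and g
  assume fg: "Linf_bounded f" "strongly_measurable ?M g"
    and conv: "converges_scalarly_in_measure f g"
  obtain \<Psi> :: "('a \<Rightarrow>\<^sub>L real) set" where \<Psi>: "countable \<Psi>" and
    test: "AE w in ?M. \<forall>r :: nat \<Rightarrow> nat.
       (\<forall>\<psi>\<in>\<Psi>. (\<lambda>n. blinfun_apply \<psi> (f (r n) w)) \<longlonglongrightarrow> blinfun_apply \<psi> (g w)) \<longrightarrow>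
       (\<forall>\<phi> :: 'a \<Rightarrow>\<^sub>L real. (\<lambda>n. blinfun_apply \<phi> (f (r n) w)) \<longlonglongrightarrow> blinfun_apply \<phi> (g w))"
    by (rule countable_test_functionals[OF assms fg])
  \<comment> \<open>Inserting 0 makes the enumerated set nonempty; only the inclusion of
    \<open>\<Psi>\<close> in the range matters.\<close>
  define \<psi> where "\<psi> = from_nat_into (insert 0 \<Psi>)"
  have \<psi>: "\<Psi> \<subseteq> range \<psi>"
    using \<Psi> range_from_nat_into[of "insert 0 \<Psi>"] by (auto simp: \<psi>_def)
  define A where "A i n c = {w\<in>space ?M. \<bar>blinfun_apply (\<psi> i) (f n w) - blinfun_apply (\<psi> i) (g w)\<bar> \<ge> c}"
    for i n and c :: real
  have f_meas: "strongly_measurable ?M (f n)" for n using fg(1) unfolding Linf_bounded_def by blast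
  have [measurable]: "(\<lambda>w. blinfun_apply \<phi> (f n w)) \<in> borel_measurable ?M" for \<phi> :: "'a \<Rightarrow>\<^sub>L real" and n
    by (rule strongly_measurable_functional[OF f_meas])
  have [measurable]: "(\<lambda>w. blinfun_apply \<phi> (g w)) \<in> borel_measurable ?M" for \<phi> :: "'a \<Rightarrow>\<^sub>L real"
    by (rule strongly_measurable_functional[OF fg(2)])
  have A_sets [measurable]: "A i n c \<in> sets ?M" for i n c unfolding A_def by measurable
  have "\<exists>n>m. \<forall>i\<le>k. measure ?M (A i n (1 / real (Suc k))) < (1 / 2) ^ k" for k m
  proof -
    have "eventually (\<lambda>n. measure ?M (A i n (1 / real (Suc k))) < (1 / 2) ^ k) sequentially" for i
      using conv unfolding converges_scalarly_in_measure_def A_def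
      by (intro order_tendstoD(2)[of _ 0]) auto
    hence "eventually (\<lambda>n. \<forall>i\<in>{..k}. measure ?M (A i n (1 / real (Suc k))) < (1 / 2) ^ k) sequentially"
      by (intro eventually_ball_finite) auto
    hence "eventually (\<lambda>n. n > m \<and> (\<forall>i\<in>{..k}. measure ?M (A i n (1 / real (Suc k))) < (1 / 2) ^ k)) sequentially"
      by (intro eventually_conj eventually_gt_at_top)
    from eventually_happens[OF this] show ?thesis by auto
  qed
  hence "\<exists>r. \<forall>k. (\<forall>i\<le>k. measure ?M (A i (r k) (1 / real (Suc k))) < (1 / 2) ^ k) \<and> r k < r (Suc k)"
    by (intro dependent_nat_choice) blast+
  then obtain r where r: "\<And>k i. i \<le> k \<Longrightarrow> measure ?M (A i (r k) (1 / real (Suc k))) < (1 / 2) ^ k"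
    and mono: "strict_mono r" unfolding strict_mono_Suc_iff by blast
  have "AE w in ?M. (\<lambda>n. blinfun_apply (\<psi> i) (f (r n) w)) \<longlonglongrightarrow> blinfun_apply (\<psi> i) (g w)" for i
  proof -
    have "summable (\<lambda>k. measure ?M (A i (r k) (1 / real (Suc k))))"
    proof (rule summable_comparison_test_ev)
      show "eventually (\<lambda>k. norm (measure ?M (A i (r k) (1 / real (Suc k)))) \<le> (1 / 2) ^ k) sequentially"
        using eventually_ge_at_top[of i] by eventually_elim (use r in \<open>auto intro: less_imp_le\<close>)
    qed (simp add: summable_geometric)
    hence "AE w in ?M. eventually (\<lambda>k. w \<in> space ?M - A i (r k) (1 / real (Suc k))) sequentially"
      by (intro borel_cantelli_AE1) (auto simp: less_top[symmetric])
    thus ?thesis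
    proof eventually_elim
      case (elim w)
      have "(\<lambda>k. \<bar>blinfun_apply (\<psi> i) (f (r k) w) - blinfun_apply (\<psi> i) (g w)\<bar>) \<longlonglongrightarrow> 0"
      proof (rule tendsto_sandwich[OF _ _ tendsto_const])
        show "eventually (\<lambda>k. \<bar>blinfun_apply (\<psi> i) (f (r k) w) - blinfun_apply (\<psi> i) (g w)\<bar>
            \<le> 1 / real (Suc k)) sequentially"
          using elim by eventually_elim (auto simp: A_def)
        show "(\<lambda>k. 1 / real (Suc k)) \<longlonglongrightarrow> 0" using LIMSEQ_inverse_real_of_nat by (simp add: inverse_eq_divide)
      qed simp
      thus ?case by (simp add: tendsto_rabs_zero_iff LIM_zero_iff)
    qed
  qed
  hence "AE w in ?M. \<forall>i. (\<lambda>n. blinfun_apply (\<psi> i) (f (r n) w)) \<longlonglongrightarrow> blinfun_apply (\<psi> i) (g w)"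
    by (simp add: AE_all_countable)
  with test have "converges_weakly_ae (f \<circ> r) g"
    unfolding converges_weakly_ae_def o_def
  proof eventually_elim
    case (elim w)
    have "\<forall>\<phi>\<in>\<Psi>. (\<lambda>n. blinfun_apply \<phi> (f (r n) w)) \<longlonglongrightarrow> blinfun_apply \<phi> (g w)"
      using elim(2) \<psi> by blast
    thus ?case using elim(1) by blast
  qed
  thus "\<exists>r. strict_mono r \<and> converges_weakly_ae (f \<circ> r) g" using mono by blast
qed

section \<open>Comparison of the convergence properties\<close>

lemma property_A_inf_if_property_A_inf':
  assumes "property_A_inf' TYPE('a::banach)"
  shows "property_A_inf TYPE('a)"
  unfolding property_A_inf_def
proof (intro allI impI exI[of _ "\<lambda>n. n"] conjI)
  show "strict_mono (\<lambda>n::nat. n)" by (simp add: strict_mono_def)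
qed (use assms in \<open>simp add: property_A_inf'_def o_def\<close>)

text \<open>For each functional, convergence almost everywhere implies convergence in measure: the
  indicators of the exceptional sets are dominated by 1 on a finite measure space and tend to
  0.\<close>

lemma property_A_inf_if_property_B_inf:
  assumes "property_B_inf TYPE('a::banach)"
  shows "property_A_inf TYPE('a)"
  unfolding property_A_inf_def
proof (intro allI impI)
  let ?M = unit_interval_measure
  interpret finite_measure ?M by (rule finite_measure_lebesgue_on) simp
  fix f :: "nat \<Rightarrow> real \<Rightarrow> 'a" and g
  assume fg: "Linf_bounded f" "strongly_measurable ?M g" and conv: "converges_scalarly_ae f g"
  have f_meas: "strongly_measurable ?M (f n)" for n using fg(1) unfolding Linf_bounded_def by blast
  have [measurable]: "(\<lambda>w. blinfun_apply \<phi> (f n w)) \<in> borel_measurable ?M" for \<phi> :: "'a \<Rightarrow>\<^sub>L real" and n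
    by (rule strongly_measurable_functional[OF f_meas])
  have [measurable]: "(\<lambda>w. blinfun_apply \<phi> (g w)) \<in> borel_measurable ?M" for \<phi> :: "'a \<Rightarrow>\<^sub>L real"
    by (rule strongly_measurable_functional[OF fg(2)])
  have "converges_scalarly_in_measure f g"
    unfolding converges_scalarly_in_measure_def
  proof (intro allI impI)
    fix \<phi> :: "'a \<Rightarrow>\<^sub>L real" and \<epsilon> :: real assume "\<epsilon> > 0"
    define A where "A n = {w\<in>space ?M. \<bar>blinfun_apply \<phi> (f n w) - blinfun_apply \<phi> (g w)\<bar> \<ge> \<epsilon>}" for n
    have [measurable]: "A n \<in> sets ?M" for n unfolding A_def by measurable
    have "AE w in ?M. (\<lambda>n. blinfun_apply \<phi> (f n w)) \<longlonglongrightarrow> blinfun_apply \<phi> (g w)"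
      using conv by (simp add: converges_scalarly_ae_def)
    hence "AE w in ?M. (\<lambda>n. indicat_real (A n) w) \<longlonglongrightarrow> 0"
    proof eventually_elim
      case (elim w)
      from LIMSEQ_D[OF this \<open>\<epsilon> > 0\<close>] obtain n0 where
        "\<And>n. n \<ge> n0 \<Longrightarrow> \<bar>blinfun_apply \<phi> (f n w) - blinfun_apply \<phi> (g w)\<bar> < \<epsilon>" by auto
      hence "eventually (\<lambda>n. indicat_real (A n) w = 0) sequentially"
        unfolding eventually_sequentially by (force simp: A_def indicator_def)
      thus ?case by (rule tendsto_eventually)
    qed
    hence "(\<lambda>n. \<integral>w. indicat_real (A n) w \<partial>?M) \<longlonglongrightarrow> (\<integral>w. 0 \<partial>?M)"
      by (intro integral_dominated_convergence[where w = "\<lambda>_. 1"]) (auto simp: indicator_def)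
    moreover have "(\<integral>w. indicat_real (A n) w \<partial>?M) = measure ?M (A n)" for n
    proof -
      have "A n \<inter> space ?M = A n" by (auto simp: A_def)
      thus ?thesis by simp
    qed
    ultimately show "(\<lambda>n. measure ?M {w\<in>space ?M. \<bar>blinfun_apply \<phi> (f n w) - blinfun_apply \<phi> (g w)\<bar> \<ge> \<epsilon>}) \<longlonglongrightarrow> 0"
      by (simp add: A_def)
  qed
  thus "\<exists>r. strict_mono r \<and> converges_weakly_ae (f \<circ> r) g"
    using assms fg unfolding property_B_inf_def by blast
qed

section \<open>Averages over refining partitions\<close>

lemma convergent_if_summable_increments:
  fixes f :: "nat \<Rightarrow> 'b::banach"
  assumes "summable (\<lambda>n. norm (f (Suc n) - f n))"
  shows "convergent f"
proof -
  have "summable (\<lambda>n. f (Suc n) - f n)" using assms by (rule summable_norm_cancel)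
  hence "convergent (\<lambda>n. (\<Sum>i<n. f (Suc i) - f i) + f 0)"
    by (intro convergent_add convergent_const) (simp add: summable_iff_convergent)
  thus ?thesis by (simp add: sum_lessThan_telescope)
qed

definition level_set :: "'c measure \<Rightarrow> ('c \<Rightarrow> nat) \<Rightarrow> nat \<Rightarrow> 'c set" where
  "level_set M q i = {w\<in>space M. q w = i}"

definition refines :: "'c measure \<Rightarrow> ('c \<Rightarrow> nat) \<Rightarrow> ('c \<Rightarrow> nat) \<Rightarrow> bool" where
  "refines M q' q \<longleftrightarrow> (\<forall>w\<in>space M. \<forall>w'\<in>space M. q' w = q' w' \<longrightarrow> q w = q w')"

text \<open>A partition into finitely many measurable sets is represented by a simple function
  \<open>q\<close>; on its null cells the average is 0 since \<open>1 / 0 = 0\<close>.\<close>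

definition cell_average ::
    "'c measure \<Rightarrow> ('c \<Rightarrow> nat) \<Rightarrow> ('c set \<Rightarrow> 'b::real_normed_vector) \<Rightarrow> 'c \<Rightarrow> 'b" where
  "cell_average M q \<nu> w = \<nu> (level_set M q (q w)) /\<^sub>R measure M (level_set M q (q w))"

lemma level_set_sets: "simple_function M q \<Longrightarrow> level_set M q i \<in> sets M"
  using simple_functionD(2)[of M q "{i}"] by (simp add: level_set_def vimage_def Int_def conj_commute)

lemma refines_refl: "refines M q q"
  and refines_trans: "refines M q'' q' \<Longrightarrow> refines M q' q \<Longrightarrow> refines M q'' q"
  unfolding refines_def by blast+

lemma refines_chain:
  assumes "\<And>k. refines M (p (Suc k)) (p k)" "k \<le> l"
  shows "refines M (p l) (p k)"
  using assms(2) by (induction l rule: dec_induct) (auto intro: refines_refl refines_trans assms(1))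

abbreviation sb_integral_on :: "'c measure \<Rightarrow> 'c set \<Rightarrow> ('c \<Rightarrow> 'b::real_vector) \<Rightarrow> 'b" where
  "sb_integral_on M A s \<equiv> sb_integral M (\<lambda>w. indicator A w *\<^sub>R s w)"

text \<open>This is the variation, on one finite partition, of the difference between
  \<open>G\<close> and the charge with density \<open>s\<close>. A bound for all \<open>q\<close>
  bounds the total variation of that difference.\<close>

definition approximation_error ::
    "'c measure \<Rightarrow> ('c set \<Rightarrow> 'b::real_normed_vector) \<Rightarrow> ('c \<Rightarrow> 'b) \<Rightarrow> ('c \<Rightarrow> nat) \<Rightarrow> real" where
  "approximation_error M G s q =
     (\<Sum>i\<in>q ` space M. norm (G (level_set M q i) - sb_integral_on M (level_set M q i) s))"

context finite_measure
begin

lemma simple_function_cell_average: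
  "simple_function M q \<Longrightarrow> simple_function M (cell_average M q \<nu>)"
  unfolding cell_average_def[abs_def] by (rule simple_function_compose1)

lemma sb_integrable: "simple_function M s \<Longrightarrow> sb_integrable M s"
  by (simp add: simple_bochner_integrable_finite[OF finite_measure_axioms])

lemma integrable_simple: "simple_function M (s :: 'a \<Rightarrow> real) \<Longrightarrow> integrable M s"
  using has_bochner_integral_simple_bochner_integrable[OF sb_integrable]
  by (auto intro: integrable.intros)

lemma sb_integral_real: "simple_function M (s :: 'a \<Rightarrow> real) \<Longrightarrow> sb_integral M s = integral\<^sup>L M s"
  by (rule simple_bochner_integrable_eq_integral[OF sb_integrable])

lemma sb_integral_cong:
  assumes "\<And>w. w \<in> space M \<Longrightarrow> f w = g w"
  shows "sb_integral M f = sb_integral M g"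
proof -
  have "f ` space M = g ` space M" using assms by (intro image_cong) auto
  moreover have "{w\<in>space M. f w = y} = {w\<in>space M. g w = y}" for y using assms by auto
  ultimately show ?thesis by (simp add: Bochner_Integration.simple_bochner_integral_def)
qed

text \<open>This is the martingale property, tested against functions of the coarser partition: the
  fine cells inside a coarse one have charges that add up to the charge of the coarse cell.\<close>

lemma integral_cell_average:
  assumes q: "simple_function M q" and q': "simple_function M q'" and ref: "refines M q' q"
    and \<nu>: "lipschitz_charge M C \<nu>"
  shows "sb_integral M (\<lambda>w. h (q w) *\<^sub>R cell_average M q' \<nu> w)
    = (\<Sum>i\<in>q ` space M. h i *\<^sub>R \<nu> (level_set M q i))"
proof -
  \<comment> \<open>A representative point of each fine cell turns the coarse label into a function
    of the fine label.\<close>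
  define rep where "rep = inv_into (space M) q'"
  have rep: "rep j \<in> space M" "q' (rep j) = j" if "j \<in> q' ` space M" for j
    using that by (auto simp: rep_def inv_into_into f_inv_into_f)
  have q_rep: "q (rep (q' w)) = q w" if "w \<in> space M" for w
    using rep[of "q' w"] that ref unfolding refines_def by blast
  have fin: "finite (q ` space M)" "finite (q' ` space M)"
    using q q' by (auto simp: simple_function_def)
  have simple: "simple_function M (\<lambda>w. h (q w) *\<^sub>R cell_average M q' \<nu> w)"
    using simple_function_compose2[OF q simple_function_cell_average[OF q'], of "\<lambda>x y. h x *\<^sub>R y"] .
  have "sb_integral M (\<lambda>w. h (q w) *\<^sub>R cell_average M q' \<nu> w)
      = (\<Sum>j\<in>q' ` space M. measure M {w\<in>space M. q' w = j} *\<^sub>R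
          (h (q (rep j)) *\<^sub>R (\<nu> (level_set M q' j) /\<^sub>R measure M (level_set M q' j))))"
  proof (rule simple_bochner_integral_partition[OF sb_integrable[OF simple] q'])
    fix w w' assume "w \<in> space M" "w' \<in> space M" "q' w = q' w'"
    thus "h (q w) *\<^sub>R cell_average M q' \<nu> w = h (q w') *\<^sub>R cell_average M q' \<nu> w'"
      using ref unfolding refines_def cell_average_def by metis
  qed (simp add: q_rep cell_average_def)
  also have "\<dots> = (\<Sum>j\<in>q' ` space M. h (q (rep j)) *\<^sub>R \<nu> (level_set M q' j))"
  proof (intro sum.cong refl)
    fix j
    \<comment> \<open>On a null cell the default average 0 agrees with the charge, because the
      Lipschitz bound makes the latter vanish.\<close>
    have "measure M (level_set M q' j) = 0 \<Longrightarrow> \<nu> (level_set M q' j) = 0"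
      using lipschitz_charge_bound[OF \<nu> level_set_sets[OF q', of j]] by simp
    thus "measure M {w\<in>space M. q' w = j} *\<^sub>R
          (h (q (rep j)) *\<^sub>R (\<nu> (level_set M q' j) /\<^sub>R measure M (level_set M q' j)))
        = h (q (rep j)) *\<^sub>R \<nu> (level_set M q' j)"
      unfolding level_set_def[symmetric] by (cases "measure M (level_set M q' j) = 0") auto
  qed
  also have "\<dots> = (\<Sum>i\<in>q ` space M. \<Sum>j | j \<in> q' ` space M \<and> q (rep j) = i. h (q (rep j)) *\<^sub>R \<nu> (level_set M q' j))"
    by (rule sum.group[OF fin(2,1), symmetric]) (use rep in auto)
  also have "\<dots> = (\<Sum>i\<in>q ` space M. h i *\<^sub>R \<nu> (level_set M q i))"
  proof (intro sum.cong refl)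
    fix i
    have "level_set M q i = {w\<in>space M. q (rep (q' w)) = i}" by (auto simp: level_set_def q_rep)
    also have "\<dots> = (\<Union>j\<in>{j \<in> q' ` space M. q (rep j) = i}. level_set M q' j)"
      by (auto simp: level_set_def)
    finally have "level_set M q i = (\<Union>j\<in>{j \<in> q' ` space M. q (rep j) = i}. level_set M q' j)" .
    moreover have "\<nu> (\<Union>j\<in>{j \<in> q' ` space M. q (rep j) = i}. level_set M q' j)
        = (\<Sum>j | j \<in> q' ` space M \<and> q (rep j) = i. \<nu> (level_set M q' j))"
      using fin by (intro lipschitz_charge_UN[OF \<nu>] level_set_sets q')
        (auto simp: disjoint_family_on_def level_set_def)
    ultimately show "(\<Sum>j | j \<in> q' ` space M \<and> q (rep j) = i. h (q (rep j)) *\<^sub>R \<nu> (level_set M q' j))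
        = h i *\<^sub>R \<nu> (level_set M q i)"
      by (simp add: scaleR_right.sum)
  qed
  finally show ?thesis .
qed

lemma integral_cell_average_level_set:
  assumes q: "simple_function M q" and q': "simple_function M q'" and ref: "refines M q' q"
    and \<nu>: "lipschitz_charge M C \<nu>" and "i \<in> q ` space M"
  shows "sb_integral_on M (level_set M q i) (cell_average M q' \<nu>) = \<nu> (level_set M q i)"
proof -
  have fin: "finite (q ` space M)" using q by (auto simp: simple_function_def)
  have "sb_integral_on M (level_set M q i) (cell_average M q' \<nu>)
      = sb_integral M (\<lambda>w. of_bool (q w = i) *\<^sub>R cell_average M q' \<nu> w)"
    by (rule sb_integral_cong) (auto simp: indicator_def level_set_def)
  also have "\<dots> = (\<Sum>j\<in>q ` space M. of_bool (j = i) *\<^sub>R \<nu> (level_set M q j))"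
    by (rule integral_cell_average[OF q q' ref \<nu>])
  also have "\<dots> = (\<Sum>j\<in>q ` space M. if j = i then \<nu> (level_set M q j) else 0)"
    by (intro sum.cong) auto
  also have "\<dots> = \<nu> (level_set M q i)" using fin assms(5) by (simp add: sum.delta)
  finally show ?thesis .
qed

lemma integral_eq_sum_level_sets:
  assumes q: "simple_function M q" and f: "integrable M (f :: 'a \<Rightarrow> real)"
  shows "(\<integral>w. f w \<partial>M) = (\<Sum>i\<in>q ` space M. \<integral>w. indicator (level_set M q i) w * f w \<partial>M)"
proof -
  have fin: "finite (q ` space M)" using q by (simp add: simple_function_def)
  have "(\<integral>w. f w \<partial>M) = (\<integral>w. (\<Sum>i\<in>q ` space M. indicator (level_set M q i) w * f w) \<partial>M)"
  proof (intro Bochner_Integration.integral_cong refl)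
    fix w assume w: "w \<in> space M"
    have "(\<Sum>i\<in>q ` space M. indicator (level_set M q i) w * f w) = (\<Sum>i\<in>q ` space M. if i = q w then f w else 0)"
      using w by (intro sum.cong) (auto simp: indicator_def level_set_def)
    thus "f w = (\<Sum>i\<in>q ` space M. indicator (level_set M q i) w * f w)"
      using w fin by (simp add: sum.delta)
  qed
  also have "\<dots> = (\<Sum>i\<in>q ` space M. \<integral>w. indicator (level_set M q i) w * f w \<partial>M)"
    using integrable_mult_indicator[OF level_set_sets[OF q] f]
    by (intro Bochner_Integration.integral_sum) simp
  finally show ?thesis .
qed

lemma norm_cell_average_le:
  assumes "simple_function M q" "lipschitz_charge M C \<nu>" "0 \<le> C"
  shows "norm (cell_average M q \<nu> w) \<le> C"
  using lipschitz_charge_bound[OF assms(2) level_set_sets[OF assms(1), of "q w"]] assms(3)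
  by (cases "measure M (level_set M q (q w)) = 0")
    (auto simp: cell_average_def field_simps zero_less_measure_iff)

lemma integral_cell_average_total:
  fixes \<nu> :: "'a set \<Rightarrow> real"
  assumes "simple_function M q" "lipschitz_charge M C \<nu>"
  shows "(\<integral>w. cell_average M q \<nu> w \<partial>M) = \<nu> (space M)"
proof (cases "space M = {}")
  case True
  hence "(\<integral>w. cell_average M q \<nu> w \<partial>M) = (\<integral>w. 0 \<partial>M)" by (intro Bochner_Integration.integral_cong) auto
  thus ?thesis using lipschitz_charge_empty[OF assms(2)] True by simp
next
  case False
  have "refines M q (\<lambda>_. 0)" by (simp add: refines_def)
  from integral_cell_average[OF simple_function_const assms(1) this assms(2), of "\<lambda>_. 1"] False
  show ?thesis
    by (simp add: sb_integral_real[OF simple_function_cell_average[OF assms(1)]] level_set_def image_constant_conv)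
qed

text \<open>Pythagoras: the coarse average is the orthogonal projection of the fine one. The mixed
  term is the martingale property with the coarse average itself as test function.\<close>

lemma integral_square_cell_average_diff:
  fixes \<nu> :: "'a set \<Rightarrow> real"
  assumes q: "simple_function M q" and q': "simple_function M q'" and ref: "refines M q' q"
    and \<nu>: "lipschitz_charge M C \<nu>"
  shows "(\<integral>w. (cell_average M q' \<nu> w - cell_average M q \<nu> w)\<^sup>2 \<partial>M)
    = (\<integral>w. (cell_average M q' \<nu> w)\<^sup>2 \<partial>M) - (\<integral>w. (cell_average M q \<nu> w)\<^sup>2 \<partial>M)"
proof -
  let ?a = "cell_average M q \<nu>" and ?a' = "cell_average M q' \<nu>"
  define h where "h i = \<nu> (level_set M q i) / measure M (level_set M q i)" for i
  have a_h: "?a w = h (q w)" for w by (simp add: cell_average_def h_def divide_inverse mult.commute)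
  have simple: "simple_function M (\<lambda>w. h (q w) * cell_average M r \<nu> w)" if "simple_function M r" for r
    using simple_function_compose2[OF q simple_function_cell_average[OF that], of "\<lambda>x y. h x * y"] .
  have eq: "(\<integral>w. h (q w) * cell_average M r \<nu> w \<partial>M) = (\<Sum>i\<in>q ` space M. h i * \<nu> (level_set M q i))"
    if "simple_function M r" "refines M r q" for r
    using integral_cell_average[OF q that(1,2) \<nu>, of h] sb_integral_real[OF simple[OF that(1)]] by simp
  have cross: "(\<integral>w. ?a w * ?a' w \<partial>M) = (\<integral>w. (?a w)\<^sup>2 \<partial>M)"
    using eq[OF q' ref] eq[OF q refines_refl] by (simp add: a_h power2_eq_square)
  have int: "integrable M (\<lambda>w. (?a w)\<^sup>2)" "integrable M (\<lambda>w. (?a' w)\<^sup>2)" "integrable M (\<lambda>w. ?a w * ?a' w)"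
    using simple_function_cell_average[OF q, of \<nu>] simple_function_cell_average[OF q', of \<nu>]
    by (auto intro!: integrable_simple simple_function_mult simple_function_compose1[where g = "\<lambda>y. y\<^sup>2"])
  have "(?a' w - ?a w)\<^sup>2 = (?a' w)\<^sup>2 + (?a w)\<^sup>2 - 2 * (?a w * ?a' w)" for w
    by (simp add: power2_diff)
  thus ?thesis using int by (simp add: cross)
qed

section \<open>Convergence of scalar averages along a refining sequence\<close>

context
  fixes p :: "nat \<Rightarrow> 'a \<Rightarrow> nat"
  assumes p: "\<And>k. simple_function M (p k)" and p_refines: "\<And>k. refines M (p (Suc k)) (p k)"
begin

text \<open>The second moments increase along the refinements and are bounded, hence Cauchy; by
  Pythagoras their differences are the squared distances. The passage to first moments uses that
  \<open>\<bar>z\<bar>\<close> is at most \<open>\<delta> + z\<^sup>2 / \<delta>\<close>.\<close>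

lemma cell_average_L1_Cauchy:
  fixes \<nu> :: "'a set \<Rightarrow> real"
  assumes \<nu>: "lipschitz_charge M C \<nu>" and "0 \<le> C" and "e > 0"
  shows "\<exists>k0. \<forall>k\<ge>k0. \<forall>l\<ge>k. (\<integral>w. \<bar>cell_average M (p l) \<nu> w - cell_average M (p k) \<nu> w\<bar> \<partial>M) < e"
proof -
  let ?a = "\<lambda>k. cell_average M (p k) \<nu>"
  define S where "S k = (\<integral>w. (?a k w)\<^sup>2 \<partial>M)" for k
  have simple: "simple_function M (?a k)" for k by (intro simple_function_cell_average p)
  have diff: "(\<integral>w. (?a l w - ?a k w)\<^sup>2 \<partial>M) = S l - S k" if "k \<le> l" for k l
    unfolding S_def by (rule integral_square_cell_average_diff[OF p p refines_chain[where p = p, OF p_refines that] \<nu>])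
  have "S k \<le> S l" if "k \<le> l" for k l
    using diff[OF that] Bochner_Integration.integral_nonneg[of M "\<lambda>w. (?a l w - ?a k w)\<^sup>2"] by simp
  hence "incseq S" by (simp add: incseq_def)
  moreover have "S k \<le> C\<^sup>2 * measure M (space M)" for k
  proof -
    have "(?a k w)\<^sup>2 \<le> C\<^sup>2" for w
      using norm_cell_average_le[OF p \<nu> \<open>0 \<le> C\<close>, of k w] \<open>0 \<le> C\<close> by (simp add: abs_le_square_iff[symmetric])
    hence "S k \<le> (\<integral>w. C\<^sup>2 \<partial>M)"
      unfolding S_def using simple[of k]
      by (intro integral_mono integrable_simple simple_function_compose1[where g = "\<lambda>y. y\<^sup>2"]) auto
    thus ?thesis by (simp add: mult.commute)
  qed
  ultimately obtain L where "S \<longlonglongrightarrow> L"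
    using incseq_convergent[of S "C\<^sup>2 * measure M (space M)"] by blast
  hence "Cauchy S" by (rule LIMSEQ_imp_Cauchy)
  \<comment> \<open>With this \<open>\<delta>\<close> each of the two summands contributes at most
    \<open>e / 2\<close>; adding 1 avoids a division by 0 on a null space.\<close>
  define c where "c = measure M (space M) + 1"
  define \<delta> where "\<delta> = e / 2 / c"
  have pos: "c > 0" by (simp add: c_def add_nonneg_pos)
  have \<delta>: "\<delta> > 0" using \<open>e > 0\<close> pos by (simp add: \<delta>_def)
  obtain k0 where k0: "\<And>k l. k \<ge> k0 \<Longrightarrow> l \<ge> k0 \<Longrightarrow> norm (S k - S l) < \<delta> * (e / 2)"
    using CauchyD[OF \<open>Cauchy S\<close>, of "\<delta> * (e / 2)"] \<delta> \<open>e > 0\<close> by auto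
  have "(\<integral>w. \<bar>?a l w - ?a k w\<bar> \<partial>M) < e" if kl: "k \<ge> k0" "l \<ge> k" for k l
  proof -
    have le: "\<bar>?a l w - ?a k w\<bar> \<le> \<delta> + (?a l w - ?a k w)\<^sup>2 / \<delta>" for w
    proof (cases "\<bar>?a l w - ?a k w\<bar> \<le> \<delta>")
      case False
      hence "\<delta> * \<bar>?a l w - ?a k w\<bar> \<le> \<bar>?a l w - ?a k w\<bar> * \<bar>?a l w - ?a k w\<bar>"
        by (intro mult_right_mono) auto
      hence "\<bar>?a l w - ?a k w\<bar> \<le> (?a l w - ?a k w)\<^sup>2 / \<delta>"
        using \<delta> by (simp add: field_simps power2_eq_square)
      thus ?thesis using \<delta> by simp
    qed (use \<delta> in \<open>auto intro: add_increasing2\<close>)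
    have int: "integrable M (\<lambda>w. (?a l w - ?a k w)\<^sup>2)" "integrable M (\<lambda>w. \<bar>?a l w - ?a k w\<bar>)"
      using simple_function_compose2[OF simple[of l] simple[of k], of "\<lambda>x y. (x - y)\<^sup>2"]
        simple_function_compose2[OF simple[of l] simple[of k], of "\<lambda>x y. \<bar>x - y\<bar>"]
      by (auto intro: integrable_simple)
    have "(\<integral>w. \<bar>?a l w - ?a k w\<bar> \<partial>M) \<le> (\<integral>w. \<delta> + (?a l w - ?a k w)\<^sup>2 / \<delta> \<partial>M)"
      using int le by (intro integral_mono) auto
    also have "\<dots> = \<delta> * measure M (space M) + (S l - S k) / \<delta>"
      using int by (simp add: diff[OF kl(2)] mult.commute)
    also have "(S l - S k) / \<delta> < e / 2"
      using k0[of l k] kl abs_ge_self[of "S l - S k"] \<delta> 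
      by (simp add: pos_divide_less_eq mult.commute)
    also have "\<delta> * measure M (space M) \<le> \<delta> * c"
      using \<delta> by (simp add: c_def)
    also have "\<delta> * c = e / 2" using pos by (simp add: \<delta>_def)
    finally show ?thesis by simp
  qed
  thus ?thesis by blast
qed

lemma cell_average_increments_tendsto_0:
  fixes \<nu> :: "'a set \<Rightarrow> real"
  assumes \<nu>: "lipschitz_charge M C \<nu>" and "0 \<le> C"
  shows "(\<lambda>k. \<integral>w. \<bar>cell_average M (p (Suc k)) \<nu> w - cell_average M (p k) \<nu> w\<bar> \<partial>M) \<longlonglongrightarrow> 0"
proof (rule LIMSEQ_I)
  fix e :: real assume "e > 0"
  from cell_average_L1_Cauchy[OF assms this] obtain k0 where
    "\<And>k l. k \<ge> k0 \<Longrightarrow> l \<ge> k \<Longrightarrow> (\<integral>w. \<bar>cell_average M (p l) \<nu> w - cell_average M (p k) \<nu> w\<bar> \<partial>M) < e" by blast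
  thus "\<exists>k0. \<forall>k\<ge>k0. norm ((\<integral>w. \<bar>cell_average M (p (Suc k)) \<nu> w - cell_average M (p k) \<nu> w\<bar> \<partial>M) - 0) < e"
    by (intro exI[of _ k0]) auto
qed

text \<open>One subsequence must serve countably many charges: at stage \<open>j\<close> the first
  charges, up to number \<open>j\<close>, move by less than \<open>(1 / 2) ^ j\<close> in L1 from
  then on. Summable increments then give convergence almost everywhere.\<close>

lemma cell_average_AE_convergent_subsequence:
  fixes \<nu> :: "nat \<Rightarrow> 'a set \<Rightarrow> real"
  assumes \<nu>: "\<And>n. lipschitz_charge M C (\<nu> n)" and "0 \<le> C"
  obtains r :: "nat \<Rightarrow> nat" where "strict_mono r"
    "AE w in M. \<forall>n. convergent (\<lambda>j. cell_average M (p (r j)) (\<nu> n) w)"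
proof -
  let ?a = "\<lambda>n k. cell_average M (p k) (\<nu> n)"
  let ?P = "\<lambda>j k. \<forall>n\<le>j. \<forall>l\<ge>k. (\<integral>w. \<bar>?a n l w - ?a n k w\<bar> \<partial>M) < (1 / 2) ^ j"
  have "\<exists>k>m. ?P j k" for j m
  proof -
    have "\<forall>n. \<exists>k0. \<forall>k\<ge>k0. \<forall>l\<ge>k. (\<integral>w. \<bar>?a n l w - ?a n k w\<bar> \<partial>M) < (1 / 2) ^ j"
      using cell_average_L1_Cauchy[OF \<nu> \<open>0 \<le> C\<close>] by simp
    from choice[OF this] obtain K where
      K: "\<And>n k l. k \<ge> K n \<Longrightarrow> l \<ge> k \<Longrightarrow> (\<integral>w. \<bar>?a n l w - ?a n k w\<bar> \<partial>M) < (1 / 2) ^ j" by blast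
    let ?k = "Max (insert (Suc m) (K ` {..j}))"
    have "?k > m" using Max_ge[of "insert (Suc m) (K ` {..j})" "Suc m"] by simp
    moreover have "?k \<ge> K n" if "n \<le> j" for n using that by (intro Max_ge) auto
    ultimately show ?thesis using K by blast
  qed
  hence "\<exists>r. \<forall>j. ?P j (r j) \<and> r j < r (Suc j)"
    by (intro dependent_nat_choice) blast+
  then obtain r where r: "\<And>j n l. n \<le> j \<Longrightarrow> l \<ge> r j \<Longrightarrow> (\<integral>w. \<bar>?a n l w - ?a n (r j) w\<bar> \<partial>M) < (1 / 2) ^ j"
    and mono: "strict_mono r" unfolding strict_mono_Suc_iff by blast
  have "AE w in M. convergent (\<lambda>j. ?a n (r j) w)" for n
  proof -
    \<comment> \<open>The estimates for the charge \<open>n\<close> hold from stage \<open>n\<close>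
      on only, hence the shift.\<close>
    define f where "f j w = \<bar>?a n (r (Suc (j + n))) w - ?a n (r (j + n)) w\<bar>" for j w
    have f_nonneg: "0 \<le> f j w" for j w by (simp add: f_def)
    have f: "simple_function M (f j)" for j
      unfolding f_def
      by (rule simple_function_compose2[where h = "\<lambda>x y. \<bar>x - y\<bar>"]) (intro simple_function_cell_average p)+
    have "AE w in M. summable (\<lambda>j. f j w)"
    proof (rule AE_summable_of_summable_integrals[where c = "\<lambda>j. (1 / 2) ^ j"])
      fix j
      have "(\<integral>w. f j w \<partial>M) \<le> (1 / 2) ^ (j + n)"
        unfolding f_def using r[of n "j + n" "r (Suc (j + n))"] mono
        by (intro less_imp_le) (auto simp: strict_mono_def less_imp_le)
      also have "\<dots> \<le> (1 / 2) ^ j" by (intro power_decreasing) auto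
      finally show "(\<integral>\<^sup>+w. ennreal (f j w) \<partial>M) \<le> ennreal ((1 / 2) ^ j)"
        by (subst nn_integral_eq_integral[OF integrable_simple[OF f]])
          (simp_all add: f_nonneg ennreal_leI)
    qed (auto simp: f_nonneg intro!: summable_geometric borel_measurable_simple_function[OF f])
    thus ?thesis
    proof eventually_elim
      case (elim w)
      hence "convergent (\<lambda>j. ?a n (r (j + n)) w)"
        by (intro convergent_if_summable_increments) (simp add: f_def)
      thus ?case by (auto simp: convergent_def intro: LIMSEQ_offset[where k = n])
    qed
  qed
  hence "AE w in M. \<forall>n. convergent (\<lambda>j. ?a n (r j) w)" by (simp add: AE_all_countable)
  thus ?thesis using that mono by blast
qed

end

end

section \<open>Approximating dual-valued charges by simple functions\<close>

text \<open>The norm need not be attained on the unit ball; half of it always is reached there, also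
  for the zero functional. A fixed choice makes the norming vectors of a simple function finitely
  many.\<close>

definition almost_norming :: "('a::real_normed_vector \<Rightarrow>\<^sub>L real) \<Rightarrow> 'a" where
  "almost_norming \<phi> = (SOME x. norm x \<le> 1 \<and> norm \<phi> / 2 \<le> \<phi> x)"

lemma almost_norming:
  fixes \<phi> :: "'a::real_normed_vector \<Rightarrow>\<^sub>L real"
  shows "norm (almost_norming \<phi>) \<le> 1" "norm \<phi> / 2 \<le> \<phi> (almost_norming \<phi>)"
proof -
  have "\<exists>x. norm x \<le> 1 \<and> norm \<phi> / 2 \<le> \<phi> x"
  proof (rule ccontr)
    assume contra: "\<not> ?thesis"
    have "norm \<phi> > 0"
      using contra by (metis blinfun.zero_right divide_eq_0_iff norm_zero order_refl zero_le_one zero_less_norm_iff)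
    have "norm \<phi> \<le> norm \<phi> / 2"
    proof (rule norm_blinfun_bound)
      fix x :: 'a
      have le: "\<phi> y \<le> norm \<phi> / 2 * norm y" for y
      proof (cases "y = 0")
        case False
        have "\<phi> (y /\<^sub>R norm y) < norm \<phi> / 2"
          using contra False by (intro not_le_imp_less) (auto dest: spec[of _ "y /\<^sub>R norm y"])
        thus ?thesis using False by (simp add: blinfun.scaleR_right field_simps)
      qed (simp add: blinfun.zero_right)
      show "norm (\<phi> x) \<le> norm \<phi> / 2 * norm x"
        using le[of x] le[of "- x"] by (auto simp: blinfun.minus_right abs_le_iff)
    qed simp
    thus False using \<open>norm \<phi> > 0\<close> by simp
  qed
  from someI_ex[OF this] show "norm (almost_norming \<phi>) \<le> 1" "norm \<phi> / 2 \<le> \<phi> (almost_norming \<phi>)"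
    unfolding almost_norming_def by auto
qed

context finite_measure
begin

lemma lipschitz_charge_set_integral:
  fixes b :: "'a \<Rightarrow> real"
  assumes b: "integrable M b" "\<And>w. 0 \<le> b w" "\<And>w. b w \<le> B"
  shows "lipschitz_charge M B (\<lambda>A. \<integral>w. indicator A w * b w \<partial>M)"
  unfolding lipschitz_charge_def
proof (intro conjI ballI impI)
  have int: "integrable M (\<lambda>w. indicator A w * b w)" if "A \<in> sets M" for A
    using integrable_mult_indicator[OF that b(1)] by simp
  fix A assume A: "A \<in> sets M"
  have "(\<integral>w. indicator A w * b w \<partial>M) \<le> (\<integral>w. indicator A w * B \<partial>M)"
    using A b
    by (intro integral_mono int integrable_simple simple_function_mult) (auto simp: mult_left_mono)
  also have "\<dots> = B * measure M A"
    using A sets.sets_into_space[OF A] by (simp add: Int_absorb2 mult.commute)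
  finally show "norm (\<integral>w. indicator A w * b w \<partial>M) \<le> B * measure M A"
    using b by simp
  fix A' assume A': "A' \<in> sets M" "A \<inter> A' = {}"
  have "indicat_real (A \<union> A') w = indicator A w + indicator A' w" for w
    using A'(2) by (auto simp: indicator_def)
  thus "(\<integral>w. indicator (A \<union> A') w * b w \<partial>M)
      = (\<integral>w. indicator A w * b w \<partial>M) + (\<integral>w. indicator A' w * b w \<partial>M)"
    using int[OF A] int[OF A'(1)] by (simp add: distrib_right)
qed

lemma lipschitz_charge_measure_Int:
  assumes "F \<in> sets M"
  shows "lipschitz_charge M 1 (\<lambda>A. measure M (A \<inter> F))"
  unfolding lipschitz_charge_def using assms
  by (auto intro!: finite_measure_mono finite_measure_Union simp: Int_Un_distrib2)

text \<open>On a fixed cell the integrals of the later averages all equal the charge, and the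
  averages are bounded by \<open>C\<close>, so dominated convergence applies. The identity is
  obtained just for the cells of the given partitions.\<close>

lemma integral_level_set_AE_limit:
  fixes \<nu> :: "'a set \<Rightarrow> real"
  assumes p: "\<And>k. simple_function M (p k)" and ref: "\<And>k. refines M (p (Suc k)) (p k)"
    and \<nu>: "lipschitz_charge M C \<nu>" "0 \<le> C" and r: "strict_mono r"
    and lim: "AE w in M. (\<lambda>j. cell_average M (p (r j)) \<nu> w) \<longlonglongrightarrow> l w"
    and l: "l \<in> borel_measurable M" and i: "i \<in> p k ` space M"
  shows "\<nu> (level_set M (p k) i) = (\<integral>w. indicator (level_set M (p k) i) w * l w \<partial>M)"
proof -
  let ?A = "level_set M (p k) i"
  have A: "?A \<in> sets M" by (rule level_set_sets[OF p])
  have simple: "simple_function M (\<lambda>w. indicator ?A w * cell_average M (p j) \<nu> w)" for j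
    using A by (intro simple_function_mult simple_function_cell_average p) auto
  have "(\<lambda>j. \<integral>w. indicator ?A w * cell_average M (p (r j)) \<nu> w \<partial>M) \<longlonglongrightarrow> (\<integral>w. indicator ?A w * l w \<partial>M)"
  proof (rule integral_dominated_convergence[where w = "\<lambda>_. C"])
    show "AE w in M. norm (indicator ?A w * cell_average M (p (r j)) \<nu> w) \<le> C" for j
      using norm_cell_average_le[OF p \<nu>, of "r j"] \<nu>(2) by (intro AE_I2) (auto simp: indicator_def)
    show "AE w in M. (\<lambda>j. indicator ?A w * cell_average M (p (r j)) \<nu> w) \<longlonglongrightarrow> indicator ?A w * l w"
      using lim by eventually_elim (intro tendsto_intros)
    show "(\<lambda>w. indicator ?A w * l w) \<in> borel_measurable M" using A l by measurable
  qed (auto intro: borel_measurable_simple_function simple)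
  moreover have "eventually (\<lambda>j. (\<integral>w. indicator ?A w * cell_average M (p (r j)) \<nu> w \<partial>M) = \<nu> ?A) sequentially"
    using eventually_ge_at_top[of k]
  proof eventually_elim
    case (elim j)
    have "k \<le> r j" using elim strict_mono_imp_increasing[OF r, of j] by simp
    from integral_cell_average_level_set[OF p p refines_chain[where p = p, OF ref this] \<nu>(1) i]
    show ?case using sb_integral_real[OF simple] by simp
  qed
  hence "(\<lambda>j. \<integral>w. indicator ?A w * cell_average M (p (r j)) \<nu> w \<partial>M) \<longlonglongrightarrow> \<nu> ?A"
    by (rule tendsto_eventually)
  ultimately show ?thesis using LIMSEQ_unique by blast
qed

text \<open>A non-approximable charge would give a martingale of cell averages whose increments have
  norm bounded away from 0 in L1. The increments are normed by countably many vectors, uniformly on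
  which the weak-star limit of the martingale takes values in a separable set; hence that limit is
  close to a simple function, whose own martingale does converge in L1.\<close>

lemma lipschitz_charge_approximable:
  fixes G :: "'a set \<Rightarrow> ('b::banach \<Rightarrow>\<^sub>L real)"
  assumes sep: "separable_subspaces_have_separable_dual TYPE('b)"
    and G: "lipschitz_charge M C G" and "0 \<le> C" and "\<epsilon> > 0"
  shows "\<exists>s. simple_function M s \<and> (\<forall>q :: 'a \<Rightarrow> nat. simple_function M q \<longrightarrow>
    approximation_error M G s q \<le> \<epsilon>)"
proof (rule ccontr)
  assume contra: "\<not> ?thesis"
  have "\<forall>s. \<exists>q :: 'a \<Rightarrow> nat. simple_function M s \<longrightarrow> simple_function M q \<and>
    approximation_error M G s q > \<epsilon>"
    using contra by (meson not_le)
  from choice[OF this] obtain Q :: "('a \<Rightarrow> ('b \<Rightarrow>\<^sub>L real)) \<Rightarrow> 'a \<Rightarrow> nat" where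
    Q: "\<forall>s. simple_function M s \<longrightarrow> simple_function M (Q s) \<and>
    approximation_error M G s (Q s) > \<epsilon>" ..
  \<comment> \<open>\<open>Q s\<close> is a partition on which \<open>s\<close> fails. Each new
    partition refines the previous one and the partition on which its own averages fail.\<close>
  define p where "p = rec_nat (\<lambda>_. 0) (\<lambda>_ q w. prod_encode (q w, Q (cell_average M q G) w))"
  define g where "g k = cell_average M (p k) G" for k
  have p_Suc: "p (Suc k) = (\<lambda>w. prod_encode (p k w, Q (g k) w))" for k by (simp add: p_def g_def)
  have p: "simple_function M (p k)" for k
  proof (induction k)
    case (Suc k)
    have "simple_function M (g k)" unfolding g_def by (rule simple_function_cell_average[OF Suc])
    hence "simple_function M (Q (g k))" using Q by blast
    from simple_function_compose2[OF Suc this, of "\<lambda>x y. prod_encode (x, y)"] show ?case by (simp add: p_Suc)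
  qed (simp add: p_def)
  have g: "simple_function M (g k)" for k unfolding g_def by (rule simple_function_cell_average[OF p])
  have Q_simple: "simple_function M (Q (g k))" for k using Q g by blast
  have ref: "refines M (p (Suc k)) (p k)" "refines M (p (Suc k)) (Q (g k))" for k
    by (auto simp: refines_def p_Suc)
  define u where "u k w = g (Suc k) w - g k w" for k w
  have u: "simple_function M (u k)" for k
    unfolding u_def by (rule simple_function_compose2[OF g g])
  have nu: "simple_function M (\<lambda>w. norm (u k w))" for k by (rule simple_function_compose1[OF u])
  \<comment> \<open>Because \<open>p (Suc k)\<close> refines \<open>Q (g k)\<close>, the charge of
    each cell of \<open>Q (g k)\<close> is the integral of \<open>g (Suc k)\<close> over it; hence
    the error of \<open>g k\<close> is at most the L1 norm of \<open>u k\<close>.\<close>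
  have u_large: "(\<integral>w. norm (u k w) \<partial>M) > \<epsilon>" for k
  proof -
    let ?q = "Q (g k)"
    let ?I = "\<lambda>i. level_set M ?q i"
    have Iset: "?I i \<in> sets M" for i by (rule level_set_sets[OF Q_simple])
    have ind: "simple_function M (\<lambda>w. indicat_real (?I i) w *\<^sub>R s w)" if "simple_function M s" for i and s :: "'a \<Rightarrow> ('b \<Rightarrow>\<^sub>L real)"
      using simple_function_compose2[OF simple_function_indicator[OF Iset] that, of "\<lambda>x y. x *\<^sub>R y"] .
    have ind': "simple_function M (\<lambda>w. indicat_real (?I i) w * norm (u k w))" for i
      using simple_function_compose2[OF simple_function_indicator[OF Iset] nu, of "\<lambda>x y. x * y"] .
    have "\<epsilon> < (\<Sum>i\<in>?q ` space M. norm (G (?I i) - sb_integral_on M (?I i) (g k)))"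
      using Q[rule_format, OF g[of k]] unfolding approximation_error_def by (rule conjunct2)
    also have "\<dots> \<le> (\<Sum>i\<in>?q ` space M. \<integral>w. indicator (?I i) w * norm (u k w) \<partial>M)"
    proof (rule sum_mono)
      fix i assume i: "i \<in> ?q ` space M"
      have "G (?I i) = sb_integral_on M (?I i) (g (Suc k))"
        using integral_cell_average_level_set[OF Q_simple p ref(2) G i] by (simp add: g_def)
      hence "G (?I i) - sb_integral_on M (?I i) (g k)
          = sb_integral_on M (?I i) (u k)"
        by (simp add: u_def scaleR_diff_right simple_bochner_integral_diff[OF sb_integrable[OF ind[OF g]] sb_integrable[OF ind[OF g]]])
      hence "norm (G (?I i) - sb_integral_on M (?I i) (g k))
          \<le> sb_integral M (\<lambda>w. norm (indicator (?I i) w *\<^sub>R u k w))"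
        using simple_bochner_integral_norm_bound[OF sb_integrable[OF ind[OF u]]] by simp
      also have "\<dots> = (\<integral>w. indicator (?I i) w * norm (u k w) \<partial>M)"
        using sb_integral_real[OF ind'] by simp
      finally show "norm (G (?I i) - sb_integral_on M (?I i) (g k))
          \<le> (\<integral>w. indicator (?I i) w * norm (u k w) \<partial>M)" .
    qed
    also have "\<dots> = (\<integral>w. norm (u k w) \<partial>M)"
      by (rule integral_eq_sum_level_sets[OF Q_simple integrable_simple[OF nu], symmetric])
    finally show ?thesis .
  qed

  \<comment> \<open>Every \<open>u k\<close> has finitely many values, so these norming vectors are
    countably many; 0 keeps the set nonempty for the enumeration.\<close>
  define D where "D = insert 0 (\<Union>k. (\<lambda>w. almost_norming (u k w)) ` space M)"
  have "countable ((\<lambda>w. almost_norming (u k w)) ` space M)" for k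
    using simple_function_compose1[OF u[of k], of almost_norming]
    by (simp add: simple_function_def countable_finite)
  hence "countable D" unfolding D_def by auto
  have D_norm: "norm x \<le> 1" if "x \<in> D" for x using that almost_norming(1) by (auto simp: D_def)
  define d where "d = from_nat_into D"
  have range_d: "range d = D"
    unfolding d_def using \<open>countable D\<close> by (intro range_from_nat_into) (auto simp: D_def)
  have d_norm: "norm (d n) \<le> 1" for n using range_d by (intro D_norm) auto
  have D_bounded: "bounded D" using D_norm by (intro boundedI[of _ 1])
  define \<nu> where "\<nu> n A = G A (d n)" for n A
  have \<nu>: "lipschitz_charge M C (\<nu> n)" for n
    unfolding lipschitz_charge_def
  proof (intro conjI ballI impI)
    fix A assume A: "A \<in> sets M"
    have "\<bar>\<nu> n A\<bar> \<le> norm (G A) * norm (d n)" using norm_blinfun[of "G A" "d n"] by (simp add: \<nu>_def)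
    also have "\<dots> \<le> norm (G A) * 1" by (intro mult_left_mono d_norm) simp
    finally show "norm (\<nu> n A) \<le> C * measure M A" using lipschitz_charge_bound[OF G A] by simp
  next
    fix A B assume "A \<in> sets M" "B \<in> sets M" "A \<inter> B = {}"
    from lipschitz_charge_Un[OF G this] show "\<nu> n (A \<union> B) = \<nu> n A + \<nu> n B"
      by (simp add: \<nu>_def blinfun.add_left)
  qed
  have avg_\<nu>: "cell_average M (p k) (\<nu> n) w = g k w (d n)" for k n w
    by (simp add: cell_average_def g_def \<nu>_def blinfun.scaleR_left)
  let ?avg = "\<lambda>k (\<nu> :: 'a set \<Rightarrow> real). cell_average M (p k) \<nu>"
  obtain r :: "nat \<Rightarrow> nat" where r: "strict_mono r" and
    conv: "AE w in M. \<forall>n. convergent (\<lambda>j. ?avg (r j) (\<nu> n) w)"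
    by (rule cell_average_AE_convergent_subsequence[where p = p and \<nu> = \<nu>, OF p ref(1) \<nu> \<open>0 \<le> C\<close>])
  define l where "l n w = lim (\<lambda>j. ?avg (r j) (\<nu> n) w)" for n w
  have l_meas [measurable]: "l n \<in> borel_measurable M" for n
    unfolding l_def[abs_def]
    by (intro borel_measurable_lim_metric borel_measurable_simple_function simple_function_cell_average p)
  have l_lim: "AE w in M. \<forall>n. (\<lambda>j. ?avg (r j) (\<nu> n) w) \<longlonglongrightarrow> l n w"
    using conv by eventually_elim (simp add: l_def convergent_LIMSEQ_iff)
  have g_norm: "norm (g k w) \<le> C" for k w
    unfolding g_def by (rule norm_cell_average_le[OF p G \<open>0 \<le> C\<close>])

  \<comment> \<open>With this choice the error function \<open>b\<close> below has integral at most
    \<open>\<epsilon>' * (measure M (space M) + C)\<close>, hence at most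
    \<open>\<epsilon> / 16\<close>; adding 1 keeps \<open>c\<close> positive.\<close>
  define c where "c = measure M (space M) + C + 1"
  have c: "c > 0" using \<open>0 \<le> C\<close> by (simp add: c_def add_nonneg_pos)
  define \<epsilon>' where "\<epsilon>' = \<epsilon> / 16 / c"
  have \<epsilon>': "\<epsilon>' > 0" using \<open>\<epsilon> > 0\<close> c by (simp add: \<epsilon>'_def)
  have "uniformly_coverable D \<epsilon>' UNIV"
    using sep \<open>countable D\<close> D_bounded \<epsilon>' unfolding separable_subspaces_have_separable_dual_def by blast
  then obtain \<Psi> where \<Psi>: "countable \<Psi>"
    and near_\<Psi>: "\<And>\<phi>. \<exists>\<psi>\<in>\<Psi>. \<forall>x\<in>D. \<bar>blinfun_apply \<phi> x - blinfun_apply \<psi> x\<bar> \<le> \<epsilon>'"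
    unfolding uniformly_coverable_def by auto
  have "\<Psi> \<noteq> {}" using near_\<Psi> by blast
  define \<psi> where "\<psi> = from_nat_into \<Psi>"
  have range_\<psi>: "range \<psi> = \<Psi>" unfolding \<psi>_def by (rule range_from_nat_into[OF \<open>\<Psi> \<noteq> {}\<close> \<Psi>])
  \<comment> \<open>The condition involves only the countably many measurable functions
    \<open>l n\<close>, so \<open>F i\<close> is measurable although the underlying weak-star limit
    need not be.\<close>
  define F where "F i = {w\<in>space M. \<forall>n. \<bar>l n w - \<psi> i (d n)\<bar> \<le> \<epsilon>'}" for i
  have F_sets [measurable]: "F i \<in> sets M" for i unfolding F_def by measurable
  have F_cover: "AE w in M. w \<in> (\<Union>i. F i)"
    using l_lim AE_space
  proof eventually_elim
    case (elim w)
    \<comment> \<open>At the fixed point \<open>w\<close> the numbers \<open>l n w\<close> are the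
      values on \<open>D\<close> of a genuine functional, which is needed before a centre from
      \<open>\<Psi>\<close> can be found near them.\<close>
    obtain T \<phi> where T: "T \<noteq> bot" "T \<le> sequentially"
      and \<phi>: "\<And>y. ((\<lambda>j. g (r j) w y) \<longlongrightarrow> blinfun_apply \<phi> y) T"
      by (rule functional_filter_limit[of "\<lambda>j. g (r j) w" C]) (use g_norm in auto)
    have l_\<phi>: "l n w = \<phi> (d n)" for n
    proof (rule tendsto_unique[OF T(1) _ \<phi>])
      have "(\<lambda>j. g (r j) w (d n)) \<longlonglongrightarrow> l n w" using elim(1) by (simp add: avg_\<nu>)
      thus "((\<lambda>j. g (r j) w (d n)) \<longlongrightarrow> l n w) T" by (rule tendsto_mono[OF T(2)])
    qed
    obtain \<xi> where \<xi>: "\<xi> \<in> \<Psi>" "\<forall>x\<in>D. \<bar>\<phi> x - \<xi> x\<bar> \<le> \<epsilon>'"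
      using near_\<Psi>[of \<phi>] by blast
    then obtain i where i: "\<xi> = \<psi> i" using range_\<psi> by auto
    have "w \<in> F i" using \<xi>(2) range_d elim(2) by (auto simp: F_def l_\<phi> i)
    thus ?case by blast
  qed
  define W where "W n = (\<Union>i<n. F i)" for n :: nat
  have W_sets [measurable]: "W n \<in> sets M" for n unfolding W_def by measurable
  have "(\<lambda>n. measure M (W n)) \<longlonglongrightarrow> measure M (\<Union>n. W n)"
  proof (rule finite_Lim_measure_incseq)
    show "incseq W" unfolding incseq_def W_def by (intro allI impI UN_mono) auto
  qed auto
  moreover have "(\<Union>n. W n) = (\<Union>i. F i)" by (auto simp: W_def)
  moreover have "measure M (\<Union>i. F i) = measure M (space M)"
    using F_cover by (intro finite_measure_eq_AE) (auto elim: AE_mp)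
  ultimately have "(\<lambda>n. measure M (W n)) \<longlonglongrightarrow> measure M (space M)" by simp
  from LIMSEQ_D[OF this \<epsilon>'] obtain I where "norm (measure M (W I) - measure M (space M)) < \<epsilon>'" by blast
  hence rest: "measure M (space M - W I) \<le> \<epsilon>'" by (simp add: finite_measure_compl)
  define Fd where "Fd i = F i - (\<Union>j<i. F j)" for i :: nat
  have Fd_sets [measurable]: "Fd i \<in> sets M" for i unfolding Fd_def by measurable
  \<comment> \<open>On \<open>W I\<close> the simple function is within \<open>\<epsilon>'\<close>
    of the limits; outside it is 0 while the limits are bounded by \<open>C\<close>, on a set of
    measure at most \<open>\<epsilon>'\<close>.\<close>
  define b where "b w = \<epsilon>' + C * indicator (space M - W I) w" for w
  have b: "0 \<le> b w" "b w \<le> \<epsilon>' + C" for w using \<epsilon>' \<open>0 \<le> C\<close> by (auto simp: b_def indicator_def)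
  have b_int: "integrable M b"
    unfolding b_def[abs_def] by (intro integrable_simple simple_function_add simple_function_mult) auto
  have b_total: "(\<integral>w. b w \<partial>M) \<le> \<epsilon> / 16"
  proof -
    have "(\<integral>w. b w \<partial>M) = \<epsilon>' * measure M (space M) + C * measure M (space M - W I)"
      unfolding b_def by (subst Bochner_Integration.integral_add) (auto simp: less_top[symmetric] Int_absorb2 mult.commute)
    also have "\<dots> \<le> \<epsilon>' * measure M (space M) + C * \<epsilon>'"
      by (intro add_left_mono mult_left_mono rest \<open>0 \<le> C\<close>)
    also have "\<dots> \<le> \<epsilon>' * c" using \<epsilon>' by (simp add: c_def algebra_simps)
    also have "\<dots> = \<epsilon> / 16" using c by (simp add: \<epsilon>'_def)
    finally show ?thesis .
  qed
  define \<beta> where "\<beta> A = (\<integral>w. indicator A w * b w \<partial>M)" for A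
  have \<beta>: "lipschitz_charge M (\<epsilon>' + C) \<beta>"
    unfolding \<beta>_def[abs_def] by (rule lipschitz_charge_set_integral[OF b_int b])
  define \<mu> where "\<mu> i A = measure M (A \<inter> Fd i)" for i A
  have \<mu>: "lipschitz_charge M 1 (\<mu> i)" for i
    unfolding \<mu>_def[abs_def] by (rule lipschitz_charge_measure_Int[OF Fd_sets])
  let ?L = "\<lambda>n w. \<Sum>i<I. indicator (Fd i) w * \<psi> i (d n)"
  have l_close: "AE w in M. \<forall>n. \<bar>l n w - ?L n w\<bar> \<le> b w"
    using l_lim AE_space
  proof eventually_elim
    case (elim w)
    show ?case
    proof
      fix n
      have "\<bar>l n w\<bar> \<le> C"
      proof (rule LIMSEQ_le_const2)
        show "(\<lambda>j. \<bar>?avg (r j) (\<nu> n) w\<bar>) \<longlonglongrightarrow> \<bar>l n w\<bar>" by (intro tendsto_intros elim(1)[rule_format])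
        show "\<exists>N. \<forall>j\<ge>N. \<bar>?avg (r j) (\<nu> n) w\<bar> \<le> C"
          using norm_cell_average_le[OF p \<nu> \<open>0 \<le> C\<close>] by auto
      qed
      show "\<bar>l n w - ?L n w\<bar> \<le> b w"
      proof (cases "w \<in> W I")
        case True
        define m where "m = (LEAST i. w \<in> F i)"
        obtain i0 where i0: "i0 < I" "w \<in> F i0" using True by (auto simp: W_def)
        have m: "w \<in> F m" "m < I" using LeastI[of "\<lambda>i. w \<in> F i", OF i0(2)] Least_le[of "\<lambda>i. w \<in> F i", OF i0(2)] i0(1)
          by (auto simp: m_def)
        have Fd: "w \<in> Fd i \<longleftrightarrow> i = m" for i
        proof
          assume "w \<in> Fd i"
          hence i: "w \<in> F i" "\<not> m < i" using m(1) by (auto simp: Fd_def)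
          thus "i = m" using Least_le[of "\<lambda>i. w \<in> F i", OF i(1)] by (simp add: m_def)
        next
          assume "i = m"
          moreover have "w \<notin> F j" if "j < m" for j using not_less_Least that unfolding m_def by blast
          ultimately show "w \<in> Fd i" using m(1) by (auto simp: Fd_def)
        qed
        have "?L n w
            = (\<Sum>i<I. if i = m then (\<psi> i) (d n) else 0)"
          by (intro sum.cong) (auto simp: indicator_def Fd)
        also have "\<dots> = (\<psi> m) (d n)" using m by (simp add: sum.delta)
        finally show ?thesis using m(1) True by (simp add: F_def b_def)
      next
        case False
        hence "w \<notin> Fd i" if "i < I" for i using that by (auto simp: W_def Fd_def)
        hence "?L n w = 0" by (intro sum.neutral) auto
        thus ?thesis using \<open>\<bar>l n w\<bar> \<le> C\<close> False elim(2) \<epsilon>' by (simp add: b_def)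
      qed
    qed
  qed
  \<comment> \<open>The bound \<open>\<beta> A\<close> does not depend on \<open>n\<close>. This
    uniformity allows the norming vector to vary with the point later on.\<close>
  have charge_close: "\<bar>\<nu> n A - (\<Sum>i<I. \<psi> i (d n) * \<mu> i A)\<bar> \<le> \<beta> A"
    if A: "A = level_set M (p k) i" "i \<in> p k ` space M" for n A k i
  proof -
    have A_sets [measurable]: "A \<in> sets M" unfolding A(1) by (rule level_set_sets[OF p])
    have "AE w in M. (\<lambda>j. ?avg (r j) (\<nu> n) w) \<longlonglongrightarrow> l n w"
      using l_lim by eventually_elim blast
    hence \<nu>_A: "\<nu> n A = (\<integral>w. indicator A w * l n w \<partial>M)"
      unfolding A(1) by (rule integral_level_set_AE_limit[where p = p, OF p ref(1) \<nu> \<open>0 \<le> C\<close> r _ l_meas A(2)])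
    have "AE w in M. \<bar>l n w\<bar> \<le> b w + (\<Sum>i<I. \<bar>\<psi> i (d n)\<bar>)"
      using l_close
    proof eventually_elim
      case (elim w)
      have "\<bar>\<Sum>i<I. indicator (Fd i) w * \<psi> i (d n)\<bar> \<le> (\<Sum>i<I. \<bar>\<psi> i (d n)\<bar>)"
        by (rule order_trans[OF sum_abs]) (intro sum_mono, auto simp: indicator_def)
      thus ?case using elim[rule_format, of n] by linarith
    qed
    hence l_int: "integrable M (l n)"
      by (intro Bochner_Integration.integrable_bound[where f = "\<lambda>w. b w + (\<Sum>i<I. \<bar>\<psi> i (d n)\<bar>)" and g = "l n"])
         (auto simp: b_int elim!: eventually_mono)
    have int: "integrable M (\<lambda>w. indicator A w * l n w)"
        "integrable M (\<lambda>w. indicator A w * (indicator (Fd i) w * \<psi> i (d n)))"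
        "integrable M (\<lambda>w. indicator A w * b w)" for i
      using integrable_mult_indicator[OF A_sets l_int] integrable_mult_indicator[OF A_sets b_int]
        integrable_simple[of "\<lambda>w. indicator A w * (indicator (Fd i) w * \<psi> i (d n))"]
      by (auto intro: simple_function_mult)
    have "\<psi> i (d n) * \<mu> i A
        = (\<integral>w. indicator A w * (indicator (Fd i) w * \<psi> i (d n)) \<partial>M)" for i
    proof -
      have ind_eq: "indicator A w * (indicator (Fd i) w * \<psi> i (d n))
          = indicat_real (A \<inter> Fd i) w * \<psi> i (d n)" for w
        by (auto simp: indicator_def)
      have "A \<inter> Fd i \<inter> space M = A \<inter> Fd i" using sets.sets_into_space[OF A_sets] by auto
      thus ?thesis unfolding ind_eq by (simp add: \<mu>_def mult.commute)
    qed
    note \<mu>_A = this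
    have expand: "indicator A w * (l n w - ?L n w)
        = indicator A w * l n w - (\<Sum>i<I. indicator A w * (indicator (Fd i) w * \<psi> i (d n)))" for w
      by (simp only: right_diff_distrib sum_distrib_left)
    have int_sum: "integrable M (\<lambda>w. \<Sum>i<I. indicator A w * (indicator (Fd i) w * \<psi> i (d n)))"
      by (rule Bochner_Integration.integrable_sum) (rule int(2))
    have "\<nu> n A - (\<Sum>i<I. \<psi> i (d n) * \<mu> i A)
        = (\<integral>w. indicator A w * (l n w - ?L n w) \<partial>M)"
      unfolding expand Bochner_Integration.integral_diff[OF int(1) int_sum]
        Bochner_Integration.integral_sum[OF int(2)] \<nu>_A \<mu>_A ..
    also have "\<bar>\<dots>\<bar> \<le> (\<integral>w. \<bar>indicator A w * (l n w - ?L n w)\<bar> \<partial>M)"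
      by (rule integral_abs_bound)
    also have "\<dots> \<le> \<beta> A"
      unfolding \<beta>_def
    proof (rule integral_mono_AE)
      show "integrable M (\<lambda>w. \<bar>indicator A w * (l n w - ?L n w)\<bar>)"
        unfolding expand by (intro integrable_abs Bochner_Integration.integrable_diff int int_sum)
      show "integrable M (\<lambda>w. indicator A w * b w)" by (rule int(3))
      show "AE w in M. \<bar>indicator A w * (l n w - ?L n w)\<bar>
          \<le> indicator A w * b w"
        using l_close by eventually_elim (auto simp: indicator_def)
    qed
    finally show ?thesis .
  qed
  have avg_close: "\<bar>g k w (d n) - (\<Sum>i<I. \<psi> i (d n) * ?avg k (\<mu> i) w)\<bar>
      \<le> ?avg k \<beta> w" if w: "w \<in> space M" for k n w
  proof -
    let ?A = "level_set M (p k) (p k w)"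
    have "\<bar>\<nu> n ?A - (\<Sum>i<I. \<psi> i (d n) * \<mu> i ?A)\<bar> * inverse (measure M ?A)
        \<le> \<beta> ?A * inverse (measure M ?A)"
      using w by (intro mult_right_mono charge_close[OF refl]) auto
    hence "\<bar>(\<nu> n ?A - (\<Sum>i<I. \<psi> i (d n) * \<mu> i ?A)) * inverse (measure M ?A)\<bar>
        \<le> \<beta> ?A * inverse (measure M ?A)"
      by (simp add: abs_mult)
    moreover have "g k w (d n) - (\<Sum>i<I. \<psi> i (d n) * ?avg k (\<mu> i) w)
        = (\<nu> n ?A - (\<Sum>i<I. \<psi> i (d n) * \<mu> i ?A)) * inverse (measure M ?A)"
      unfolding avg_\<nu>[symmetric] cell_average_def
      by (simp add: algebra_simps sum_distrib_left sum_distrib_right)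
    moreover have "?avg k \<beta> w = \<beta> ?A * inverse (measure M ?A)"
      by (simp add: cell_average_def)
    ultimately show ?thesis by (simp only:)
  qed
  define V where "V i k = (\<integral>w. \<bar>?avg (Suc k) (\<mu> i) w - ?avg k (\<mu> i) w\<bar> \<partial>M)" for i k
  have V_simple: "simple_function M (\<lambda>w. \<bar>?avg (Suc k) (\<mu> i) w - ?avg k (\<mu> i) w\<bar>)" for i k
    by (rule simple_function_compose2[where h = "\<lambda>x y. \<bar>x - y\<bar>"]) (intro simple_function_cell_average p)+
  have \<beta>_int: "integrable M (?avg k \<beta>)" for k
    by (intro integrable_simple simple_function_cell_average p)
  \<comment> \<open>Evaluating \<open>u k\<close> at its norming vector keeps half its norm. The
    averages of \<open>\<beta>\<close> at the levels \<open>k\<close> and \<open>Suc k\<close> have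
    the same integral, at most \<open>\<epsilon> / 16\<close> each. What remains are increments of
    finitely many scalar martingales, which vanish in the limit.\<close>
  have "\<epsilon> / 2 \<le> \<epsilon> / 8 + (\<Sum>i<I. norm (\<psi> i) * V i k)" for k
  proof -
    have pt: "norm (u k w) / 2 \<le> ?avg (Suc k) \<beta> w + ?avg k \<beta> w
        + (\<Sum>i<I. norm (\<psi> i) * \<bar>?avg (Suc k) (\<mu> i) w - ?avg k (\<mu> i) w\<bar>)"
      if w: "w \<in> space M" for w
    proof -
      have "almost_norming (u k w) \<in> D" using w by (auto simp: D_def)
      then obtain n where n: "almost_norming (u k w) = d n" using range_d by (metis imageE)
      let ?S = "\<lambda>k. \<Sum>i<I. \<psi> i (d n) * ?avg k (\<mu> i) w"
      have "\<bar>?S (Suc k) - ?S k\<bar> \<le> (\<Sum>i<I. \<bar>\<psi> i (d n) *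
          (?avg (Suc k) (\<mu> i) w - ?avg k (\<mu> i) w)\<bar>)"
        unfolding sum_subtractf[symmetric] right_diff_distrib[symmetric] by (rule sum_abs)
      also have "\<dots> \<le> (\<Sum>i<I. norm (\<psi> i) * \<bar>?avg (Suc k) (\<mu> i) w - ?avg k (\<mu> i) w\<bar>)"
        unfolding abs_mult
      proof (intro sum_mono mult_right_mono)
        fix i
        have "\<bar>\<psi> i (d n)\<bar> \<le> norm (\<psi> i) * norm (d n)" using norm_blinfun[of "\<psi> i" "d n"] by simp
        also have "\<dots> \<le> norm (\<psi> i) * 1" by (intro mult_left_mono d_norm) simp
        finally show "\<bar>\<psi> i (d n)\<bar> \<le> norm (\<psi> i)" by simp
      qed simp
      finally have S: "?S (Suc k) - ?S k \<le> (\<Sum>i<I. norm (\<psi> i) * \<bar>?avg (Suc k) (\<mu> i) w - ?avg k (\<mu> i) w\<bar>)"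
        by linarith
      have "norm (u k w) / 2 \<le> g (Suc k) w (d n) - g k w (d n)"
        using almost_norming(2)[of "u k w"] by (simp add: n) (simp add: u_def blinfun.diff_left)
      thus ?thesis using S avg_close[OF w, of "Suc k" n] avg_close[OF w, of k n] by linarith
    qed
    have "\<epsilon> / 2 \<le> (\<integral>w. norm (u k w) / 2 \<partial>M)" using u_large[of k] by simp
    also have "\<dots> \<le> (\<integral>w. ?avg (Suc k) \<beta> w + ?avg k \<beta> w
        + (\<Sum>i<I. norm (\<psi> i) * \<bar>?avg (Suc k) (\<mu> i) w - ?avg k (\<mu> i) w\<bar>) \<partial>M)"
      using integrable_simple[OF V_simple] \<beta>_int integrable_simple[OF nu] pt
      by (intro integral_mono Bochner_Integration.integrable_add Bochner_Integration.integrable_sum) auto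
    also have "\<dots> = \<beta> (space M) + \<beta> (space M) + (\<Sum>i<I. norm (\<psi> i) * V i k)"
      using integrable_simple[OF V_simple] \<beta>_int
      by (simp add: integral_cell_average_total[OF p \<beta>] V_def Bochner_Integration.integral_sum)
    also have "\<beta> (space M) = (\<integral>w. b w \<partial>M)"
      unfolding \<beta>_def by (intro Bochner_Integration.integral_cong) auto
    finally show ?thesis using b_total by linarith
  qed
  moreover have "(\<lambda>k. \<epsilon> / 8 + (\<Sum>i<I. norm (\<psi> i) * V i k)) \<longlonglongrightarrow> \<epsilon> / 8 + (\<Sum>i<I. norm (\<psi> i) * 0)"
    unfolding V_def
    by (intro tendsto_intros cell_average_increments_tendsto_0[where p = p, OF p ref(1) \<mu>]) simp
  ultimately have "\<epsilon> / 2 \<le> \<epsilon> / 8 + (\<Sum>i<I. norm (\<psi> i) * 0)"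
    by (intro LIMSEQ_le_const) auto
  thus False using \<open>\<epsilon> > 0\<close> by simp
qed

end

section \<open>Separable duals imply the Radon--Nikodym property\<close>

text \<open>The families need not cover \<open>E\<close>, which makes monotonicity in
  \<open>E\<close> immediate; on the whole space adding the uncovered remainder compares it with
  \<open>total_variation\<close>.\<close>

definition variation :: "'c measure \<Rightarrow> ('c set \<Rightarrow> 'b::real_normed_vector) \<Rightarrow> 'c set \<Rightarrow> ennreal" where
  "variation M G E =
     (SUP P\<in>{P. finite P \<and> P \<subseteq> sets M \<and> disjoint P \<and> \<Union>P \<subseteq> E}. \<Sum>A\<in>P. ennreal (norm (G A)))"

lemma variation_upper:
  "finite P \<Longrightarrow> P \<subseteq> sets M \<Longrightarrow> disjoint P \<Longrightarrow> \<Union>P \<subseteq> E \<Longrightarrow> (\<Sum>A\<in>P. ennreal (norm (G A))) \<le> variation M G E"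
  unfolding variation_def by (rule SUP_upper) simp

lemma variation_least:
  "(\<And>P. finite P \<Longrightarrow> P \<subseteq> sets M \<Longrightarrow> disjoint P \<Longrightarrow> \<Union>P \<subseteq> E \<Longrightarrow> (\<Sum>A\<in>P. ennreal (norm (G A))) \<le> c)
    \<Longrightarrow> variation M G E \<le> c"
  unfolding variation_def by (rule SUP_least) auto

lemma variation_mono: "E \<subseteq> E' \<Longrightarrow> variation M G E \<le> variation M G E'"
  by (rule variation_least, rule variation_upper) auto

lemma norm_le_variation: "E \<in> sets M \<Longrightarrow> ennreal (norm (G E)) \<le> variation M G E"
  using variation_upper[of "{E}" M E G] by simp

text \<open>Two disjoint sets can have the same trace on \<open>A\<close> only if that trace is
  empty, where \<open>G\<close> vanishes; so no term is lost when the traces are collected into a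
  set.\<close>

lemma sum_image_Int_le_variation:
  assumes P: "finite P" "P \<subseteq> sets M" "disjoint P" and A: "A \<in> sets M" and G: "G {} = 0"
  shows "(\<Sum>B\<in>P. ennreal (norm (G (B \<inter> A)))) \<le> variation M G A"
proof -
  have "(\<Sum>B\<in>P. ennreal (norm (G (B \<inter> A)))) = (\<Sum>B\<in>(\<lambda>B. B \<inter> A) ` P. ennreal (norm (G B)))"
  proof (rule sum.reindex_nontrivial[OF P(1), symmetric, unfolded o_def])
    fix B B' assume "B \<in> P" "B' \<in> P" "B \<noteq> B'" "B \<inter> A = B' \<inter> A"
    hence "B \<inter> A = {}" using P(3) unfolding disjoint_def by blast
    thus "ennreal (norm (G (B \<inter> A))) = 0" using G by simp
  qed
  also have "\<dots> \<le> variation M G A"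
  proof (rule variation_upper)
    show "disjoint ((\<lambda>B. B \<inter> A) ` P)" using P(3) unfolding disjoint_def by blast
  qed (use P A in auto)
  finally show ?thesis .
qed

lemma variation_space:
  fixes G :: "'c set \<Rightarrow> 'b::real_normed_vector"
  shows "variation M G (space M) \<le> total_variation M G"
proof (rule variation_least)
  fix P :: "'c set set" assume P: "finite P" "P \<subseteq> sets M" "disjoint P" "\<Union>P \<subseteq> space M"
  let ?P = "insert (space M - \<Union>P) P"
  have "(\<Sum>A\<in>P. ennreal (norm (G A))) \<le> (\<Sum>A\<in>?P. ennreal (norm (G A)))"
    using P by (intro sum_mono2) auto
  also have "\<dots> \<le> total_variation M G"
    unfolding total_variation_def
  proof (rule SUP_upper, intro CollectI conjI)
    have "\<Union>P \<in> sets M" using P by (intro sets.finite_Union) auto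
    thus "?P \<subseteq> sets M" using P by auto
    show "disjoint ?P" using P(3) unfolding disjoint_def by blast
  qed (use P in auto)
  finally show "(\<Sum>A\<in>P. ennreal (norm (G A))) \<le> total_variation M G" .
qed

section \<open>Countable additivity of the variation, truncation and approximation\<close>

lemma vector_measure_empty:
  assumes "vector_measure M G"
  shows "G {} = 0"
proof -
  \<comment> \<open>The empty sets form a disjoint sequence, so a constant series converges and its
    term must be 0.\<close>
  have "(\<lambda>i::nat. G {}) sums G (\<Union>i::nat. {})"
    using assms[unfolded vector_measure_def, rule_format, of "\<lambda>_. {}"] by (simp add: disjoint_family_on_def)
  hence "summable (\<lambda>i::nat. G {})" by (rule sums_summable)
  thus ?thesis by (simp add: summable_const_iff)
qed

lemma vector_measure_Un:
  assumes G: "vector_measure M G" and AB: "A \<in> sets M" "B \<in> sets M" "A \<inter> B = {}"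
  shows "G (A \<union> B) = G A + G B"
proof -
  have "(\<lambda>i. G (binaryset A B i)) sums G (\<Union>i. binaryset A B i)"
    using AB by (intro G[unfolded vector_measure_def, rule_format])
      (auto simp: range_binaryset_eq disjoint_family_on_def binaryset_def)
  moreover have "(\<lambda>i. G (binaryset A B i)) sums (G A + G B)"
    by (rule binaryset_sums[where f = G, OF vector_measure_empty[OF G]])
  ultimately show ?thesis using sums_unique2 UN_binaryset_eq[of A B] by metis
qed

text \<open>One inequality joins families inside disjoint sets, first for two sets and then for
  finite unions. The other cuts every member of a family along the \<open>A i\<close> and uses the
  countable additivity of \<open>G\<close> with the triangle inequality.\<close>

lemma variation_countably_additive:
  assumes G: "vector_measure M G"
  shows "countably_additive (sets M) (variation M G)"
  unfolding countably_additive_def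
proof (intro allI impI antisym)
  fix A :: "nat \<Rightarrow> 'a set"
  assume A: "range A \<subseteq> sets M" "disjoint_family A" "(\<Union>i. A i) \<in> sets M"
  hence Ai: "A i \<in> sets M" for i by auto
  note G0 = vector_measure_empty[OF G]
  have add: "variation M G B + variation M G B' \<le> variation M G (B \<union> B')"
    if "B \<inter> B' = {}" for B B'
  proof -
    let ?\<P> = "\<lambda>E. {P. finite P \<and> P \<subseteq> sets M \<and> disjoint P \<and> \<Union>P \<subseteq> E}"
    have ne: "?\<P> E \<noteq> {}" for E by (auto intro!: exI[of _ "{}"])
    let ?S = "\<lambda>P. \<Sum>A\<in>P. ennreal (norm (G A))"
    have "variation M G B + variation M G B' = (SUP P\<in>?\<P> B. (SUP P'\<in>?\<P> B'. ?S P + ?S P'))"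
    proof -
      have "variation M G B + variation M G B' = (SUP P\<in>?\<P> B. ?S P + variation M G B')"
        unfolding variation_def[of M G B] by (rule ennreal_SUP_add_left[OF ne, symmetric])
      also have "\<dots> = (SUP P\<in>?\<P> B. (SUP P'\<in>?\<P> B'. ?S P + ?S P'))"
        unfolding variation_def[of M G B'] by (intro SUP_cong refl ennreal_SUP_add_right[OF ne])
      finally show ?thesis .
    qed
    also have "\<dots> \<le> variation M G (B \<union> B')"
    proof (intro SUP_least)
      fix P P' assume P: "P \<in> ?\<P> B" and P': "P' \<in> ?\<P> B'"
      \<comment> \<open>The two families can share only the empty set, which has charge 0, so the
        sum over their union counts nothing twice.\<close>
      have "X = {}" if "X \<in> P \<inter> P'" for X using that P P' \<open>B \<inter> B' = {}\<close> by blast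
      hence "(\<Sum>A\<in>P. ennreal (norm (G A))) + (\<Sum>A\<in>P'. ennreal (norm (G A))) = (\<Sum>A\<in>P \<union> P'. ennreal (norm (G A)))"
        using P P' G0 by (intro sum.union_inter_neutral[symmetric]) auto
      also have "\<dots> \<le> variation M G (B \<union> B')"
      proof (rule variation_upper)
        show "disjoint (P \<union> P')"
          by (rule disjoint_union) (use P P' \<open>B \<inter> B' = {}\<close> in blast)+
      qed (use P P' in auto)
      finally show "(\<Sum>A\<in>P. ennreal (norm (G A))) + (\<Sum>A\<in>P'. ennreal (norm (G A))) \<le> variation M G (B \<union> B')" .
    qed
    finally show ?thesis .
  qed
  have "(\<Sum>i<n. variation M G (A i)) \<le> variation M G (\<Union>i<n. A i)" for n
  proof (induction n)
    case (Suc n)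
    have "(\<Sum>i<Suc n. variation M G (A i)) \<le> variation M G (\<Union>i<n. A i) + variation M G (A n)"
      using Suc by (simp add: add_right_mono)
    also have "\<dots> \<le> variation M G ((\<Union>i<n. A i) \<union> A n)"
    proof (rule add)
      have "A i \<inter> A n = {}" if "i < n" for i using A(2) that by (simp add: disjoint_family_on_def)
      thus "(\<Union>i<n. A i) \<inter> A n = {}" by blast
    qed
    also have "(\<Union>i<n. A i) \<union> A n = (\<Union>i<Suc n. A i)" by (auto simp: lessThan_Suc)
    finally show ?case .
  qed simp
  hence "(\<Sum>i<n. variation M G (A i)) \<le> variation M G (\<Union>i. A i)" for n
    by (rule order_trans) (auto intro!: variation_mono)
  thus "(\<Sum>i. variation M G (A i)) \<le> variation M G (\<Union>i. A i)"
    unfolding suminf_eq_SUP by (intro SUP_least)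
  show "variation M G (\<Union>i. A i) \<le> (\<Sum>i. variation M G (A i))"
  proof (rule variation_least)
    fix P assume P: "finite P" "P \<subseteq> sets M" "disjoint P" "\<Union>P \<subseteq> (\<Union>i. A i)"
    have "ennreal (norm (G B)) \<le> (\<Sum>i. ennreal (norm (G (B \<inter> A i))))" if "B \<in> P" for B
    proof -
      have "(\<lambda>i. G (B \<inter> A i)) sums G (\<Union>i. B \<inter> A i)"
      proof (intro G[unfolded vector_measure_def, rule_format])
        have "A m \<inter> A n = {}" if "m \<noteq> n" for m n using A(2) that by (simp add: disjoint_family_on_def)
        thus "disjoint_family (\<lambda>i. B \<inter> A i)" unfolding disjoint_family_on_def by blast
      qed (use P that Ai in auto)
      moreover have "(\<Union>i. B \<inter> A i) = B" using P that by blast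
      ultimately have "(\<lambda>n. \<Sum>i<n. G (B \<inter> A i)) \<longlonglongrightarrow> G B" by (simp add: sums_def)
      hence lim: "(\<lambda>n. ennreal (norm (\<Sum>i<n. G (B \<inter> A i)))) \<longlonglongrightarrow> ennreal (norm (G B))"
        by (intro tendsto_intros)
      have bound: "ennreal (norm (\<Sum>i<n. G (B \<inter> A i))) \<le> (\<Sum>i. ennreal (norm (G (B \<inter> A i))))" for n
      proof -
        have "ennreal (norm (\<Sum>i<n. G (B \<inter> A i))) \<le> ennreal (\<Sum>i<n. norm (G (B \<inter> A i)))"
          by (intro ennreal_leI norm_sum)
        also have "\<dots> = (\<Sum>i<n. ennreal (norm (G (B \<inter> A i))))" by (simp add: sum_ennreal)
        also have "\<dots> \<le> (\<Sum>i. ennreal (norm (G (B \<inter> A i))))" by (intro sum_le_suminf) auto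
        finally show ?thesis .
      qed
      show ?thesis by (rule LIMSEQ_le_const2[OF lim]) (use bound in blast)
    qed
    hence "(\<Sum>B\<in>P. ennreal (norm (G B))) \<le> (\<Sum>B\<in>P. \<Sum>i. ennreal (norm (G (B \<inter> A i))))"
      by (rule sum_mono)
    also have "\<dots> = (\<Sum>i. \<Sum>B\<in>P. ennreal (norm (G (B \<inter> A i))))"
      by (rule suminf_sum[symmetric]) auto
    also have "\<dots> \<le> (\<Sum>i. variation M G (A i))"
      by (intro suminf_le sum_image_Int_le_variation P Ai G0) auto
    finally show "(\<Sum>B\<in>P. ennreal (norm (G B))) \<le> (\<Sum>i. variation M G (A i))" .
  qed
qed

text \<open>The variation is a finite measure and absolutely continuous, so the scalar
  Radon--Nikodym theorem gives it a density \<open>h\<close>. On the set where \<open>h\<close> is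
  at most \<open>n\<close> the charge is Lipschitz with constant \<open>n\<close>, and the variation
  of the rest tends to 0.\<close>

lemma vector_measure_truncation:
  fixes G :: "'c set \<Rightarrow> 'b::banach"
  assumes "finite_measure M" and G: "vector_measure M G" and tv: "total_variation M G < \<infinity>"
    and cont: "continuous_wrt_measure M G" and "\<epsilon> > 0"
  obtains S n where "S \<in> sets M" "variation M G (space M - S) \<le> ennreal \<epsilon>"
    "\<And>E. E \<in> sets M \<Longrightarrow> E \<subseteq> S \<Longrightarrow> norm (G E) \<le> real n * measure M E"
proof -
  interpret finite_measure M by fact
  note G0 = vector_measure_empty[OF G]
  define N where "N = measure_of (space M) (sets M) (variation M G)"
  have N_sets [simp, measurable_cong]: "sets N = sets M" and N_space [simp]: "space N = space M"
    by (simp_all add: N_def)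
  have pos: "positive (sets M) (variation M G)"
  proof -
    have "variation M G {} \<le> 0"
    proof (rule variation_least)
      fix P :: "'c set set" assume "\<Union>P \<subseteq> {}"
      hence "A = {}" if "A \<in> P" for A using that by blast
      hence "(\<Sum>A\<in>P. ennreal (norm (G A))) = 0" using G0 by (intro sum.neutral) auto
      thus "(\<Sum>A\<in>P. ennreal (norm (G A))) \<le> 0" by simp
    qed
    thus ?thesis by (simp add: positive_def)
  qed
  have N: "emeasure N A = variation M G A" if "A \<in> sets M" for A
    unfolding N_def
    by (rule emeasure_measure_of_sigma[OF sets.sigma_algebra_axioms pos variation_countably_additive[OF G] that])
  have fin: "emeasure N (space M) < \<infinity>"
    using le_less_trans[OF variation_space tv] by (simp add: N)
  interpret N: finite_measure N by (intro finite_measureI) (use fin in auto)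
  have null: "G E = 0" if "E \<in> null_sets M" for E
  proof (rule ccontr)
    assume "G E \<noteq> 0"
    then obtain \<delta> where "\<delta> > 0" "\<forall>F\<in>sets M. measure M F < \<delta> \<longrightarrow> norm (G F) < norm (G E)"
      using cont unfolding continuous_wrt_measure_def by (meson zero_less_norm_iff)
    moreover have "measure M E = 0" "E \<in> sets M" using that by (auto simp: measure_def)
    ultimately show False by (metis less_irrefl)
  qed
  have "absolutely_continuous M N"
    unfolding absolutely_continuous_def
  proof
    fix E assume E: "E \<in> null_sets M"
    have "variation M G E \<le> 0"
    proof (rule variation_least)
      fix P assume P: "P \<subseteq> sets M" "\<Union>P \<subseteq> E"
      have "G A = 0" if "A \<in> P" for A
        using that P E by (intro null null_sets_subset[OF E]) auto
      thus "(\<Sum>A\<in>P. ennreal (norm (G A))) \<le> 0" by simp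
    qed
    thus "E \<in> null_sets N" using E by (auto simp: null_sets_def N)
  qed
  then obtain h where h [measurable]: "h \<in> borel_measurable M" and hN: "density M h = N"
    using Radon_Nikodym[of N] by auto
  have V: "variation M G E = (\<integral>\<^sup>+w. h w * indicator E w \<partial>M)" if "E \<in> sets M" for E
    using N[OF that] emeasure_density[OF h that] by (simp add: hN)
  define S where "S n = {w\<in>space M. h w \<le> of_nat n}" for n :: nat
  have S [measurable]: "S n \<in> sets M" for n unfolding S_def by measurable
  have "(\<integral>\<^sup>+w. h w \<partial>M) = emeasure N (space M)"
    using emeasure_density[OF h, of "space M"] by (simp add: hN cong: nn_integral_cong)
  hence "AE w in M. h w \<noteq> \<infinity>" using fin by (intro nn_integral_PInf_AE) auto
  hence "AE w in M. w \<in> (\<Union>n. S n)"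
    using AE_space
  proof eventually_elim
    case (elim w)
    then obtain n :: nat where "h w < of_nat n" using ennreal_Ex_less_of_nat[of "h w"] by (auto simp: less_top)
    thus ?case using elim(2) by (auto simp: S_def intro!: exI[of _ n] less_imp_le)
  qed
  hence "AE w in N. w \<in> (\<Union>n. S n)"
    unfolding hN[symmetric] by (subst AE_density[OF h]) auto
  hence "measure N (\<Union>n. S n) = measure N (space N)"
    by (intro N.finite_measure_eq_AE) (auto elim: AE_mp)
  moreover have "(\<lambda>n. measure N (S n)) \<longlonglongrightarrow> measure N (\<Union>n. S n)"
  proof (rule N.finite_Lim_measure_incseq)
    show "incseq S" unfolding incseq_def S_def by (auto intro: order_trans)
  qed auto
  ultimately have "(\<lambda>n. measure N (S n)) \<longlonglongrightarrow> measure N (space N)" by simp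
  from LIMSEQ_D[OF this \<open>\<epsilon> > 0\<close>] obtain n where "norm (measure N (S n) - measure N (space N)) < \<epsilon>" by blast
  moreover have "measure N (space M - S n) = measure N (space M) - measure N (S n)"
    using N.finite_measure_compl[of "S n"] by simp
  ultimately have "measure N (space M - S n) \<le> \<epsilon>" by (simp add: abs_less_iff)
  moreover have "variation M G (space M - S n) = ennreal (measure N (space M - S n))"
    using N[of "space M - S n"] by (simp add: N.emeasure_eq_measure)
  ultimately have "variation M G (space M - S n) \<le> ennreal \<epsilon>" by (simp only: ennreal_leI)
  moreover have "norm (G E) \<le> real n * measure M E" if E: "E \<in> sets M" "E \<subseteq> S n" for E
  proof -
    have "ennreal (norm (G E)) \<le> variation M G E" by (rule norm_le_variation[OF E(1)])
    also have "\<dots> \<le> (\<integral>\<^sup>+w. of_nat n * indicator E w \<partial>M)"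
      unfolding V[OF E(1)] using E(2) by (intro nn_integral_mono) (auto simp: S_def indicator_def)
    also have "\<dots> = ennreal (real n * measure M E)"
      using E(1) by (simp add: nn_integral_cmult_indicator emeasure_eq_measure ennreal_mult ennreal_of_nat_eq_real_of_nat)
    finally show ?thesis by (simp add: measure_nonneg)
  qed
  ultimately show ?thesis using that[OF S] by blast
qed

text \<open>Half of \<open>\<epsilon>\<close> is spent on the Lipschitz part, approximated on the
  restricted space \<open>S\<close>; the other half on the complement, where the approximant is 0
  and the error is at most the variation there.\<close>

lemma vector_measure_approximable:
  fixes G :: "'c set \<Rightarrow> ('a::banach \<Rightarrow>\<^sub>L real)"
  assumes sep: "separable_subspaces_have_separable_dual TYPE('a)" and M: "finite_measure M"
    and G: "vector_measure M G" and tv: "total_variation M G < \<infinity>"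
    and cont: "continuous_wrt_measure M G" and "\<epsilon> > 0"
  shows "\<exists>t. simple_function M t \<and> (\<forall>q :: 'c \<Rightarrow> nat. simple_function M q \<longrightarrow>
    approximation_error M G t q \<le> \<epsilon>)"
proof -
  interpret finite_measure M by fact
  note G0 = vector_measure_empty[OF G]
  have \<epsilon>2: "\<epsilon> / 2 > 0" using \<open>\<epsilon> > 0\<close> by simp
  obtain S n where S: "S \<in> sets M" and rest: "variation M G (space M - S) \<le> ennreal (\<epsilon> / 2)"
    and lip: "\<And>E. E \<in> sets M \<Longrightarrow> E \<subseteq> S \<Longrightarrow> norm (G E) \<le> real n * measure M E"
    by (rule vector_measure_truncation[OF M G tv cont \<epsilon>2]) (rule that)
  define N where "N = restrict_space M S"
  have S_sub: "S \<inter> space M = S" using sets.sets_into_space[OF S] by auto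
  have S_Int: "S \<inter> space M \<in> sets M" using S by (simp add: S_sub)
  have N_space: "space N = S" using S_sub by (simp add: N_def space_restrict_space)
  have N_sets: "E \<in> sets N \<longleftrightarrow> E \<in> sets M \<and> E \<subseteq> S" for E
    unfolding N_def using sets_restrict_space_iff[OF S_Int] by blast
  have N_measure: "measure N E = measure M E" if "E \<subseteq> S" for E
    unfolding N_def by (rule measure_restrict_space[OF S_Int that])
  have N: "finite_measure N" unfolding N_def by (rule finite_measure_restrict_space[OF M S])
  have "lipschitz_charge N (real n) G"
    unfolding lipschitz_charge_def using vector_measure_Un[OF G] lip by (auto simp: N_sets N_measure)
  from finite_measure.lipschitz_charge_approximable[OF N sep this _ \<epsilon>2]
  obtain s where s: "simple_function N s" and s_close: "\<And>q :: 'c \<Rightarrow> nat. simple_function N q \<Longrightarrow>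
      approximation_error N G s q \<le> \<epsilon> / 2"
    by auto
  have restrict: "sb_integrable M (\<lambda>w. indicator S w *\<^sub>R f w)"
      "sb_integral N f = sb_integral_on M S f"
    if "simple_function N f" for f :: "'c \<Rightarrow> ('a \<Rightarrow>\<^sub>L real)"
    using finite_measure.sb_integrable[OF N that] simple_bochner_integrable_restrict_space[OF S_Int, of f]
      simple_bochner_integral_restrict_space[OF S_Int, of f] by (auto simp: N_def)
  define t where "t w = indicator S w *\<^sub>R s w" for w
  have "simple_function M t"
    using restrict(1)[OF s] by (simp add: t_def[abs_def] simple_bochner_integrable.simps)
  moreover have "approximation_error M G t q \<le> \<epsilon>"
    if q: "simple_function M q" for q :: "'c \<Rightarrow> nat"
  proof -
    let ?I = "level_set M q"
    have I: "?I i \<in> sets M" for i by (rule level_set_sets[OF q])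
    have qN: "simple_function N q"
      unfolding simple_function_def N_sets N_space
    proof (intro conjI ballI)
      show "finite (q ` S)" using q S_sub by (auto simp: simple_function_def intro: finite_subset[of _ "q ` space M"])
      fix i
      have "q -` {i} \<inter> S = ?I i \<inter> S" using S_sub by (auto simp: level_set_def)
      thus "q -` {i} \<inter> S \<in> sets M" "q -` {i} \<inter> S \<subseteq> S" using I S by auto
    qed
    have IN: "level_set N q i = ?I i \<inter> S" for i using S_sub by (auto simp: level_set_def N_space)
    have fin: "finite (q ` space M)" using q by (simp add: simple_function_def)
    define e where "e i = norm (G (?I i \<inter> S) - sb_integral_on N (?I i \<inter> S) s)" for i
    have "norm (G (?I i) - sb_integral_on M (?I i) t) \<le> e i + norm (G (?I i \<inter> (space M - S)))" for i
    proof -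
      have "?I i = (?I i \<inter> S) \<union> (?I i \<inter> (space M - S))" by (auto simp: level_set_def)
      hence "G (?I i) = G (?I i \<inter> S) + G (?I i \<inter> (space M - S))"
        using vector_measure_Un[OF G, of "?I i \<inter> S" "?I i \<inter> (space M - S)"] I S by auto
      moreover have "sb_integral_on M (?I i) t = sb_integral_on N (?I i \<inter> S) s"
      proof -
        have "simple_function N (\<lambda>w. indicat_real (?I i \<inter> S) w *\<^sub>R s w)"
          using I S s by (intro simple_function_compose2[where h = "\<lambda>x y. x *\<^sub>R y"] simple_function_indicator) (auto simp: N_sets)
        from restrict(2)[OF this] show ?thesis
          by (simp add: t_def) (intro sb_integral_cong, auto simp: indicator_def)
      qed
      ultimately show ?thesis
        using norm_triangle_ineq[of "G (?I i \<inter> S) - sb_integral_on N (?I i \<inter> S) s"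
            "G (?I i \<inter> (space M - S))"]
        by (simp only: e_def add_diff_eq diff_add_eq)
    qed
    hence "approximation_error M G t q
        \<le> (\<Sum>i\<in>q ` space M. e i) + (\<Sum>i\<in>q ` space M. norm (G (?I i \<inter> (space M - S))))"
      unfolding sum.distrib[symmetric] approximation_error_def by (rule sum_mono)
    also have "(\<Sum>i\<in>q ` space M. e i) = (\<Sum>i\<in>q ` space N. e i)"
    proof (rule sum.mono_neutral_right[OF fin])
      show "q ` space N \<subseteq> q ` space M" using S_sub by (auto simp: N_space)
      show "\<forall>i\<in>q ` space M - q ` space N. e i = 0"
      proof
        fix i assume "i \<in> q ` space M - q ` space N"
        hence "q w \<noteq> i" if "w \<in> S" for w using that unfolding N_space by blast
        hence "?I i \<inter> S = {}" by (auto simp: level_set_def)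
        thus "e i = 0" by (simp add: e_def G0 Bochner_Integration.simple_bochner_integral_def image_constant_conv)
      qed
    qed
    also have "(\<Sum>i\<in>q ` space N. e i) \<le> \<epsilon> / 2"
      using s_close[OF qN] by (simp add: e_def IN approximation_error_def)
    also have "(\<Sum>i\<in>q ` space M. norm (G (?I i \<inter> (space M - S)))) \<le> \<epsilon> / 2"
    proof -
      have inj: "inj_on ?I (q ` space M)" by (rule inj_onI) (auto simp: level_set_def)
      have "ennreal (\<Sum>i\<in>q ` space M. norm (G (?I i \<inter> (space M - S))))
          = (\<Sum>B\<in>?I ` q ` space M. ennreal (norm (G (B \<inter> (space M - S)))))"
        by (simp add: sum.reindex[OF inj] sum_ennreal)
      also have "\<dots> \<le> variation M G (space M - S)"
        using I S fin by (intro sum_image_Int_le_variation G0) (auto simp: disjoint_def level_set_def)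
      also note rest
      finally show ?thesis using \<epsilon>2 by (simp add: ennreal_le_iff)
    qed
    finally show ?thesis by simp
  qed
  ultimately show ?thesis by blast
qed

text \<open>Simple functions whose errors decay geometrically are Cauchy in L1, since on the level
  sets of their difference the norm of the integral is the integral of the norm. Their increments
  are summable almost everywhere, and Fatou identifies the limit as the density.\<close>

lemma radon_nikodym_property_wrt_if_separable_dual:
  assumes sep: "separable_subspaces_have_separable_dual TYPE('a::banach)" and M: "finite_measure M"
  shows "radon_nikodym_property_wrt M TYPE('a \<Rightarrow>\<^sub>L real)"
  unfolding radon_nikodym_property_wrt_def
proof (intro allI impI)
  interpret finite_measure M by fact
  fix G :: "'b set \<Rightarrow> ('a \<Rightarrow>\<^sub>L real)"
  assume G: "vector_measure M G" and tv: "total_variation M G < \<infinity>" and cont: "continuous_wrt_measure M G"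
  have "\<forall>n::nat. \<exists>t. simple_function M t \<and> (\<forall>q :: 'b \<Rightarrow> nat. simple_function M q \<longrightarrow>
    approximation_error M G t q \<le> (1 / 2) ^ n)"
    using vector_measure_approximable[OF sep M G tv cont] by simp
  from choice[OF this] obtain t where t: "\<And>n. simple_function M (t n)"
    and t_close: "\<And>n (q :: 'b \<Rightarrow> nat). simple_function M q \<Longrightarrow> approximation_error M G (t n) q \<le> (1 / 2) ^ n"
    by blast
  have ind: "simple_function M (\<lambda>w. indicat_real E w *\<^sub>R s w)"
    if "E \<in> sets M" "simple_function M s" for E and s :: "'b \<Rightarrow> ('a \<Rightarrow>\<^sub>L real)"
    using simple_function_compose2[OF simple_function_indicator[OF that(1)] that(2), of "\<lambda>x y. x *\<^sub>R y"] .
  have L1: "(\<integral>\<^sup>+w. ennreal (norm (t m w - t n w)) \<partial>M) \<le> ennreal ((1 / 2) ^ m + (1 / 2) ^ n)" for m n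
  proof -
    define v where "v w = t m w - t n w" for w
    have v: "simple_function M v" unfolding v_def by (rule simple_function_compose2[OF t t])
    have fin_w: "finite (v ` space M)" using v by (simp add: simple_function_def)
    \<comment> \<open>Labelling the finitely many values of \<open>v\<close> by natural numbers
      makes \<open>v\<close> constant on each cell, so that nothing is lost in the triangle
      inequality for integrals.\<close>
    define q where "q w = to_nat_on (v ` space M) (v w)" for w
    have q: "simple_function M q" unfolding q_def by (rule simple_function_compose1[OF v])
    have q_w: "v w = v w'" if "q w = q w'" "w \<in> space M" "w' \<in> space M" for w w'
      using that inj_on_to_nat_on[OF countable_finite[OF fin_w]] by (auto simp: q_def dest: inj_onD)
    let ?I = "level_set M q"
    have I: "?I i \<in> sets M" for i by (rule level_set_sets[OF q])
    have "(\<integral>w. norm (v w) \<partial>M) = (\<Sum>i\<in>q ` space M. \<integral>w. indicator (?I i) w * norm (v w) \<partial>M)"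
      by (rule integral_eq_sum_level_sets[OF q integrable_simple[OF simple_function_compose1[OF v]]])
    also have "\<dots> = (\<Sum>i\<in>q ` space M. norm (sb_integral_on M (?I i) (t m)
        - sb_integral_on M (?I i) (t n)))"
    proof (intro sum.cong refl)
      fix i assume "i \<in> q ` space M"
      then obtain w0 where w0: "w0 \<in> space M" "i = q w0" by blast
      have w0: "v w = v w0" if "w \<in> ?I i" for w
        by (rule q_w) (use that w0 in \<open>simp_all add: level_set_def\<close>)
      have ind_real: "simple_function M (indicat_real (?I i))" using I by simp
      have I_space: "?I i \<inter> space M = ?I i" by (auto simp: level_set_def)
      have "(\<integral>w. indicator (?I i) w * norm (v w) \<partial>M) = (\<integral>w. indicator (?I i) w * norm (v w0) \<partial>M)"
        using w0 by (intro Bochner_Integration.integral_cong) (auto simp: indicator_def)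
      also have "\<dots> = measure M (?I i) * norm (v w0)" by (simp add: I_space)
      also have "\<dots> = norm (measure M (?I i) *\<^sub>R v w0)" by simp
      also have "measure M (?I i) *\<^sub>R v w0 = sb_integral M (indicat_real (?I i)) *\<^sub>R v w0"
        by (simp add: sb_integral_real[OF ind_real] I_space)
      also have "\<dots> = sb_integral M (\<lambda>w. indicator (?I i) w *\<^sub>R v w0)"
        by (rule simple_bochner_integral_linear[of "\<lambda>x. x *\<^sub>R v w0", OF _ sb_integrable[OF ind_real], symmetric])
           (auto intro!: linearI simp: scaleR_add_left)
      also have "\<dots> = sb_integral M (\<lambda>w. indicator (?I i) w *\<^sub>R t m w - indicator (?I i) w *\<^sub>R t n w)"
        using w0 by (intro sb_integral_cong) (auto simp: indicator_def v_def)
      also have "\<dots> = sb_integral_on M (?I i) (t m) - sb_integral_on M (?I i) (t n)"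
        by (rule simple_bochner_integral_diff[OF sb_integrable[OF ind[OF I t]] sb_integrable[OF ind[OF I t]]])
      finally show "(\<integral>w. indicator (?I i) w * norm (v w) \<partial>M) = norm (sb_integral_on M (?I i) (t m)
        - sb_integral_on M (?I i) (t n))" .
    qed
    also have "\<dots> \<le> (\<Sum>i\<in>q ` space M. norm (G (?I i) - sb_integral_on M (?I i) (t m))
        + norm (G (?I i) - sb_integral_on M (?I i) (t n)))"
    proof (intro sum_mono)
      have "norm (x - y) \<le> norm (z - x) + norm (z - y)" for x y z :: "'a \<Rightarrow>\<^sub>L real"
        using norm_triangle_ineq4[of "z - y" "z - x"] by simp
      thus "norm (sb_integral_on M (?I i) (t m) - sb_integral_on M (?I i) (t n))
          \<le> norm (G (?I i) - sb_integral_on M (?I i) (t m))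
          + norm (G (?I i) - sb_integral_on M (?I i) (t n))" for i .
    qed
    also have "\<dots> \<le> (1 / 2) ^ m + (1 / 2) ^ n"
      unfolding sum.distrib by (intro add_mono t_close[OF q, unfolded approximation_error_def])
    finally have "(\<integral>w. norm (v w) \<partial>M) \<le> (1 / 2) ^ m + (1 / 2) ^ n" .
    thus ?thesis
      using integrable_simple[OF simple_function_compose1[OF v, of norm]]
      by (subst nn_integral_eq_integral) (auto simp: v_def simp del: ennreal_plus intro!: ennreal_leI)
  qed
  have "AE w in M. summable (\<lambda>n. norm (t (Suc n) w - t n w))"
  proof (rule AE_summable_of_summable_integrals[OF borel_measurable_norm_diff_simple[OF t t] L1])
    show "summable (\<lambda>n. (1 / 2 :: real) ^ Suc n + (1 / 2) ^ n)"
      by (intro summable_add summable_geometric) (auto intro!: summable_mult summable_geometric)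
  qed auto
  hence t_conv: "AE w in M. convergent (\<lambda>n. t n w)"
    by eventually_elim (rule convergent_if_summable_increments)
  define g where "g w = lim (\<lambda>n. t n w)" for w
  have t_lim: "AE w in M. (\<lambda>n. t n w) \<longlonglongrightarrow> g w"
    using t_conv by eventually_elim (simp add: g_def convergent_LIMSEQ_iff)
  have int: "has_strong_bochner_integral M (\<lambda>w. indicator E w *\<^sub>R g w) (G E)" if E: "E \<in> sets M" for E
    unfolding has_strong_bochner_integral_def
  proof (intro conjI exI[of _ "\<lambda>n w. indicator E w *\<^sub>R t n w"] allI)
    show "strongly_measurable M (\<lambda>w. indicator E w *\<^sub>R g w)"
      unfolding strongly_measurable_def
    proof (intro exI[of _ "\<lambda>n w. indicator E w *\<^sub>R t n w"] conjI allI ind[OF E t])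
      show "AE w in M. (\<lambda>n. indicator E w *\<^sub>R t n w) \<longlonglongrightarrow> indicator E w *\<^sub>R g w"
        using t_lim by eventually_elim (intro tendsto_intros)
    qed
    show "sb_integrable M (\<lambda>w. indicator E w *\<^sub>R t n w)" for n by (rule sb_integrable[OF ind[OF E t]])
    show "(\<lambda>n. \<integral>\<^sup>+w. ennreal (norm (indicator E w *\<^sub>R g w - indicator E w *\<^sub>R t n w)) \<partial>M) \<longlonglongrightarrow> 0"
    proof (rule tendsto_sandwich[OF _ _ tendsto_const])
      have "(\<integral>\<^sup>+w. ennreal (norm (indicator E w *\<^sub>R g w - indicator E w *\<^sub>R t n w)) \<partial>M) \<le> ennreal (2 * (1 / 2) ^ n)" for n
      proof -
        have "(\<integral>\<^sup>+w. ennreal (norm (indicator E w *\<^sub>R g w - indicator E w *\<^sub>R t n w)) \<partial>M)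
            \<le> (\<integral>\<^sup>+w. liminf (\<lambda>m. ennreal (norm (t m w - t n w))) \<partial>M)"
        proof (rule nn_integral_mono_AE)
          show "AE w in M. ennreal (norm (indicator E w *\<^sub>R g w - indicator E w *\<^sub>R t n w))
              \<le> liminf (\<lambda>m. ennreal (norm (t m w - t n w)))"
            using t_lim
          proof eventually_elim
            case (elim w)
            have "(\<lambda>m. ennreal (norm (t m w - t n w))) \<longlonglongrightarrow> ennreal (norm (g w - t n w))"
              by (intro tendsto_intros elim)
            hence "liminf (\<lambda>m. ennreal (norm (t m w - t n w))) = ennreal (norm (g w - t n w))"
              by (intro lim_imp_Liminf) auto
            moreover have "norm (indicator E w *\<^sub>R g w - indicator E w *\<^sub>R t n w) \<le> norm (g w - t n w)"
              by (auto simp: indicator_def)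
            ultimately show ?case by (simp add: ennreal_leI)
          qed
        qed
        also have "\<dots> \<le> liminf (\<lambda>m. \<integral>\<^sup>+w. ennreal (norm (t m w - t n w)) \<partial>M)"
          using borel_measurable_norm_diff_simple[OF t t] by (intro nn_integral_liminf) auto
        also have "\<dots> \<le> ennreal (2 * (1 / 2) ^ n)"
        proof (rule Liminf_le)
          have "eventually (\<lambda>m. (\<integral>\<^sup>+w. ennreal (norm (t m w - t n w)) \<partial>M) \<le> ennreal (2 * (1 / 2) ^ n)) sequentially"
            using eventually_ge_at_top[of n]
          proof eventually_elim
            case (elim m)
            hence "(1 / 2 :: real) ^ m \<le> (1 / 2) ^ n" by (intro power_decreasing) auto
            thus ?case by (intro order_trans[OF L1] ennreal_leI) simp
          qed
          thus "eventually (\<lambda>m. (\<integral>\<^sup>+w. ennreal (norm (t m w - t n w)) \<partial>M) \<le> ennreal (2 * (1 / 2) ^ n)) sequentially" .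
        qed simp
        finally show ?thesis .
      qed
      thus "eventually (\<lambda>n. (\<integral>\<^sup>+w. ennreal (norm (indicator E w *\<^sub>R g w - indicator E w *\<^sub>R t n w)) \<partial>M)
          \<le> ennreal (2 * (1 / 2) ^ n)) sequentially" by simp
      have "(\<lambda>n. 2 * (1 / 2 :: real) ^ n) \<longlonglongrightarrow> 2 * 0" by (intro tendsto_intros LIMSEQ_realpow_zero) auto
      thus "(\<lambda>n. ennreal (2 * (1 / 2) ^ n)) \<longlonglongrightarrow> 0" using tendsto_ennrealI by fastforce
    qed simp
    show "(\<lambda>n. sb_integral_on M E (t n)) \<longlonglongrightarrow> G E"
    proof (rule LIMSEQ_I, goal_cases)
      case (1 e)
      have le: "norm (G E - sb_integral_on M E (t n)) \<le> (1 / 2) ^ n" for n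
      \<comment> \<open>For nonempty \<open>E\<close> the error is one term of the sum for the
        partition into \<open>E\<close> and its complement. The empty set is separate because the
        label 1 does not occur then.\<close>
      proof (cases "E = {}")
        case True
        thus ?thesis
          by (simp add: vector_measure_empty[OF G] Bochner_Integration.simple_bochner_integral_def image_constant_conv)
      next
        case False
        define q :: "'b \<Rightarrow> nat" where "q w = indicator E w" for w
        have q: "simple_function M q" unfolding q_def using E by simp
        have lev: "level_set M q 1 = E" using sets.sets_into_space[OF E] by (auto simp: level_set_def q_def indicator_def)
        have "1 \<in> q ` space M" using False sets.sets_into_space[OF E] by (force simp: q_def indicator_def image_iff)
        hence "norm (G (level_set M q 1) - sb_integral_on M (level_set M q 1) (t n)) \<le>
            approximation_error M G (t n) q"
          using q unfolding approximation_error_def by (intro member_le_sum) (auto simp: simple_function_def)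
        thus ?thesis using t_close[OF q, of n] unfolding lev by linarith
      qed
      obtain n0 where n0: "(1 / 2 :: real) ^ n0 < e" using real_arch_pow_inv[OF 1, of "1 / 2"] by auto
      have "norm (sb_integral_on M E (t n) - G E) < e" if "n \<ge> n0" for n
      proof -
        have "(1 / 2 :: real) ^ n \<le> (1 / 2) ^ n0" using that by (intro power_decreasing) auto
        thus ?thesis using le[of n] n0 unfolding norm_minus_commute[of _ "G E"] by linarith
      qed
      thus ?case by blast
    qed
  qed
  have "has_strong_bochner_integral M g (G (space M))"
  proof -
    have "strongly_measurable M g" using t t_lim unfolding strongly_measurable_def by blast
    moreover have "(\<integral>\<^sup>+w. ennreal (norm (indicator (space M) w *\<^sub>R g w - s w)) \<partial>M) = (\<integral>\<^sup>+w. ennreal (norm (g w - s w)) \<partial>M)"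
      for s :: "'b \<Rightarrow> ('a \<Rightarrow>\<^sub>L real)" by (intro nn_integral_cong) simp
    ultimately show ?thesis using int[OF sets.top] unfolding has_strong_bochner_integral_def by simp
  qed
  thus "\<exists>g. (\<exists>x. has_strong_bochner_integral M g x) \<and>
      (\<forall>E\<in>sets M. has_strong_bochner_integral M (\<lambda>w. indicator E w *\<^sub>R g w) (G E))"
    using int by blast
qed

theorem theorem3p2:
  assumes "(UNIV :: real set) \<lesssim> (UNIV :: 'c set)"
  shows "(radon_nikodym_property TYPE('c) TYPE('a::banach \<Rightarrow>\<^sub>L real) \<longleftrightarrow> property_A_inf' TYPE('a)) \<and>
         (property_A_inf' TYPE('a) \<longleftrightarrow> property_A_inf TYPE('a)) \<and>
         (property_A_inf TYPE('a) \<longleftrightarrow> property_B_inf TYPE('a))"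
proof -
  let ?sep = "separable_subspaces_have_separable_dual TYPE('a)"
  have "radon_nikodym_property TYPE('c) TYPE('a \<Rightarrow>\<^sub>L real) \<longleftrightarrow> ?sep"
    using separable_dual_if_radon_nikodym[OF assms] radon_nikodym_property_wrt_if_separable_dual
    unfolding radon_nikodym_property_def by blast
  moreover have "property_A_inf' TYPE('a) \<longleftrightarrow> ?sep"
    using property_A_inf'_if_separable_dual property_A_inf_if_property_A_inf'
      separable_dual_if_property_A_inf by blast
  moreover have "property_A_inf TYPE('a) \<longleftrightarrow> ?sep"
    using property_A_inf'_if_separable_dual property_A_inf_if_property_A_inf'
      separable_dual_if_property_A_inf by blast
  moreover have "property_B_inf TYPE('a) \<longleftrightarrow> ?sep"
    using property_B_inf_if_separable_dual property_A_inf_if_property_B_inf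
      separable_dual_if_property_A_inf by blast
  ultimately show ?thesis by blast
qed

end
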